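(* Let $K\subset\mathbb{R}^n$, $n\ge 3$, be a centrally symmetric and strictly convex body with center at the origin $O$, and let $B\subset \operatorname{int}K$ be a ball with $O\notin B$. Suppose that: 1) $K$ satisfies the Barker-Larman condition with respect to $B$; and 2) $B$ is suitable for $K$. Then $K$ is an ellipsoid.
   Context: A convex body in $\mathbb{R}^n$ is a compact convex set with nonempty interior; it is strictly convex if its boundary contains no line segment. A set $C$ is centrally symmetric if some translate of it is symmetric with respect to the origin, i.e. $C$ and $-C$ are translates of each other. Balls are closed Euclidean balls of positive radius. Barker-Larman condition: $K$ satisfies the Barker-Larman condition with respect to a ball $B\subset\operatorname{int}K$ if for every support hyperplane $\Pi$ of $B$ the section $\Pi\cap K$ is centrally symmetric. Suitable: Let $K$ be a convex body symmetric about the origin $O$ and $B\subset\operatorname{int}K$ a ball with $O\notin B$. Put $G:=\operatorname{conv}[B\cup(-B)]$. The ball $B$ is suitable for $K$ if for every support hyperplane $\Gamma$ of $G$ one has $B\subset\operatorname{conv}(K_\Gamma\cup K_{-\Gamma})$, where $K_\Gamma:=\Gamma\cap K$ and $K_{-\Gamma}:=(-\Gamma)\cap K$. *)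

theory Defs
  imports "HOL-Analysis.Analysis"
begin

definition convex_body :: "'a::euclidean_space set \<Rightarrow> bool" where
  "convex_body K \<longleftrightarrow> compact K \<and> convex K \<and> interior K \<noteq> {}"

(* Only nondegenerate segments (two distinct endpoints) are forbidden. *)
definition strictly_convex_body :: "'a::euclidean_space set \<Rightarrow> bool" where
  "strictly_convex_body K \<longleftrightarrow>
     convex_body K \<and> \<not> (\<exists>x y. x \<noteq> y \<and> closed_segment x y \<subseteq> frontier K)"

definition symmetric_about_origin :: "'a::real_vector set \<Rightarrow> bool" where
  "symmetric_about_origin C \<longleftrightarrow> uminus ` C = C"

definition centrally_symmetric :: "'a::real_vector set \<Rightarrow> bool" where
  "centrally_symmetric C \<longleftrightarrow> (\<exists>t. symmetric_about_origin ((+) t ` C))"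

definition support_hyperplane :: "'a::real_inner set \<Rightarrow> 'a set \<Rightarrow> bool" where
  "support_hyperplane S H \<longleftrightarrow>
     (\<exists>a b. a \<noteq> 0 \<and> H = {x. a \<bullet> x = b} \<and> S \<subseteq> {x. a \<bullet> x \<le> b} \<and> H \<inter> S \<noteq> {})"

definition Barker_Larman :: "'a::euclidean_space set \<Rightarrow> 'a set \<Rightarrow> bool" where
  "Barker_Larman K B \<longleftrightarrow>
     (\<forall>H. support_hyperplane B H \<longrightarrow> centrally_symmetric (H \<inter> K))"

definition suitable :: "'a::euclidean_space set \<Rightarrow> 'a set \<Rightarrow> bool" where
  "suitable K B \<longleftrightarrow>
     (\<forall>H. support_hyperplane (convex hull (B \<union> uminus ` B)) H \<longrightarrow>
          B \<subseteq> convex hull ((H \<inter> K) \<union> (uminus ` H \<inter> K)))"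

(* Nondegenerate (full-dimensional) ellipsoids with arbitrary centre. *)
definition ellipsoid :: "'a::euclidean_space set \<Rightarrow> bool" where
  "ellipsoid E \<longleftrightarrow> (\<exists>c (f :: 'a \<Rightarrow> 'a). linear f \<and> bij f \<and> E = (\<lambda>x. c + f x) ` cball 0 1)"

end

theory Submission
  imports Defs
begin

text \<open>
Let \<open>h\<close> be the support function of \<open>B\<close> and \<open>c(u)\<close> the centre of the section of \<open>K\<close> by the support
hyperplane of \<open>B\<close> with outer normal \<open>u\<close>. Suitability and strict convexity give the duality
\<open>v \<bullet> c(u) = 0 \<Longrightarrow> u \<bullet> c(v) = 0\<close> for \<open>u \<bullet> p \<ge> 0 > v \<bullet> p\<close>, where \<open>p\<close> is the centre of \<open>B\<close>; the converse
follows by an intermediate value argument on half circles. Hence \<open>c\<close>, read projectively, is a collineation on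
an open cone of normals, so it is linear there, and by duality everywhere:
\<open>c(u) = h(u) / (u \<bullet> A u) A u\<close> with \<open>A\<close> symmetric and positive definite.

With respect to the quadratic form \<open>q\<close> of \<open>A\<^sup>-\<^sup>1\<close> the centre of each tangent section is then the foot of the
perpendicular from the origin, so \<open>K\<close> is invariant under the point reflections of the tangent sections, and
these preserve \<open>q\<close>. Let \<open>m\<close> be the maximum of \<open>q\<close> on \<open>K\<close> and \<open>M\<close> the part of \<open>K\<close> on the level set
\<open>q = m\<close>. If \<open>M\<close> is not the whole level set, consider a point of \<open>M\<close> nearest to a point outside: the first-order
condition along its reflected images is a cubic identity which, because \<open>B\<close> is a Euclidean ball, confines
nearest points to finitely many lines through \<open>p\<close>. But finitely many points do not separate the level set,
and \<open>M\<close> is infinite.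
\<close>

section \<open>Sections by support hyperplanes of the ball\<close>

text \<open>Suitability constrains only the support hyperplanes of the hull of B and -B, and up to
  sign these have normals u with u \<bullet> p \<ge> 0. The duality therefore never compares two
  normals on the same side of the hyperplane orthogonal to p, and a symmetric polarity is not
  visible at once. The collineation yields a linear \<open>A\<close> on the side v \<bullet> p < 0,
  while the other side sees the adjoint \<open>T\<close> of \<open>A\<close>. The two maps meet
  where u \<bullet> p = 0: there the centre is parallel to both \<open>A u\<close> and
  \<open>T u\<close>, and this forces A = T. In the second half, the point reflection of a tangent
  section is the restriction of a half-turn about the line through \<open>A w\<close>. It is known
  to preserve K only on that one hyperplane, so the half-turns cannot be composed freely, and no
  transitive group is at hand. A nearest point takes its place: the normals of the tangent
  hyperplanes through a point of M form a sphere, the first-order condition is cubic in the normal,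
  and a cubic that vanishes on a sphere is very rigid.\<close>

text \<open>\<open>strictly_convex_body\<close> only says that no whole segment lies in the
  frontier. This gives one interior point on the segment, and every other point of the open segment
  lies between it and an endpoint.\<close>

lemma strictly_convex_interior:
  fixes K :: "'a::euclidean_space set"
  assumes "strictly_convex_body K" "x \<in> K" "y \<in> K" "x \<noteq> y" "z \<in> open_segment x y"
  shows "z \<in> interior K"
proof -
  have K: "compact K" "convex K" and seg: "\<not> closed_segment x y \<subseteq> frontier K"
    using assms unfolding strictly_convex_body_def convex_body_def by auto
  have sub: "closed_segment x y \<subseteq> K"
    using K assms by (simp add: closed_segment_subset)
  have "closure K = K" using K by (simp add: compact_imp_closed)
  then obtain w where w: "w \<in> closed_segment x y" "w \<in> interior K"
    using seg sub unfolding frontier_def by auto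
  show ?thesis
  proof (cases "z = w")
    case False
    have "closed_segment x y = closed_segment x w \<union> closed_segment w y"
      by (rule Un_closed_segment[OF w(1), symmetric])
    moreover have "z \<in> closed_segment x y" "z \<noteq> x" "z \<noteq> y"
      using assms(5) by (auto simp: open_segment_def)
    ultimately have "z \<in> open_segment w x \<or> z \<in> open_segment w y"
      using False by (auto simp: open_segment_def closed_segment_commute)
    moreover have "x \<in> closure K" "y \<in> closure K"
      using assms closure_subset by auto
    ultimately show ?thesis
      using in_interior_closure_convex_segment[OF K(2) w(2)] by blast
  qed (use w in simp)
qed

lemma orthogonal_exists:
  fixes S :: "'a::euclidean_space set"
  assumes "finite S" "card S < DIM('a)"
  shows "\<exists>x. x \<noteq> 0 \<and> (\<forall>y\<in>S. x \<bullet> y = 0)"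
proof -
  have d: "dim S < DIM('a)"
    using dim_le_card'[OF assms(1)] assms(2) by linarith
  have "\<exists>x. x \<noteq> 0 \<and> (\<forall>y\<in>span S. orthogonal x y)"
    by (rule orthogonal_to_subspace_exists[OF d]) blast
  then show ?thesis
    by (auto simp: orthogonal_def span_base)
qed

text \<open>Most uses of dimension at least 3 go through this common orthogonal vector.\<close>

lemma orthogonal_exists2:
  fixes a b :: "'a::euclidean_space"
  assumes "3 \<le> DIM('a)"
  shows "\<exists>x. x \<noteq> 0 \<and> x \<bullet> a = 0 \<and> x \<bullet> b = 0"
proof -
  have "card {a,b} < DIM('a)" using assms by (auto simp: card_insert_if)
  then show ?thesis using orthogonal_exists[of "{a,b}"] by simp
qed

lemma interior_shift:
  fixes x :: "'a::real_normed_vector"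
  assumes "x \<in> interior K"
  shows "\<exists>\<epsilon>>0. x + \<epsilon> *\<^sub>R g \<in> interior K"
proof -
  have "((\<lambda>\<epsilon>. x + \<epsilon> *\<^sub>R g) \<longlongrightarrow> x + 0 *\<^sub>R g) (at_right 0)"
    by (intro tendsto_intros)
  then have "eventually (\<lambda>\<epsilon>. x + \<epsilon> *\<^sub>R g \<in> interior K) (at_right 0)"
    using assms by (auto intro: topological_tendstoD)
  then have "eventually (\<lambda>\<epsilon>. \<epsilon> > 0 \<and> x + \<epsilon> *\<^sub>R g \<in> interior K) (at_right 0)"
    using eventually_at_right_less[of "0::real"] by eventually_elim simp
  then show ?thesis using eventually_happens' trivial_limit_at_right_real by blast
qed

locale tangent_sections =
  fixes K :: "'a::euclidean_space set" and p :: 'a and r :: real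
  assumes dim3: "3 \<le> DIM('a)"
    and strict: "strictly_convex_body K"
    and sym: "symmetric_about_origin K"
    and r_pos: "r > 0"
    and ball_in: "cball p r \<subseteq> interior K"
    and origin_out: "0 \<notin> cball p r"
    and BL: "Barker_Larman K (cball p r)"
begin

text \<open>Normals are not normalised: \<open>h\<close>, \<open>sec\<close> and \<open>cen\<close>
  are used on cones of normals, where sums make sense. \<open>h\<close> is positively homogeneous
  and \<open>cen\<close> is constant on rays.\<close>

definition h :: "'a \<Rightarrow> real" where "h u = u \<bullet> p + r * norm u"

definition sec :: "'a \<Rightarrow> 'a set" where "sec u = {x. u \<bullet> x = h u} \<inter> K"

definition touch :: "'a \<Rightarrow> 'a" where "touch u = p + (r / norm u) *\<^sub>R u"

definition cen :: "'a \<Rightarrow> 'a" where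
  "cen u = (SOME c. \<forall>x\<in>sec u. 2 *\<^sub>R c - x \<in> sec u)"

lemma compact_K: "compact K" and convex_K: "convex K" and closed_K: "closed K"
  using strict unfolding strictly_convex_body_def convex_body_def by (simp_all add: compact_imp_closed)

lemma uminus_K: "x \<in> K \<Longrightarrow> - x \<in> K"
  using sym unfolding symmetric_about_origin_def by blast

lemma p_ne_0: "p \<noteq> 0" and r_less_norm_p: "r < norm p"
  using origin_out r_pos by (auto simp: dist_norm)

lemma touch_in_ball: "u \<noteq> 0 \<Longrightarrow> touch u \<in> cball p r"
  using r_pos by (simp add: touch_def dist_norm)

lemma touch_interior: "u \<noteq> 0 \<Longrightarrow> touch u \<in> interior K"
  using touch_in_ball ball_in by blast

lemma inner_touch: "u \<noteq> 0 \<Longrightarrow> u \<bullet> touch u = h u"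
  by (simp add: touch_def h_def inner_add_right dot_square_norm power2_eq_square)

lemma touch_in_sec: "u \<noteq> 0 \<Longrightarrow> touch u \<in> sec u"
  using inner_touch touch_interior interior_subset by (auto simp: sec_def)

lemma ball_le_h: "x \<in> cball p r \<Longrightarrow> u \<bullet> x \<le> h u"
proof -
  assume "x \<in> cball p r"
  then have "norm (x - p) \<le> r" by (simp add: dist_norm norm_minus_commute)
  then have "u \<bullet> (x - p) \<le> norm u * r"
    by (meson norm_cauchy_schwarz mult_left_mono norm_ge_zero order_trans)
  then show ?thesis by (simp add: h_def inner_diff_right algebra_simps)
qed

lemma support_ball: "u \<noteq> 0 \<Longrightarrow> support_hyperplane (cball p r) {x. u \<bullet> x = h u}"
  unfolding support_hyperplane_def
  using ball_le_h inner_touch touch_in_ball by (intro exI[of _ u] exI[of _ "h u"]) blast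

lemma ex_cen: "u \<noteq> 0 \<Longrightarrow> \<exists>c. \<forall>x\<in>sec u. 2 *\<^sub>R c - x \<in> sec u"
proof -
  assume "u \<noteq> 0"
  then have "centrally_symmetric (sec u)"
    using BL support_ball unfolding Barker_Larman_def sec_def by blast
  then obtain t where t: "uminus ` ((+) t ` sec u) = (+) t ` sec u"
    unfolding centrally_symmetric_def symmetric_about_origin_def by blast
  have "2 *\<^sub>R (- t) - x \<in> sec u" if "x \<in> sec u" for x
  proof -
    have "- (t + x) \<in> (+) t ` sec u" using that by (subst t[symmetric]) blast
    then obtain x' where x': "x' \<in> sec u" "- (t + x) = t + x'" by blast
    from x'(2) have "x' = - (t + x) - t" by simp
    then have "2 *\<^sub>R (- t) - x = x'" by (simp add: scaleR_2)
    with x' show ?thesis by simp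
  qed
  then show ?thesis by blast
qed

lemma reflect_cen: "u \<noteq> 0 \<Longrightarrow> x \<in> sec u \<Longrightarrow> 2 *\<^sub>R cen u - x \<in> sec u"
  using someI_ex[OF ex_cen] unfolding cen_def by blast

lemma compact_sec: "compact (sec u)"
  unfolding sec_def using closed_Int_compact closed_hyperplane compact_K by blast

lemma convex_sec: "convex (sec u)"
  unfolding sec_def by (intro convex_Int convex_hyperplane convex_K)

text \<open>Composing the reflections in two centres translates the section into itself by twice
  their difference, which is impossible for a compact set.\<close>

lemma cen_unique:
  assumes "u \<noteq> 0" and c: "\<And>x. x \<in> sec u \<Longrightarrow> 2 *\<^sub>R c - x \<in> sec u"
  shows "c = cen u"
proof (rule ccontr)
  assume ne: "c \<noteq> cen u"
  define d where "d = c - cen u"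
  have "\<exists>x\<in>sec u. \<forall>y\<in>sec u. d \<bullet> y \<le> d \<bullet> x"
    using touch_in_sec[OF assms(1)]
    by (intro continuous_attains_sup compact_sec continuous_intros) auto
  then obtain x where x: "x \<in> sec u" "\<And>y. y \<in> sec u \<Longrightarrow> d \<bullet> y \<le> d \<bullet> x" by blast
  have "2 *\<^sub>R c - (2 *\<^sub>R cen u - x) \<in> sec u"
    using c reflect_cen assms(1) x(1) by blast
  then have "d \<bullet> (2 *\<^sub>R c - (2 *\<^sub>R cen u - x)) \<le> d \<bullet> x" using x(2) by blast
  then have "2 * (d \<bullet> d) \<le> 0"
    by (simp add: d_def inner_diff_right inner_add_right)
  moreover have "d \<bullet> d > 0" using ne by (simp add: d_def)
  ultimately show False by simp
qed

lemma cen_in_sec: "u \<noteq> 0 \<Longrightarrow> cen u \<in> sec u"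
proof -
  assume u: "u \<noteq> 0"
  have "(1/2) *\<^sub>R touch u + (1/2) *\<^sub>R (2 *\<^sub>R cen u - touch u) \<in> sec u"
    using convexD[OF convex_sec touch_in_sec[OF u] reflect_cen[OF u touch_in_sec[OF u]], of "1/2" "1/2"]
    by simp
  then show ?thesis by (simp add: scaleR_right_diff_distrib)
qed

lemma inner_cen: "u \<noteq> 0 \<Longrightarrow> u \<bullet> cen u = h u" and cen_in_K: "u \<noteq> 0 \<Longrightarrow> cen u \<in> K"
  using cen_in_sec by (auto simp: sec_def)

lemma h_scale: "t > 0 \<Longrightarrow> h (t *\<^sub>R u) = t * h u"
  by (simp add: h_def algebra_simps)

lemma sec_scale: "t > 0 \<Longrightarrow> sec (t *\<^sub>R u) = sec u"
  by (auto simp: sec_def h_scale)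

lemma cen_scale: "t > 0 \<Longrightarrow> cen (t *\<^sub>R u) = cen u"
  by (simp add: cen_def sec_scale)

text \<open>When u \<bullet> p = 0, \<open>h u\<close> equals \<open>h (- u)\<close>, so the
  reflection in the origin exchanges the two sections.\<close>

lemma cen_uminus: "u \<noteq> 0 \<Longrightarrow> u \<bullet> p = 0 \<Longrightarrow> cen (- u) = - cen u"
proof -
  assume u: "u \<noteq> 0" "u \<bullet> p = 0"
  have sec: "x \<in> sec (- u) \<longleftrightarrow> - x \<in> sec u" for x
    using u uminus_K[of x] uminus_K[of "- x"] by (auto simp: sec_def h_def)
  have "2 *\<^sub>R (- cen u) - x \<in> sec (- u)" if "x \<in> sec (- u)" for x
  proof -
    have "2 *\<^sub>R cen u - (- x) \<in> sec u" using reflect_cen[OF u(1)] that sec by blast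
    moreover have "- (2 *\<^sub>R (- cen u) - x) = 2 *\<^sub>R cen u - (- x)" by simp
    ultimately show ?thesis by (simp only: sec)
  qed
  then show ?thesis using cen_unique[of "- u" "- cen u"] u by simp
qed

section \<open>Continuity of the section centre\<close>

text \<open>Lower semicontinuity of the sections: the orthogonal projections of x onto the nearby
  hyperplanes stay in K because x is interior. Frontier points are handled by the next
  lemma.\<close>

lemma sec_interior_limit:
  assumes u: "u \<noteq> 0" and x: "x \<in> sec u" "x \<in> interior K"
    and U: "U \<longlonglongrightarrow> u" "\<And>n. U n \<noteq> 0"
  obtains X where "X \<longlonglongrightarrow> x" "eventually (\<lambda>n. X n \<in> sec (U n)) sequentially"
proof -
  define X where "X n = x + ((h (U n) - U n \<bullet> x) / (U n \<bullet> U n)) *\<^sub>R U n" for n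
  have hU: "(\<lambda>n. h (U n)) \<longlonglongrightarrow> h u"
    unfolding h_def by (intro tendsto_intros U)
  have "X \<longlonglongrightarrow> x + ((h u - u \<bullet> x) / (u \<bullet> u)) *\<^sub>R u"
    unfolding X_def using u by (intro tendsto_intros U hU) auto
  then have lim: "X \<longlonglongrightarrow> x" using x by (simp add: sec_def)
  have "U n \<bullet> X n = h (U n)" for n
    using U(2)[of n] by (simp add: X_def inner_add_right)
  moreover have "eventually (\<lambda>n. X n \<in> interior K) sequentially"
    using lim x(2) by (simp add: topological_tendstoD)
  ultimately have "eventually (\<lambda>n. X n \<in> sec (U n)) sequentially"
    using interior_subset by (auto simp: sec_def elim!: eventually_mono)
  with lim show ?thesis by (rule that)
qed

text \<open>Every point of the section is a limit of points interior to K, obtained by pulling it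
  towards \<open>touch u\<close>, and the section is closed.\<close>

lemma reflect_interior_imp:
  assumes u: "u \<noteq> 0" and c: "\<And>x. x \<in> sec u \<Longrightarrow> x \<in> interior K \<Longrightarrow> 2 *\<^sub>R c - x \<in> sec u"
  shows "c = cen u"
proof (rule cen_unique[OF u])
  fix x assume x: "x \<in> sec u"
  \<comment> \<open>With \<open>n+2\<close> the weight of x lies strictly between 0 and 1 already
    for n = 0, so \<open>X n\<close> is in the open segment.\<close>
  define X where "X n = (1 - 1 / real (n+2)) *\<^sub>R x + (1 / real (n+2)) *\<^sub>R touch u" for n
  have ev: "2 *\<^sub>R c - X n \<in> sec u" for n
  proof (rule c)
    have XX: "X n = (1 - (1 - 1 / real (n+2))) *\<^sub>R touch u + (1 - 1 / real (n+2)) *\<^sub>R x"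
      by (simp add: X_def algebra_simps)
    show "X n \<in> sec u"
      unfolding X_def using x touch_in_sec[OF u]
      by (intro convexD[OF convex_sec]) auto
    show "X n \<in> interior K"
    proof (cases "x = touch u")
      case True
      then show ?thesis using touch_interior[OF u] by (simp add: X_def flip: scaleR_add_left)
    next
      case False
      have "X n \<in> open_segment (touch u) x"
        unfolding in_segment XX using False
        by (intro conjI exI[of _ "1 - 1 / real (n+2)"]) auto
      moreover have "x \<in> closure K" using x closure_subset by (auto simp: sec_def)
      ultimately show ?thesis
        using in_interior_closure_convex_segment[OF convex_K touch_interior[OF u]] by blast
    qed
  qed
  have t: "(\<lambda>n. 1 / real (n+2)) \<longlonglongrightarrow> 0"
    using LIMSEQ_ignore_initial_segment[OF lim_1_over_n[where 'a=real], of 2] by simp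
  have "(\<lambda>n. 2 *\<^sub>R c - X n) \<longlonglongrightarrow> 2 *\<^sub>R c - ((1 - 0) *\<^sub>R x + 0 *\<^sub>R touch u)"
    unfolding X_def by (intro tendsto_intros t)
  then have "(\<lambda>n. 2 *\<^sub>R c - X n) \<longlonglongrightarrow> 2 *\<^sub>R c - x" by simp
  then show "2 *\<^sub>R c - x \<in> sec u"
    by (rule Lim_in_closed_set[OF compact_imp_closed[OF compact_sec[of u]], rotated 2]) (use ev in auto)
qed

text \<open>The values lie in the compact set K, so a closed graph suffices: a limit of centres
  reflects the interior points of the limit section into that section, hence is its centre.\<close>

lemma continuous_cen: "continuous_on (- {0}) cen"
proof -
  have "closedin (top_of_set ((- {0}) \<times> K)) ((\<lambda>u. (u, cen u)) ` (- {0}))"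
    unfolding closedin_limpt islimpt_sequential
  proof (intro conjI allI impI)
    show "(\<lambda>u. (u, cen u)) ` (- {0}) \<subseteq> (- {0}) \<times> K" using cen_in_K by auto
    fix l
    assume "(\<exists>Y. (\<forall>n. Y n \<in> (\<lambda>u. (u, cen u)) ` (- {0}) - {l}) \<and> Y \<longlonglongrightarrow> l) \<and> l \<in> (- {0}) \<times> K"
    then obtain Y where Y: "(\<forall>n. Y n \<in> (\<lambda>u. (u, cen u)) ` (- {0}))" "Y \<longlonglongrightarrow> l" "l \<in> (- {0}) \<times> K"
      by blast
    define U where "U n = fst (Y n)" for n
    have U0: "U n \<noteq> 0" and YU: "Y n = (U n, cen (U n))" for n
      using Y(1)[rule_format, of n] by (auto simp: U_def)
    obtain u c where l: "l = (u, c)" by (cases l)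
    have u: "u \<noteq> 0" and limU: "U \<longlonglongrightarrow> u" and limc: "(\<lambda>n. cen (U n)) \<longlonglongrightarrow> c"
      using Y tendsto_fst[of Y l] tendsto_snd[of Y l] by (auto simp: l U_def[symmetric] YU)
    have "c = cen u"
    proof (rule reflect_interior_imp[OF u])
      fix x assume "x \<in> sec u" "x \<in> interior K"
      then obtain X where X: "X \<longlonglongrightarrow> x" "eventually (\<lambda>n. X n \<in> sec (U n)) sequentially"
        using sec_interior_limit[OF u _ _ limU U0] by blast
      have lim: "(\<lambda>n. 2 *\<^sub>R cen (U n) - X n) \<longlonglongrightarrow> 2 *\<^sub>R c - x"
        by (intro tendsto_intros X limc)
      have ev: "eventually (\<lambda>n. 2 *\<^sub>R cen (U n) - X n \<in> sec (U n)) sequentially"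
        using X(2) by eventually_elim (rule reflect_cen[OF U0])
      have "2 *\<^sub>R c - x \<in> K"
        by (rule Lim_in_closed_set[OF closed_K _ _ lim])
          (use ev in \<open>auto simp: sec_def elim: eventually_mono\<close>)
      moreover have "u \<bullet> (2 *\<^sub>R c - x) = h u"
      proof (rule tendsto_unique)
        show "(\<lambda>n. U n \<bullet> (2 *\<^sub>R cen (U n) - X n)) \<longlonglongrightarrow> u \<bullet> (2 *\<^sub>R c - x)"
          by (intro tendsto_intros lim limU)
        have "(\<lambda>n. h (U n)) \<longlonglongrightarrow> h u"
          unfolding h_def by (intro tendsto_intros limU)
        then show "(\<lambda>n. U n \<bullet> (2 *\<^sub>R cen (U n) - X n)) \<longlonglongrightarrow> h u"
          by (rule Lim_transform_eventually) (use ev in \<open>auto simp: sec_def elim: eventually_mono\<close>)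
      qed simp
      ultimately show "2 *\<^sub>R c - x \<in> sec u" by (simp add: sec_def)
    qed
    then show "l \<in> (\<lambda>u. (u, cen u)) ` (- {0})" using u l by auto
  qed
  moreover have "cen \<in> - {0} \<rightarrow> K" using cen_in_K by auto
  ultimately show ?thesis
    using continuous_closed_graph_eq[OF compact_K, of cen "- {0}"] by blast
qed

lemma tendsto_cen: "(f \<longlongrightarrow> u) F \<Longrightarrow> u \<noteq> 0 \<Longrightarrow> ((\<lambda>x. cen (f x)) \<longlongrightarrow> cen u) F"
  by (rule isCont_tendsto_compose[of u cen])
     (use continuous_cen in \<open>auto simp: continuous_on_eq_continuous_at open_Compl\<close>)


text \<open>If \<open>c\<close> is the centre of the section by \<open>\<Gamma>\<close>, then the section by \<open>-\<Gamma>\<close> is its translate by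
  \<open>-2c\<close>. A hyperplane \<open>H\<close> parallel to \<open>c\<close> therefore meets both in translates of one set; unless the
  centre of \<open>H \<inter> K\<close> lies half way between them, reflecting one of them through that centre gives three
  parallel congruent sections of \<open>H \<inter> K\<close>, which strict convexity forbids.\<close>

lemma polar_duality_aux:
  assumes v0: "v \<noteq> 0" and e: "u \<bullet> e > 0" "v \<bullet> e = 0"
    and shift: "\<And>x. x \<in> sec v \<Longrightarrow> u \<bullet> x = u \<bullet> e \<Longrightarrow> x - 2 *\<^sub>R e \<in> K"
    and two: "xa \<in> sec v" "u \<bullet> xa = u \<bullet> e" "ya \<in> sec v" "u \<bullet> ya = u \<bullet> e" "xa \<noteq> ya"
  shows "u \<bullet> cen v \<le> 0"
proof (rule ccontr)
  assume "\<not> u \<bullet> cen v \<le> 0"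
  then have pos: "u \<bullet> cen v > 0" by simp
  define X where "X = {x. u \<bullet> x = u \<bullet> e} \<inter> sec v"
  have X: "x \<in> X \<longleftrightarrow> x \<in> K \<and> u \<bullet> x = u \<bullet> e \<and> v \<bullet> x = h v" for x
    by (auto simp: X_def sec_def)
  have "compact X" unfolding X_def using compact_sec closed_hyperplane by blast
  then have cX: "compact (X \<times> X)" by (intro compact_Times)
  have two: "xa \<in> X" "ya \<in> X" "xa \<noteq> ya" using two by (auto simp: X_def)
  \<comment> \<open>The contradiction will be a pair of points of \<open>X\<close> farther apart
    than a diametral pair x, y.\<close>
  have "\<exists>z\<in>X \<times> X. \<forall>y\<in>X \<times> X. dist (fst y) (snd y) \<le> dist (fst z) (snd z)"
    by (intro continuous_attains_sup cX continuous_intros) (use two in auto)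
  then obtain x y where xy: "x \<in> X" "y \<in> X"
    and diam: "\<And>x' y'. x' \<in> X \<Longrightarrow> y' \<in> X \<Longrightarrow> dist x' y' \<le> dist x y" by fastforce
  have "x \<noteq> y"
    using diam[OF two(1,2)] two(3) by auto
  define g where "g = y - x"
  \<comment> \<open>The weight that places a convex combination of the levels - (u \<bullet> e) and
    2 (u \<bullet> cen v) + u \<bullet> e of the two outer copies at the level u \<bullet> e of
    \<open>X\<close>.\<close>
  define t where "t = (u \<bullet> e) / (u \<bullet> e + u \<bullet> cen v)"
  have t: "0 < t" "t < 1" using e(1) pos by (auto simp: t_def)
  define lo up where "lo a = a - 2 *\<^sub>R e" and "up a = 2 *\<^sub>R cen v - lo a" for a
  \<comment> \<open>\<open>up\<close> reverses differences, so exchanging x and y between the two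
    copies makes them add: \<open>mid y x\<close> and \<open>mid x y\<close> differ by exactly y -
    x. Both are interior to K, which leaves room to enlarge their distance.\<close>
  define mid where "mid a b = (1 - t) *\<^sub>R lo a + t *\<^sub>R up b" for a b
  have lo: "lo a \<in> K \<and> v \<bullet> lo a = h v \<and> u \<bullet> lo a = - (u \<bullet> e)" if "a \<in> X" for a
    using shift[of a] that e(2) by (auto simp: lo_def X sec_def inner_diff_right)
  have up: "up a \<in> K \<and> v \<bullet> up a = h v \<and> u \<bullet> up a = 2 * (u \<bullet> cen v) + u \<bullet> e" if "a \<in> X" for a
    using reflect_cen[OF v0, of "lo a"] lo[OF that]
    by (auto simp: sec_def up_def inner_diff_right)
  have mid: "mid a b \<in> interior K" "mid a b \<in> X" if "a \<in> X" "b \<in> X" for a b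
  proof -
    have "lo a \<noteq> up b"
      using lo[OF that(1)] up[OF that(2)] e(1) pos by auto
    moreover have "mid a b \<in> open_segment (lo a) (up b)"
      unfolding in_segment using calculation t by (auto simp: mid_def)
    ultimately show i: "mid a b \<in> interior K"
      using strictly_convex_interior[OF strict] lo[OF that(1)] up[OF that(2)] by blast
    have "u \<bullet> mid a b = (1 - t) * (- (u \<bullet> e)) + t * (2 * (u \<bullet> cen v) + u \<bullet> e)"
      using lo[OF that(1)] up[OF that(2)] by (simp add: mid_def inner_add_right)
    also have "\<dots> = u \<bullet> e"
    proof -
      have "t * (u \<bullet> e + u \<bullet> cen v) = u \<bullet> e" using e(1) pos by (simp add: t_def)
      then show ?thesis by (simp add: algebra_simps)
    qed
    finally have "u \<bullet> mid a b = u \<bullet> e" .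
    moreover have "v \<bullet> mid a b = (1 - t) * h v + t * h v"
      using lo[OF that(1)] up[OF that(2)] by (simp add: mid_def inner_add_right)
    ultimately show "mid a b \<in> X"
      using i interior_subset by (auto simp: X algebra_simps)
  qed
  have diff: "mid y x - mid x y = g"
    by (simp add: mid_def up_def lo_def g_def algebra_simps)
  obtain \<epsilon> where eps: "\<epsilon> > 0" "mid y x + \<epsilon> *\<^sub>R g \<in> interior K"
    using interior_shift[OF mid(1)[OF xy(2,1)]] by blast
  have "mid y x + \<epsilon> *\<^sub>R g \<in> X"
    using eps mid(2)[OF xy(2,1)] interior_subset xy by (auto simp: X g_def inner_add_right inner_diff_right)
  then have "dist (mid x y) (mid y x + \<epsilon> *\<^sub>R g) \<le> dist x y"
    by (rule diam[OF mid(2)[OF xy]])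
  also have "dist (mid x y) (mid y x + \<epsilon> *\<^sub>R g) = norm ((1 + \<epsilon>) *\<^sub>R g)"
    by (simp add: dist_norm norm_minus_commute[of "mid x y"] scaleR_add_left flip: diff)
      (simp add: algebra_simps)
  finally have "(1 + \<epsilon>) * norm g \<le> norm g" using eps by (simp add: g_def dist_norm norm_minus_commute)
  then show False using eps \<open>x \<noteq> y\<close> by (simp add: g_def algebra_simps mult_le_0_iff)
qed

end

section \<open>Suitability and the duality of centres\<close>

locale suitable_ball = tangent_sections +
  assumes suit: "suitable K (cball p r)"
begin

lemma h_pos: "u \<noteq> 0 \<Longrightarrow> u \<bullet> p \<ge> 0 \<Longrightarrow> h u > 0"
  using r_pos by (simp add: h_def add_nonneg_pos)

text \<open>The sign condition puts -B below the hyperplane as well. This is the source of the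
  half-space conditions in the duality.\<close>

lemma support_hull:
  assumes "u \<noteq> 0" "u \<bullet> p \<ge> 0"
  shows "support_hyperplane (convex hull (cball p r \<union> uminus ` cball p r)) {x. u \<bullet> x = h u}"
proof -
  have "u \<bullet> (- x) \<le> h u" if "x \<in> cball p r" for x
    using ball_le_h[OF that, of "- u"] assms by (simp add: h_def)
  then have "cball p r \<union> uminus ` cball p r \<subseteq> {x. u \<bullet> x \<le> h u}"
    using ball_le_h by blast
  then have "convex hull (cball p r \<union> uminus ` cball p r) \<subseteq> {x. u \<bullet> x \<le> h u}"
    by (intro hull_minimal convex_halfspace_le)
  moreover have "touch u \<in> {x. u \<bullet> x = h u} \<inter> convex hull (cball p r \<union> uminus ` cball p r)"
    using assms touch_in_ball[of u] by (auto simp: inner_touch intro!: hull_inc simp del: mem_cball)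
  ultimately show ?thesis
    unfolding support_hyperplane_def using assms by (intro exI[of _ u] exI[of _ "h u"]) blast
qed

text \<open>Suitability serves to show that the tangent hyperplane with normal v meets
  \<open>sec u\<close> in the interior of K. Then \<open>polar_duality_aux\<close>, applied to the
  sections by \<Gamma> and by -\<Gamma>, bounds u \<bullet> cen v from both sides.\<close>

lemma polar_duality:
  assumes u: "u \<noteq> 0" "u \<bullet> p \<ge> 0" and v: "v \<bullet> p < 0" and vc: "v \<bullet> cen u = 0"
  shows "u \<bullet> cen v = 0"
proof -
  have v0: "v \<noteq> 0" using v by auto
  note hu = h_pos[OF u]
  define \<Gamma> where "\<Gamma> = {x. u \<bullet> x = h u}"
  \<comment> \<open>The lowest point of B in direction v. It lies in the hull of the two sections,
    so one of them reaches at least as low.\<close>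
  define q where "q = touch (- v)"
  have q: "q \<in> cball p r" using touch_in_ball[of "- v"] v0 by (simp add: q_def)
  have vq: "v \<bullet> q = v \<bullet> p - r * norm v"
    using inner_touch[of "- v"] v0 by (simp add: q_def h_def)
  have "cball p r \<subseteq> convex hull ((\<Gamma> \<inter> K) \<union> (uminus ` \<Gamma> \<inter> K))"
    using suit support_hull[OF u] unfolding suitable_def \<Gamma>_def by blast
  then have qh: "q \<in> convex hull ((\<Gamma> \<inter> K) \<union> (uminus ` \<Gamma> \<inter> K))" using q by blast
  have "\<exists>x \<in> (\<Gamma> \<inter> K) \<union> (uminus ` \<Gamma> \<inter> K). v \<bullet> x \<le> v \<bullet> q"
  proof (rule ccontr)
    assume "\<not> ?thesis"
    then have "convex hull ((\<Gamma> \<inter> K) \<union> (uminus ` \<Gamma> \<inter> K)) \<subseteq> {x. v \<bullet> x > v \<bullet> q}"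
      by (intro hull_minimal convex_halfspace_gt) (use not_le in blast)
    then show False using qh by auto
  qed
  then obtain x where x: "x \<in> (\<Gamma> \<inter> K) \<union> (uminus ` \<Gamma> \<inter> K)" "v \<bullet> x \<le> v \<bullet> q" by blast
  \<comment> \<open>Since v \<bullet> cen u = 0, reflecting the section negates the v-levels:
    reaching low also means reaching high.\<close>
  have refl: "2 *\<^sub>R cen u - y \<in> sec u \<and> v \<bullet> (2 *\<^sub>R cen u - y) = - (v \<bullet> y)" if "y \<in> sec u" for y
    using reflect_cen[OF u(1) that] vc by (simp add: inner_diff_right)
  obtain x1 where x1: "x1 \<in> sec u" "v \<bullet> x1 \<le> v \<bullet> q"
  proof (cases "x \<in> \<Gamma>")
    case True
    then show ?thesis using x by (intro that[of x]) (auto simp: \<Gamma>_def sec_def)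
  next
    case False
    then have "- x \<in> sec u" using x uminus_K by (auto simp: \<Gamma>_def sec_def)
    from refl[OF this] show ?thesis using x(2) by (intro that[of "2 *\<^sub>R cen u - (- x)"]) auto
  qed
  define x2 where "x2 = 2 *\<^sub>R cen u - x1"
  have x2: "x2 \<in> sec u" "v \<bullet> x2 \<ge> - (v \<bullet> q)" using refl[OF x1(1)] x1(2) by (auto simp: x2_def)
  have rv: "r * norm v > 0" using r_pos v0 by simp
  \<comment> \<open>Here v \<bullet> p < 0 enters: - (v \<bullet> q) = - (v \<bullet> p) + r * norm
    v exceeds \<open>h v\<close>.\<close>
  have side1: "v \<bullet> x1 < h v" and side2: "h v < v \<bullet> x2"
    using x1(2) x2(2) vq rv v by (auto simp: h_def)
  \<comment> \<open>The level \<open>h v\<close> is crossed on the segment from the interior point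
    \<open>touch u\<close> to \<open>x1\<close> or \<open>x2\<close>, before that endpoint is
    reached.\<close>
  have *: "\<exists>i0. i0 \<in> interior K \<and> u \<bullet> i0 = h u \<and> v \<bullet> i0 = h v"
    if y: "y \<in> sec u" "v \<bullet> y \<noteq> h v" and t: "0 \<le> t" "t < 1"
      and eq: "(1 - t) * (v \<bullet> touch u) + t * (v \<bullet> y) = h v" for y t
  proof -
    define i0 where "i0 = (1 - t) *\<^sub>R touch u + t *\<^sub>R y"
    have "u \<bullet> i0 = (1 - t) * h u + t * h u"
      using y(1) by (simp add: i0_def inner_add_right inner_touch[OF u(1)] sec_def)
    then have "u \<bullet> i0 = h u" by (simp add: algebra_simps)
    moreover have "v \<bullet> i0 = h v" using eq by (simp add: i0_def inner_add_right)
    moreover have "i0 \<in> interior K"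
    proof (cases "t = 0 \<or> touch u = y")
      case True
      then have "i0 = touch u" by (auto simp: i0_def simp flip: scaleR_add_left)
      then show ?thesis using touch_interior[OF u(1)] by simp
    next
      case False
      then have "i0 \<in> open_segment (touch u) y"
        unfolding in_segment using t by (auto simp: i0_def intro!: exI[of _ t])
      moreover have "y \<in> closure K" using y closure_subset by (auto simp: sec_def)
      ultimately show ?thesis
        using in_interior_closure_convex_segment[OF convex_K touch_interior[OF u(1)]] by blast
    qed
    ultimately show ?thesis by blast
  qed
  have "\<exists>i0. i0 \<in> interior K \<and> u \<bullet> i0 = h u \<and> v \<bullet> i0 = h v"
  proof (cases "v \<bullet> touch u \<le> h v")
    case True
    define t where "t = (h v - v \<bullet> touch u) / (v \<bullet> x2 - v \<bullet> touch u)"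
    have "t * (v \<bullet> x2 - v \<bullet> touch u) = h v - v \<bullet> touch u" using True side2 by (simp add: t_def)
    then have "(1 - t) * (v \<bullet> touch u) + t * (v \<bullet> x2) = h v" by (simp add: algebra_simps)
    moreover have "0 \<le> t" "t < 1" using True side2 by (auto simp: t_def)
    ultimately show ?thesis using *[of x2 t] side2 x2(1) by simp
  next
    case False
    define t where "t = (v \<bullet> touch u - h v) / (v \<bullet> touch u - v \<bullet> x1)"
    have "t * (v \<bullet> touch u - v \<bullet> x1) = v \<bullet> touch u - h v" using False side1 by (simp add: t_def)
    then have "(1 - t) * (v \<bullet> touch u) + t * (v \<bullet> x1) = h v" by (simp add: algebra_simps)
    moreover have "0 \<le> t" "t < 1" using False side1 by (auto simp: t_def)
    ultimately show ?thesis using *[of x1 t] side1 x1(1) by simp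
  qed
  then obtain i0 where i0: "i0 \<in> interior K" "u \<bullet> i0 = h u" "v \<bullet> i0 = h v" by blast
  \<comment> \<open>Moving along f keeps both levels and produces the two distinct points that
    \<open>polar_duality_aux\<close> asks for.\<close>
  obtain f where f: "f \<noteq> 0" "f \<bullet> u = 0" "f \<bullet> v = 0"
    using orthogonal_exists2[OF dim3] by blast
  obtain \<epsilon> where e: "\<epsilon> > 0" "i0 + \<epsilon> *\<^sub>R f \<in> interior K"
    using interior_shift[OF i0(1)] by blast
  define j0 where "j0 = i0 + \<epsilon> *\<^sub>R f"
  have j0: "j0 \<in> K" "u \<bullet> j0 = h u" "v \<bullet> j0 = h v" "i0 \<noteq> j0" and i0K: "i0 \<in> K"
    using e f i0 interior_subset by (auto simp: j0_def inner_add_right inner_commute)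
  have uc: "u \<bullet> cen u = h u" by (rule inner_cen[OF u(1)])
  have tr: "x - 2 *\<^sub>R cen u \<in> K" if "x \<in> K" "u \<bullet> x = h u" for x
    using uminus_K[of "2 *\<^sub>R cen u - x"] reflect_cen[OF u(1), of x] that by (simp add: sec_def)
  have tr': "x + 2 *\<^sub>R cen u \<in> K" if "x \<in> K" "u \<bullet> x = - h u" for x
    using reflect_cen[OF u(1), of "- x"] uminus_K[of x] that by (simp add: sec_def add.commute)
  have "u \<bullet> cen v \<le> 0"
    by (rule polar_duality_aux[OF v0 _ vc, where xa=i0 and ya=j0])
      (use hu uc i0 j0 i0K tr in \<open>auto simp: sec_def\<close>)
  \<comment> \<open>The same argument seen from -\<Gamma>, whose section has centre
    \<open>- cen u\<close>.\<close>
  moreover have "(- u) \<bullet> cen v \<le> 0"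
    by (rule polar_duality_aux[OF v0, where e="- cen u" and xa="i0 - 2 *\<^sub>R cen u" and ya="j0 - 2 *\<^sub>R cen u"])
      (use hu uc vc i0 j0 i0K tr tr' in \<open>auto simp: sec_def inner_diff_right\<close>)
  ultimately show ?thesis by simp
qed

end

section \<open>Collineations of open cones\<close>

lemma in_span_orthogonal:
  fixes x :: "'a::euclidean_space"
  assumes "\<And>z. (\<And>y. y \<in> S \<Longrightarrow> z \<bullet> y = 0) \<Longrightarrow> z \<bullet> x = 0"
  shows "x \<in> span S"
proof -
  have "\<exists>y z. y \<in> span S \<and> (\<forall>w\<in>span S. orthogonal z w) \<and> x = y + z"
    by (rule orthogonal_subspace_decomp_exists[of S x]) blast
  then obtain y z where yz: "y \<in> span S" "\<And>w. w \<in> span S \<Longrightarrow> orthogonal z w" "x = y + z"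
    by blast
  have "z \<bullet> x = 0" using assms yz(2) by (simp add: orthogonal_def span_base)
  moreover have "z \<bullet> y = 0" using yz by (simp add: orthogonal_def)
  ultimately have "z = 0" using yz(3) by (simp add: inner_add_right)
  then show ?thesis using yz by simp
qed

lemma dim_open:
  fixes U :: "'a::euclidean_space set"
  assumes "open U" "U \<noteq> {}"
  shows "dim U = DIM('a)"
  using empty_interior_lowdim[of U] assms dim_subset_UNIV[of U]
  by (metis interior_open le_antisym not_le)

section \<open>Additive maps on the half line (Cauchy's functional equation) and on open
  cones\<close>

lemma additive_continuous_pos:
  fixes f :: "real \<Rightarrow> real"
  assumes add: "\<And>s t. s > 0 \<Longrightarrow> t > 0 \<Longrightarrow> f (s + t) = f s + f t"
    and cont: "continuous_on {0<..} f" and t: "t > 0"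
  shows "f t = t * f 1"
proof -
  have mult: "f (real (Suc n) * s) = real (Suc n) * f s" if "s > 0" for n s
  proof (induction n)
    case (Suc n)
    have "f (real (Suc (Suc n)) * s) = f (real (Suc n) * s + s)"
      by (simp add: algebra_simps)
    also have "\<dots> = f (real (Suc n) * s) + f s" using that by (intro add) auto
    finally show ?case using Suc by (simp add: algebra_simps)
  qed simp
  have rat: "f (real (Suc m) / real (Suc n)) = real (Suc m) / real (Suc n) * f 1" for m n
  proof -
    have "real (Suc n) * f (real (Suc m) / real (Suc n)) = f (real (Suc m) * 1)"
      by (subst mult[symmetric]) auto
    also have "\<dots> = real (Suc m) * f 1" by (rule mult) simp
    finally show ?thesis by (simp add: field_simps)
  qed
  \<comment> \<open>The outer \<open>Suc\<close> keeps the numerator positive, so that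
    \<open>rat\<close> applies; the approximation is from above.\<close>
  define q where "q n = real (Suc (nat \<lfloor>real (Suc n) * t\<rfloor>)) / real (Suc n)" for n
  have q: "q n \<le> t + 1 / real (Suc n)" "t \<le> q n" for n
  proof -
    have "real (nat \<lfloor>real (Suc n) * t\<rfloor>) = of_int \<lfloor>real (Suc n) * t\<rfloor>" using t by simp
    then have *: "real (Suc (nat \<lfloor>real (Suc n) * t\<rfloor>)) \<le> real (Suc n) * t + 1"
      "real (Suc n) * t \<le> real (Suc (nat \<lfloor>real (Suc n) * t\<rfloor>))"
      by linarith+
    have "q n \<le> (real (Suc n) * t + 1) / real (Suc n)"
      unfolding q_def by (intro divide_right_mono *) simp
    then show "q n \<le> t + 1 / real (Suc n)" by (simp add: add_divide_distrib)
    have "real (Suc n) * t / real (Suc n) \<le> q n"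
      unfolding q_def by (intro divide_right_mono *) simp
    then show "t \<le> q n" by simp
  qed
  have "(\<lambda>n. t + 1 / real (Suc n)) \<longlonglongrightarrow> t + 0"
    by (intro tendsto_intros LIMSEQ_Suc[OF lim_1_over_n])
  then have lim: "q \<longlonglongrightarrow> t"
    by (intro tendsto_sandwich[of "\<lambda>_. t" q _ "\<lambda>n. t + 1 / real (Suc n)"]) (use q in auto)
  have "isCont f t"
    using cont t by (simp add: continuous_on_eq_continuous_at)
  then have "(\<lambda>n. f (q n)) \<longlonglongrightarrow> f t" using lim by (rule isCont_tendsto_compose)
  moreover have "f (q n) = q n * f 1" for n unfolding q_def by (rule rat)
  ultimately have "(\<lambda>n. q n * f 1) \<longlonglongrightarrow> f t" by simp
  moreover have "(\<lambda>n. q n * f 1) \<longlonglongrightarrow> t * f 1" by (intro tendsto_intros lim)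
  ultimately show ?thesis by (rule LIMSEQ_unique)
qed

definition cone_set :: "'a::real_vector set \<Rightarrow> bool" where
  "cone_set W \<longleftrightarrow> (\<forall>x\<in>W. \<forall>y\<in>W. x + y \<in> W) \<and> (\<forall>x\<in>W. \<forall>t>0. t *\<^sub>R x \<in> W)"

lemma cone_set_sum:
  assumes W: "cone_set W" and "finite S" "S \<noteq> {}" and "\<And>b. b \<in> S \<Longrightarrow> x b \<in> W"
  shows "sum x S \<in> W"
  using assms(2-)
  by (induction S rule: finite_ne_induct) (use W in \<open>auto simp: cone_set_def\<close>)

text \<open>An open cone contains a basis, but the coordinates of a point of W may be negative.
  Adding a large positive combination of the basis makes all of them positive, and its value cancels
  afterwards.\<close>

lemma cone_additive_extends_linear:
  fixes F :: "'a::euclidean_space \<Rightarrow> 'b::real_vector"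
  assumes W: "open W" "W \<noteq> {}" "cone_set W"
    and add: "\<And>x y. x \<in> W \<Longrightarrow> y \<in> W \<Longrightarrow> F (x + y) = F x + F y"
    and scale: "\<And>x t. x \<in> W \<Longrightarrow> t > 0 \<Longrightarrow> F (t *\<^sub>R x) = t *\<^sub>R F x"
  shows "\<exists>A. linear A \<and> (\<forall>x\<in>W. F x = A x)"
proof -
  obtain B where B: "B \<subseteq> W" "independent B" "W \<subseteq> span B"
    using maximal_independent_subset_extend[of "{}" W] by (metis empty_subsetI independent_empty)
  have finB: "finite B" using B(2) by (rule independent_imp_finite)
  have "dim W = DIM('a)" using W by (intro dim_open)
  then have "dim B = DIM('a)" using B dim_subset[of W "span B"] dim_subset_UNIV[of B] by simp
  then have spanB: "span B = UNIV" by (simp add: dim_eq_full)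
  have Bne: "B \<noteq> {}"
    using \<open>dim B = DIM('a)\<close> by auto
  obtain A where A: "linear A" "\<And>b. b \<in> B \<Longrightarrow> A b = F b"
    using linear_independent_extend[OF B(2)] by blast
  have sumF: "F (sum x S) = (\<Sum>b\<in>S. F (x b))"
    if "finite S" "S \<noteq> {}" "\<And>b. b \<in> S \<Longrightarrow> x b \<in> W" for S and x :: "'a \<Rightarrow> 'a"
    using that
  proof (induction S rule: finite_ne_induct)
    case (insert b S)
    have "sum x S \<in> W" using insert by (intro cone_set_sum[OF W(3)]) auto
    then show ?case using insert by (simp add: add)
  qed simp
  have "F v = A v" if v: "v \<in> W" for v
  proof -
    have "v \<in> span B" using spanB by simp
    then obtain t where t: "v = (\<Sum>b\<in>B. t b *\<^sub>R b)"
      using span_finite[OF finB] by auto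
    \<comment> \<open>N exceeds every \<bar>t b\<bar>; the summand 1 makes the inequality
      strict.\<close>
    define N where "N = 1 + (\<Sum>b\<in>B. \<bar>t b\<bar>)"
    have Nt: "t b + N > 0" if "b \<in> B" for b
    proof -
      have "\<bar>t b\<bar> \<le> (\<Sum>b\<in>B. \<bar>t b\<bar>)" using that finB by (intro member_le_sum) auto
      then show ?thesis by (simp add: N_def)
    qed
    have N: "N > 0" unfolding N_def by (intro add_pos_nonneg sum_nonneg) auto
    have inW: "c *\<^sub>R b \<in> W" if "b \<in> B" "c > 0" for b c
      using W(3) B(1) that by (auto simp: cone_set_def)
    define s where "s = (\<Sum>b\<in>B. N *\<^sub>R b)"
    have s: "s \<in> W" unfolding s_def using inW N by (intro cone_set_sum[OF W(3) finB Bne]) auto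
    have Fs: "F s = (\<Sum>b\<in>B. N *\<^sub>R F b)"
    proof -
      have "F s = (\<Sum>b\<in>B. F (N *\<^sub>R b))"
        unfolding s_def by (rule sumF[OF finB Bne]) (use inW N in auto)
      also have "\<dots> = (\<Sum>b\<in>B. N *\<^sub>R F b)"
        using B(1) N by (intro sum.cong) (auto simp: scale)
      finally show ?thesis .
    qed
    have "v + s = (\<Sum>b\<in>B. (t b + N) *\<^sub>R b)"
      by (simp add: t s_def scaleR_add_left sum.distrib)
    then have "F (v + s) = (\<Sum>b\<in>B. F ((t b + N) *\<^sub>R b))"
      using sumF[OF finB Bne, of "\<lambda>b. (t b + N) *\<^sub>R b"] inW Nt by auto
    also have "\<dots> = (\<Sum>b\<in>B. (t b + N) *\<^sub>R F b)"
      using B(1) Nt by (intro sum.cong) (auto simp: scale)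
    finally have "F v + F s = (\<Sum>b\<in>B. t b *\<^sub>R F b) + F s"
      using add[OF v s] by (simp add: Fs scaleR_add_left sum.distrib)
    then have "F v = (\<Sum>b\<in>B. t b *\<^sub>R F b)" by simp
    also have "\<dots> = A v"
      unfolding t using A by (simp add: linear_sum linear_scale)
    finally show ?thesis .
  qed
  then show ?thesis using A by blast
qed

text \<open>Phrased with coefficients because \<open>independent {x, y}\<close> does not notice a
  repeated vector.\<close>

definition indep2 :: "'a::real_vector \<Rightarrow> 'a \<Rightarrow> bool" where
  "indep2 x y \<longleftrightarrow> (\<forall>a b. a *\<^sub>R x + b *\<^sub>R y = 0 \<longrightarrow> a = 0 \<and> b = 0)"

definition indep3 :: "'a::real_vector \<Rightarrow> 'a \<Rightarrow> 'a \<Rightarrow> bool" where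
  "indep3 x y z \<longleftrightarrow> (\<forall>a b c. a *\<^sub>R x + b *\<^sub>R y + c *\<^sub>R z = 0 \<longrightarrow> a = 0 \<and> b = 0 \<and> c = 0)"

lemma in_span1: "x \<in> span {y} \<longleftrightarrow> (\<exists>a. x = a *\<^sub>R y)"
  by (auto simp: span_singleton)

lemma in_span2: "x \<in> span {y, z} \<longleftrightarrow> (\<exists>a b. x = a *\<^sub>R y + b *\<^sub>R z)"
proof
  assume "x \<in> span {y, z}"
  then obtain a where "x - a *\<^sub>R y \<in> span {z}" by (auto simp: span_insert)
  then obtain b where "x - a *\<^sub>R y = b *\<^sub>R z" by (auto simp: span_singleton)
  then show "\<exists>a b. x = a *\<^sub>R y + b *\<^sub>R z" by (metis add.commute diff_eq_eq)
next
  assume "\<exists>a b. x = a *\<^sub>R y + b *\<^sub>R z"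
  then show "x \<in> span {y, z}"
    by (metis insertCI span_add span_base span_scale)
qed

lemma indep2_iff: "indep2 x y \<longleftrightarrow> x \<noteq> 0 \<and> y \<notin> span {x}"
proof
  assume i: "indep2 x y"
  have "x \<noteq> 0" using i[unfolded indep2_def, rule_format, of 1 0] by auto
  moreover have False if "y = a *\<^sub>R x" for a
    using i[unfolded indep2_def, rule_format, of a "-1"] that by auto
  ultimately show "x \<noteq> 0 \<and> y \<notin> span {x}" by (auto simp: in_span1)
next
  assume x: "x \<noteq> 0 \<and> y \<notin> span {x}"
  have "a = 0 \<and> b = 0" if "a *\<^sub>R x + b *\<^sub>R y = 0" for a b
  proof (cases "b = 0")
    case False
    have "b *\<^sub>R y = (- a) *\<^sub>R x" using that by (simp add: add_eq_0_iff2)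
    then have "inverse b *\<^sub>R (b *\<^sub>R y) = (inverse b * (- a)) *\<^sub>R x"
      by (simp only: scaleR_scaleR)
    then have "y \<in> span {x}" unfolding in_span1 using False by (intro exI[of _ "inverse b * (- a)"]) simp
    then show ?thesis using x by simp
  qed (use that x in auto)
  then show "indep2 x y" by (auto simp: indep2_def)
qed

lemma indep3_iff: "indep3 x y z \<longleftrightarrow> indep2 x y \<and> z \<notin> span {x, y}"
proof
  assume i: "indep3 x y z"
  have "indep2 x y"
    unfolding indep2_def using i[unfolded indep3_def, rule_format, of _ _ 0] by simp
  moreover have False if "z = a *\<^sub>R x + b *\<^sub>R y" for a b
    using i[unfolded indep3_def, rule_format, of a b "-1"] that by simp
  ultimately show "indep2 x y \<and> z \<notin> span {x, y}" by (auto simp: in_span2)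
next
  assume x: "indep2 x y \<and> z \<notin> span {x, y}"
  have "a = 0 \<and> b = 0 \<and> c = 0" if e: "a *\<^sub>R x + b *\<^sub>R y + c *\<^sub>R z = 0" for a b c
  proof (cases "c = 0")
    case False
    have "c *\<^sub>R z = - (a *\<^sub>R x + b *\<^sub>R y)" using e by (simp add: add_eq_0_iff)
    then have "c *\<^sub>R z \<in> span {x, y}"
      by (simp add: span_neg span_add span_scale span_base del: minus_add_distrib)
    then have "inverse c *\<^sub>R (c *\<^sub>R z) \<in> span {x, y}" by (rule span_scale)
    then show ?thesis using False x by simp
  qed (use x e in \<open>auto simp: indep2_def\<close>)
  then show "indep3 x y z" by (simp add: indep3_def)
qed

lemma indep3_D:
  assumes "indep3 x y z" "a *\<^sub>R x + b *\<^sub>R y + c *\<^sub>R z = a' *\<^sub>R x + b' *\<^sub>R y + c' *\<^sub>R z"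
  shows "a = a'" "b = b'" "c = c'"
proof -
  have "(a - a') *\<^sub>R x + (b - b') *\<^sub>R y + (c - c') *\<^sub>R z = 0"
    using assms(2) by (simp add: scaleR_diff_left algebra_simps)
  then have "a - a' = 0 \<and> b - b' = 0 \<and> c - c' = 0" using assms(1) unfolding indep3_def by blast
  then show "a = a'" "b = b'" "c = c'" by auto
qed

lemma indep2_D:
  assumes "indep2 x y" "a *\<^sub>R x + b *\<^sub>R y = a' *\<^sub>R x + b' *\<^sub>R y"
  shows "a = a'" "b = b'"
proof -
  have "(a - a') *\<^sub>R x + (b - b') *\<^sub>R y = 0"
    using assms(2) by (simp add: scaleR_diff_left algebra_simps)
  then have "a - a' = 0 \<and> b - b' = 0" using assms(1) unfolding indep2_def by blast
  then show "a = a'" "b = b'" by auto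
qed

lemma indep2_commute: "indep2 x y \<Longrightarrow> indep2 y x"
  unfolding indep2_def by (metis add.commute)

lemma indep2_separate:
  fixes x y :: "'a::euclidean_space"
  assumes "indep2 x y"
  shows "\<exists>z. z \<bullet> x = 0 \<and> z \<bullet> y \<noteq> 0"
  using in_span_orthogonal[of "{x}" y] assms by (auto simp: indep2_iff)

text \<open>A local version of the fundamental theorem of projective geometry. The classical device: rescale
  \<open>g v\<close> to the vector \<open>F v\<close> for which \<open>g v0 + F v\<close> is proportional to \<open>g (v0 + v)\<close>; then \<open>F\<close> is
  additive.\<close>

locale cone_collineation =
  fixes W :: "'a::euclidean_space set" and g :: "'a \<Rightarrow> 'a"
  assumes dim3: "3 \<le> DIM('a)"
    and W: "open W" "W \<noteq> {}" "cone_set W"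
    and cont: "continuous_on W g"
    and g_scale: "\<And>v t. v \<in> W \<Longrightarrow> t > 0 \<Longrightarrow> g (t *\<^sub>R v) = g v"
    and g_add: "\<And>v w. v \<in> W \<Longrightarrow> w \<in> W \<Longrightarrow> g (v + w) \<in> span {g v, g w}"
    and g_indep3: "\<And>u v w. u \<in> W \<Longrightarrow> v \<in> W \<Longrightarrow> w \<in> W \<Longrightarrow> indep3 u v w \<Longrightarrow> indep3 (g u) (g v) (g w)"
begin

lemma W_add: "x \<in> W \<Longrightarrow> y \<in> W \<Longrightarrow> x + y \<in> W" and W_scale: "x \<in> W \<Longrightarrow> t > 0 \<Longrightarrow> t *\<^sub>R x \<in> W"
  using W(3) by (auto simp: cone_set_def)

lemma escape_span2:
  assumes "open U" "U \<noteq> {}"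
  shows "\<exists>w::'a. w \<in> U \<and> w \<notin> span {x, y}"
proof (rule ccontr)
  assume "\<not> ?thesis"
  then have "dim U \<le> dim {x,y}" by (metis dim_span dim_subset subsetI)
  also have "\<dots> \<le> 2" using dim_le_card'[of "{x,y}"] by (auto simp: card_insert_if split: if_splits)
  finally show False using dim_open[OF assms] dim3 by simp
qed

lemma g_indep2: "u \<in> W \<Longrightarrow> v \<in> W \<Longrightarrow> indep2 u v \<Longrightarrow> indep2 (g u) (g v)"
  using escape_span2[OF W(1,2), of u v] g_indep3[of u v] by (auto simp: indep3_iff)

text \<open>c fixes the scale of \<open>g v\<close> relative to \<open>g u\<close>, while d absorbs
  the arbitrary scale of \<open>g (u + v)\<close>.\<close>

definition scl :: "'a \<Rightarrow> 'a \<Rightarrow> real \<Rightarrow> bool" where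
  "scl u v c \<longleftrightarrow> c \<noteq> 0 \<and> (\<exists>d. d \<noteq> 0 \<and> d *\<^sub>R g (u + v) = g u + c *\<^sub>R g v)"

lemma ex_scl:
  assumes "u \<in> W" "v \<in> W" "indep2 u v"
  shows "\<exists>c. scl u v c"
proof -
  have ind: "indep2 (g u) (g v)" by (rule g_indep2[OF assms])
  have "u + v \<in> W" using assms W_add by blast
  obtain a b where ab: "g (u + v) = a *\<^sub>R g u + b *\<^sub>R g v"
    using g_add[OF assms(1,2)] by (auto simp: in_span2)
  have "indep2 u (u + v)" "indep2 v (u + v)"
    using assms(3) indep2_commute[OF assms(3)]
    by (auto simp: indep2_iff span_add_eq span_add_eq2 span_base)
  then have i: "indep2 (g u) (g (u + v))" "indep2 (g v) (g (u + v))"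
    using g_indep2 assms \<open>u + v \<in> W\<close> by auto
  have "b \<noteq> 0"
    using i(1) ab by (auto simp: indep2_iff in_span1)
  moreover have "a \<noteq> 0"
    using i(2) ab by (auto simp: indep2_iff in_span1)
  ultimately have "scl u v (b / a)"
    unfolding scl_def by (intro conjI exI[of _ "1 / a"]) (auto simp: ab scaleR_add_right)
  then show ?thesis ..
qed

text \<open>The line of \<open>g (u + v + w)\<close> is computed from u + v and w, and from u + w
  and v. Comparing coefficients along the independent \<open>g u\<close>, \<open>g v\<close>,
  \<open>g w\<close> shows that it is spanned by g u + a g v + b g w; the third decomposition, u and
  v + w, then gives the claim.\<close>

lemma scl_add:
  assumes W3: "u \<in> W" "v \<in> W" "w \<in> W" and ind: "indep3 u v w"
    and s: "scl u v a" "scl u w b" "scl u (v + w) c"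
  shows "c *\<^sub>R g (v + w) = a *\<^sub>R g v + b *\<^sub>R g w"
proof -
  have i: "indep3 (g u) (g v) (g w)" by (rule g_indep3[OF W3 ind])
  obtain d1 where d1: "d1 \<noteq> 0" "d1 *\<^sub>R g (u + v) = g u + a *\<^sub>R g v" using s(1) by (auto simp: scl_def)
  obtain d2 where d2: "d2 \<noteq> 0" "d2 *\<^sub>R g (u + w) = g u + b *\<^sub>R g w" using s(2) by (auto simp: scl_def)
  obtain d3 where d3: "d3 \<noteq> 0" "d3 *\<^sub>R g (u + (v + w)) = g u + c *\<^sub>R g (v + w)" using s(3) by (auto simp: scl_def)
  obtain \<sigma> \<tau> where st: "g (v + w) = \<sigma> *\<^sub>R g v + \<tau> *\<^sub>R g w"
    using g_add[OF W3(2,3)] by (auto simp: in_span2)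
  obtain \<alpha> \<beta> where X1: "g (u + v + w) = \<alpha> *\<^sub>R g (u + v) + \<beta> *\<^sub>R g w"
    using g_add[OF W_add[OF W3(1,2)] W3(3)] by (auto simp: in_span2)
  obtain \<alpha>' \<beta>' where X2: "g (u + w + v) = \<alpha>' *\<^sub>R g (u + w) + \<beta>' *\<^sub>R g v"
    using g_add[OF W_add[OF W3(1,3)] W3(2)] by (auto simp: in_span2)
  have g1: "g (u + v) = (1 / d1) *\<^sub>R g u + (a / d1) *\<^sub>R g v"
  proof -
    have "g (u + v) = (1 / d1) *\<^sub>R (d1 *\<^sub>R g (u + v))" using d1(1) by simp
    then show ?thesis unfolding d1(2) by (simp add: scaleR_add_right)
  qed
  have g2: "g (u + w) = (1 / d2) *\<^sub>R g u + (b / d2) *\<^sub>R g w"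
  proof -
    have "g (u + w) = (1 / d2) *\<^sub>R (d2 *\<^sub>R g (u + w))" using d2(1) by simp
    then show ?thesis unfolding d2(2) by (simp add: scaleR_add_right)
  qed
  have e1: "g (u + v + w) = (\<alpha> / d1) *\<^sub>R g u + (\<alpha> * a / d1) *\<^sub>R g v + \<beta> *\<^sub>R g w"
    unfolding X1 g1 by (simp add: scaleR_add_right)
  have e2: "g (u + v + w) = (\<alpha>' / d2) *\<^sub>R g u + \<beta>' *\<^sub>R g v + (\<alpha>' * b / d2) *\<^sub>R g w"
    using X2 unfolding g2 by (simp add: scaleR_add_right add.commute add.left_commute add.assoc)
  have q: "\<alpha> / d1 = \<alpha>' / d2" "\<beta> = \<alpha>' * b / d2"
    using indep3_D[OF i e1[symmetric, unfolded e2]] by auto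
  then have "\<alpha> * a / d1 = \<alpha>' * a / d2"
    by (metis times_divide_eq_left)
  note q = q this
  define k where "k = \<alpha> / d1"
  have e: "g (u + v + w) = k *\<^sub>R g u + (k * a) *\<^sub>R g v + (k * b) *\<^sub>R g w"
    unfolding e1 q by (simp add: k_def q(1))
  have "(d3 * k) *\<^sub>R g u + (d3 * k * a) *\<^sub>R g v + (d3 * k * b) *\<^sub>R g w
      = 1 *\<^sub>R g u + (c * \<sigma>) *\<^sub>R g v + (c * \<tau>) *\<^sub>R g w"
    using d3(2) by (simp add: add.assoc[symmetric] e st scaleR_add_right mult.assoc)
  from indep3_D[OF i this] have "c * \<sigma> = a" "c * \<tau> = b" by auto
  then show ?thesis by (simp add: st scaleR_add_right)
qed

theorem collineation_linear:
  "\<exists>W' A. open W' \<and> W' \<noteq> {} \<and> W' \<subseteq> W \<and> linear A \<and>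
    (\<forall>v\<in>W'. \<exists>c. c \<noteq> 0 \<and> A v = c *\<^sub>R g v)"
proof -
  obtain v0 where v0: "v0 \<in> W" "v0 \<notin> span {0, 0}" using escape_span2[OF W(1,2)] by blast
  then have v0n: "v0 \<noteq> 0" using span_zero by blast
  obtain v1 where v1: "v1 \<in> W" "v1 \<notin> span {v0, v0}" using escape_span2[OF W(1,2)] by blast
  then have "indep2 v0 v1" using v0n by (simp add: indep2_iff)
  then obtain \<eta>' where \<eta>': "\<eta>' \<bullet> v0 = 0" "\<eta>' \<bullet> v1 \<noteq> 0" using indep2_separate by blast
  define \<eta> where "\<eta> = (\<eta>' \<bullet> v1) *\<^sub>R \<eta>'"
  have \<eta>: "\<eta> \<bullet> v0 = 0" "\<eta> \<bullet> v1 > 0" using \<eta>' by (auto simp: \<eta>_def zero_less_mult_iff linorder_neq_iff)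
  \<comment> \<open>One open side of a hyperplane through \<open>v0\<close>: every v in it is
    independent of \<open>v0\<close>, so that \<open>\<phi>\<close> is defined on all of it.\<close>
  define W' where "W' = W \<inter> {v. \<eta> \<bullet> v > 0}"
  have W': "open W'" "W' \<noteq> {}" "W' \<subseteq> W" "cone_set W'"
    using W v1 \<eta> open_halfspace_gt[of 0 \<eta>]
    by (auto simp: W'_def cone_set_def inner_add_right)
  have ind: "indep2 v0 v" if "v \<in> W'" for v
    using that \<eta> v0n by (auto simp: indep2_iff in_span1 W'_def)
  define \<phi> where "\<phi> v = (SOME c. scl v0 v c)" for v
  have \<phi>: "scl v0 v (\<phi> v)" if "v \<in> W'" for v
    unfolding \<phi>_def using someI_ex[OF ex_scl[OF v0(1) _ ind[OF that]]] that W' by blast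
  define F where "F v = \<phi> v *\<^sub>R g v" for v
  have W'add: "x + y \<in> W'" if "x \<in> W'" "y \<in> W'" for x y
    using W'(4) that by (auto simp: cone_set_def)
  have add3: "F (v + w) = F v + F w" if "v \<in> W'" "w \<in> W'" "indep3 v0 v w" for v w
    unfolding F_def
    by (rule scl_add[OF v0(1) _ _ that(3)]) (use \<phi> that W'add W' in auto)
  have add: "F (v + w) = F v + F w" if vw: "v \<in> W'" "w \<in> W'" for v w
  proof (cases "indep3 v0 v w")
    case False
    then have w: "w \<in> span {v0, v}" using ind vw by (simp add: indep3_iff)
    \<comment> \<open>For v and w coplanar with \<open>v0\<close>, a vector outside that plane is
      added, additivity is used for independent triples only, and its value cancels.\<close>
    obtain w' where w': "w' \<in> W'" "w' \<notin> span {v0, v}" using escape_span2[OF W'(1,2)] by blast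
    have sub: "span {v0, x} \<subseteq> span {v0, v}" if "x \<in> span {v0, v}" for x
      using that by (intro span_minimal) (auto intro: span_base)
    have "v + w \<in> span {v0, v}" using w by (simp add: span_add span_base)
    then have i: "indep3 v0 (v + w) w'" "indep3 v0 w w'" "indep3 v0 v (w + w')"
      using sub w w' ind vw W'add by (auto simp: indep3_iff span_add_eq)
    have "F (v + w) + F w' = F (v + (w + w'))"
      using add3[OF W'add[OF vw] w'(1) i(1)] by (simp add: add.assoc)
    also have "\<dots> = F v + (F w + F w')"
      using add3[OF vw(1) W'add[OF vw(2) w'(1)] i(3)] add3[OF vw(2) w'(1) i(2)] by simp
    finally show ?thesis by simp
  qed (use add3 vw in blast)
  have scale: "F (t *\<^sub>R v) = t *\<^sub>R F v" if v: "v \<in> W'" and "t > 0" for v t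
  proof -
    have tv: "s *\<^sub>R v \<in> W'" if "s > 0" for s using W'(4) v that by (auto simp: cone_set_def)
    have gs: "g (s *\<^sub>R v) = g v" if "s > 0" for s using g_scale W' v that by blast
    have iv: "indep2 (g v0) (g v)" using g_indep2 v0 ind v W' by blast
    then have gv: "g v \<noteq> 0" using indep2_commute by (auto simp: indep2_iff)
    define \<psi> where "\<psi> s = \<phi> (s *\<^sub>R v)" for s
    have F\<psi>: "F (s *\<^sub>R v) = \<psi> s *\<^sub>R g v" if "s > 0" for s by (simp add: F_def \<psi>_def gs that)
    \<comment> \<open>The choice in \<open>\<phi>\<close> says nothing about continuity. Testing
      with \<theta> and \<zeta>, which isolate the components along \<open>g v\<close> and
      \<open>g v0\<close>, gives an explicit continuous formula for \<open>\<psi>\<close>.\<close>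
    obtain \<theta> where \<theta>: "\<theta> \<bullet> g v0 = 0" "\<theta> \<bullet> g v \<noteq> 0" using indep2_separate[OF iv] by blast
    obtain \<zeta> where \<zeta>: "\<zeta> \<bullet> g v = 0" "\<zeta> \<bullet> g v0 \<noteq> 0" using indep2_separate[OF indep2_commute[OF iv]] by blast
    have val: "\<zeta> \<bullet> g (v0 + s *\<^sub>R v) \<noteq> 0 \<and>
        \<psi> s = (\<theta> \<bullet> g (v0 + s *\<^sub>R v)) * (\<zeta> \<bullet> g v0) / ((\<zeta> \<bullet> g (v0 + s *\<^sub>R v)) * (\<theta> \<bullet> g v))" if s: "s > 0" for s
    proof -
      obtain d where d: "d \<noteq> 0" "d *\<^sub>R g (v0 + s *\<^sub>R v) = g v0 + \<psi> s *\<^sub>R g v"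
        using \<phi>[OF tv[OF s]] gs[OF s] by (auto simp: scl_def \<psi>_def)
      have "d * (\<theta> \<bullet> g (v0 + s *\<^sub>R v)) = \<psi> s * (\<theta> \<bullet> g v)"
        using arg_cong[OF d(2), of "inner \<theta>"] \<theta> by (simp add: inner_add_right)
      moreover have "d * (\<zeta> \<bullet> g (v0 + s *\<^sub>R v)) = \<zeta> \<bullet> g v0"
        using arg_cong[OF d(2), of "inner \<zeta>"] \<zeta> by (simp add: inner_add_right)
      ultimately have *: "\<theta> \<bullet> g (v0 + s *\<^sub>R v) = \<psi> s * (\<theta> \<bullet> g v) / d" "\<zeta> \<bullet> g (v0 + s *\<^sub>R v) = \<zeta> \<bullet> g v0 / d"
        using d(1) by (auto simp: nonzero_eq_divide_eq mult.commute)
      show ?thesis unfolding * using d(1) \<theta> \<zeta> by simp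
    qed
    have "continuous_on {0<..} (\<lambda>s. g (v0 + s *\<^sub>R v))"
      by (rule continuous_on_compose2[OF cont]) (use tv W' v0 W_add in \<open>auto intro!: continuous_intros\<close>)
    then have "continuous_on {0<..} (\<lambda>s. (\<theta> \<bullet> g (v0 + s *\<^sub>R v)) * (\<zeta> \<bullet> g v0) / ((\<zeta> \<bullet> g (v0 + s *\<^sub>R v)) * (\<theta> \<bullet> g v)))"
      using val \<theta> by (intro continuous_intros) auto
    then have "continuous_on {0<..} \<psi>"
      by (rule continuous_on_eq) (use val in auto)
    moreover have "\<psi> (s + s') = \<psi> s + \<psi> s'" if "s > 0" "s' > 0" for s s'
    proof -
      have "\<psi> (s + s') *\<^sub>R g v = (\<psi> s + \<psi> s') *\<^sub>R g v"
        using add[OF tv[OF that(1)] tv[OF that(2)]] that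
        by (simp add: F\<psi> scaleR_add_left[symmetric] del: scaleR_add_left)
      then show ?thesis using gv by simp
    qed
    ultimately have "\<psi> t = t * \<psi> 1" using \<open>t > 0\<close> by (intro additive_continuous_pos) auto
    then show ?thesis using F\<psi>[of t] F\<psi>[of 1] \<open>t > 0\<close> by simp
  qed
  obtain A where A: "linear A" "\<And>v. v \<in> W' \<Longrightarrow> F v = A v"
    using cone_additive_extends_linear[OF W'(1,2,4), of F] add scale by blast
  have "\<exists>c. c \<noteq> 0 \<and> A v = c *\<^sub>R g v" if "v \<in> W'" for v
    using \<phi>[OF that] A(2)[OF that] by (auto simp: scl_def F_def)
  then show ?thesis using W' A by blast
qed

end

section \<open>The polarity of section centres\<close>

lemma span1_orthogonal:
  fixes x a :: "'a::euclidean_space"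
  assumes "\<And>d. d \<bullet> a = 0 \<Longrightarrow> d \<bullet> x = 0"
  shows "x \<in> span {a}"
  using in_span_orthogonal[of "{a}" x] assms by auto

lemma span1_separate:
  fixes x a :: "'a::euclidean_space"
  shows "x \<notin> span {a} \<Longrightarrow> \<exists>d. d \<bullet> a = 0 \<and> d \<bullet> x \<noteq> 0"
  using span1_orthogonal[of a x] by metis

text \<open>Being parallel to y is the vanishing of (y \<bullet> y) x - (x \<bullet> y) y, which
  passes to the limit.\<close>

lemma span1_limit:
  fixes X Y :: "real \<Rightarrow> 'a::real_inner"
  assumes "(X \<longlongrightarrow> x) (at_right 0)" "(Y \<longlongrightarrow> y) (at_right 0)" "y \<noteq> 0"
    and ev: "eventually (\<lambda>\<epsilon>. X \<epsilon> \<in> span {Y \<epsilon>}) (at_right 0)"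
  shows "x \<in> span {y}"
proof -
  have "((\<lambda>\<epsilon>. (Y \<epsilon> \<bullet> Y \<epsilon>) *\<^sub>R X \<epsilon> - (X \<epsilon> \<bullet> Y \<epsilon>) *\<^sub>R Y \<epsilon>) \<longlongrightarrow> (y \<bullet> y) *\<^sub>R x - (x \<bullet> y) *\<^sub>R y) (at_right 0)"
    by (intro tendsto_intros assms)
  moreover have "eventually (\<lambda>\<epsilon>. (Y \<epsilon> \<bullet> Y \<epsilon>) *\<^sub>R X \<epsilon> - (X \<epsilon> \<bullet> Y \<epsilon>) *\<^sub>R Y \<epsilon> = 0) (at_right 0)"
    using ev by eventually_elim (auto simp: in_span1)
  ultimately have "((\<lambda>_. 0) \<longlongrightarrow> (y \<bullet> y) *\<^sub>R x - (x \<bullet> y) *\<^sub>R y) (at_right (0::real))"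
    by (rule Lim_transform_eventually)
  then have "(y \<bullet> y) *\<^sub>R x - (x \<bullet> y) *\<^sub>R y = 0"
    by (simp add: tendsto_const_iff)
  then have "inverse (y \<bullet> y) *\<^sub>R ((y \<bullet> y) *\<^sub>R x) = inverse (y \<bullet> y) *\<^sub>R ((x \<bullet> y) *\<^sub>R y)"
    by simp
  then have "x = (inverse (y \<bullet> y) * (x \<bullet> y)) *\<^sub>R y" using assms(3) by simp
  then show ?thesis unfolding in_span1 by blast
qed

lemma tendsto_line:
  fixes x d :: "'a::real_normed_vector"
  shows "((\<lambda>\<epsilon>. x + \<epsilon> *\<^sub>R d) \<longlongrightarrow> x) (at_right 0)"
proof -
  have "((\<lambda>\<epsilon>. x + \<epsilon> *\<^sub>R d) \<longlongrightarrow> x + 0 *\<^sub>R d) (at_right 0)" by (intro tendsto_intros)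
  then show ?thesis by simp
qed

lemma eventually_at_right_ex:
  "eventually P (at_right (0::real)) \<Longrightarrow> \<exists>\<epsilon>>0. P \<epsilon>"
  using eventually_happens'[OF trivial_limit_at_right_real, of "\<lambda>\<epsilon>. \<epsilon> > 0 \<and> P \<epsilon>" 0]
    eventually_conj[OF eventually_at_right_less[of 0]] by blast

lemma indep3_iff_independent: "indep3 x y z \<longleftrightarrow> independent {z, y, x} \<and> x \<noteq> y \<and> z \<noteq> x \<and> z \<noteq> y"
proof -
  have eq: "{y, x} = {x, y}" by blast
  have sp: "x \<in> span {x}" "x \<in> span {x, y}" "y \<in> span {x, y}" by (simp_all add: span_base)
  have "independent {z, y, x} \<longleftrightarrow> independent {y, x} \<and> z \<notin> span {x, y}" if "z \<noteq> x" "z \<noteq> y"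
    using that independent_insert[of z "{y, x}"] by (simp add: eq)
  moreover have "independent {y, x} \<longleftrightarrow> x \<noteq> 0 \<and> y \<notin> span {x}" if "x \<noteq> y"
    using that by (auto simp: independent_insert)
  ultimately show ?thesis
    unfolding indep3_iff indep2_iff using sp by metis
qed

section \<open>Converse duality and the collineation of centres\<close>

context suitable_ball
begin

text \<open>The broken line from -u0 through w to u0 stands for a half circle, since
  \<open>cen\<close> ignores positive factors. Its end values are opposite by
  \<open>cen_uminus\<close>.\<close>

lemma zero_on_half_circle:
  assumes u0: "u0 \<noteq> 0" "u0 \<bullet> p = 0"
    and nz: "\<And>t. t \<in> {-1..1} \<Longrightarrow> t *\<^sub>R u0 + (1 - \<bar>t\<bar>) *\<^sub>R w \<noteq> 0"
  shows "\<exists>t\<in>{-1..1}. v \<bullet> cen (t *\<^sub>R u0 + (1 - \<bar>t\<bar>) *\<^sub>R w) = 0"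
proof -
  define \<gamma> where "\<gamma> t = t *\<^sub>R u0 + (1 - \<bar>t\<bar>) *\<^sub>R w" for t :: real
  define f where "f t = v \<bullet> cen (\<gamma> t)" for t
  have "continuous_on {-1..1} (\<lambda>t. cen (\<gamma> t))"
    by (rule continuous_on_compose2[OF continuous_cen])
      (use nz in \<open>auto simp: \<gamma>_def intro!: continuous_intros\<close>)
  then have cont: "continuous_on {-1..1} f" unfolding f_def by (intro continuous_intros)
  have ends: "f (-1) = - f 1" using cen_uminus[OF u0] by (simp add: f_def \<gamma>_def)
  have "\<exists>t. -1 \<le> t \<and> t \<le> 1 \<and> f t = 0"
  proof (cases "f 1 \<ge> 0")
    case True
    then show ?thesis using IVT'[of f "-1" 0 1] cont ends by simp
  next
    case False
    then show ?thesis using IVT2'[of f 1 0 "-1"] cont ends by simp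
  qed
  then show ?thesis by (auto simp: f_def \<gamma>_def)
qed

text \<open>On a suitable half circle of normals some x satisfies v \<bullet> cen x = 0, and
  \<open>polar_duality\<close> turns this into x \<bullet> cen v = 0. The half circle is chosen so
  that this can only hold at the given normal u, or at its ends u and -u. Normals with u \<bullet> p
  = 0 are limits of the case u \<bullet> p > 0, unless p is parallel to \<open>cen v\<close>; then
  the half circle from -u through p to u is used.\<close>

lemma polar_duality_converse:
  assumes u: "u \<noteq> 0" "u \<bullet> p \<ge> 0" and v: "v \<bullet> p < 0" and ne: "cen v \<noteq> 0" and uc: "u \<bullet> cen v = 0"
  shows "v \<bullet> cen u = 0"
proof -
  have pos: "v \<bullet> cen w = 0" if w: "w \<bullet> p > 0" "w \<bullet> cen v = 0" for w
  proof -
    have w0: "w \<noteq> 0" using w by auto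
    \<comment> \<open>The component of \<open>cen v\<close> orthogonal to p. It is nonzero: if
      \<open>cen v\<close> were parallel to p, then w \<bullet> cen v = 0 and w \<bullet> p > 0
      would give cen v = 0.\<close>
    define u0 where "u0 = cen v - ((cen v \<bullet> p) / (p \<bullet> p)) *\<^sub>R p"
    have u0p: "u0 \<bullet> p = 0" using p_ne_0 by (simp add: u0_def inner_diff_left)
    have "u0 \<bullet> cen v = u0 \<bullet> u0"
    proof -
      have "cen v = u0 + ((cen v \<bullet> p) / (p \<bullet> p)) *\<^sub>R p" by (simp add: u0_def)
      then show ?thesis by (metis add.right_neutral inner_add_right inner_scaleR_right mult_zero_right u0p)
    qed
    moreover have "u0 \<noteq> 0"
    proof
      assume "u0 = 0"
      then have e: "cen v = ((cen v \<bullet> p) / (p \<bullet> p)) *\<^sub>R p" by (simp add: u0_def)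
      then have "((cen v \<bullet> p) / (p \<bullet> p)) * (w \<bullet> p) = 0" using w(2) by (metis inner_scaleR_right)
      then have "cen v = 0" using w(1) e by auto
      then show False using ne by simp
    qed
    ultimately have u0: "u0 \<noteq> 0" "u0 \<bullet> cen v \<noteq> 0" by auto
    have nz: "t *\<^sub>R u0 + (1 - \<bar>t\<bar>) *\<^sub>R w \<noteq> 0" for t
    proof
      assume e: "t *\<^sub>R u0 + (1 - \<bar>t\<bar>) *\<^sub>R w = 0"
      have "t * (u0 \<bullet> cen v) = 0"
        using arg_cong[OF e, of "\<lambda>x. x \<bullet> cen v"] w(2) by (simp add: inner_add_left)
      then have "t = 0" using u0 by simp
      then show False using e w0 by simp
    qed
    obtain t where t: "t \<in> {-1..1}" "v \<bullet> cen (t *\<^sub>R u0 + (1 - \<bar>t\<bar>) *\<^sub>R w) = 0"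
      using zero_on_half_circle[OF u0(1) u0p nz] by blast
    have nn: "0 \<le> (1 - \<bar>t\<bar>) * (w \<bullet> p)"
      using t(1) w(1) by (intro mult_nonneg_nonneg) (simp_all add: abs_le_iff)
    have "(t *\<^sub>R u0 + (1 - \<bar>t\<bar>) *\<^sub>R w) \<bullet> cen v = 0"
      by (rule polar_duality[OF nz _ v t(2)]) (use nn u0p in \<open>simp add: inner_add_left\<close>)
    then have "t = 0" using w(2) u0 by (simp add: inner_add_left)
    then show ?thesis using t by simp
  qed
  consider "u \<bullet> p > 0" | "u \<bullet> p = 0" "p \<notin> span {cen v}" | "u \<bullet> p = 0" "p \<in> span {cen v}"
    using u(2) by (metis order_le_less)
  then show ?thesis
  proof cases
    case 1
    then show ?thesis using pos uc by blast
  next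
    case 2
    then obtain g0 where g0: "g0 \<bullet> cen v = 0" "g0 \<bullet> p \<noteq> 0"
      using span1_separate by blast
    define g where "g = (g0 \<bullet> p) *\<^sub>R g0"
    have g: "g \<bullet> cen v = 0" "g \<bullet> p > 0"
      using g0 by (auto simp: g_def zero_less_mult_iff linorder_neq_iff)
    have "eventually (\<lambda>\<epsilon>. v \<bullet> cen (u + \<epsilon> *\<^sub>R g) = 0) (at_right 0)"
      using eventually_at_right_less[of "0::real"]
      by eventually_elim (rule pos, use 2 g uc in \<open>auto simp: inner_add_left\<close>)
    moreover have "((\<lambda>\<epsilon>. v \<bullet> cen (u + \<epsilon> *\<^sub>R g)) \<longlongrightarrow> v \<bullet> cen u) (at_right 0)"
      by (intro tendsto_intros tendsto_cen tendsto_line u)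
    ultimately have "((\<lambda>_. 0) \<longlongrightarrow> v \<bullet> cen u) (at_right (0::real))"
      by (rule Lim_transform_eventually[rotated])
    then show ?thesis by (simp add: tendsto_const_iff)
  next
    case 3
    then obtain a where a: "p = a *\<^sub>R cen v" by (auto simp: in_span1)
    then have pc: "p \<bullet> cen v \<noteq> 0" using p_ne_0 by (metis inner_eq_zero_iff inner_scaleR_right mult_zero_right)
    have nz: "t *\<^sub>R u + (1 - \<bar>t\<bar>) *\<^sub>R p \<noteq> 0" for t
    proof
      assume e: "t *\<^sub>R u + (1 - \<bar>t\<bar>) *\<^sub>R p = 0"
      have "(1 - \<bar>t\<bar>) * (p \<bullet> p) = 0"
        using arg_cong[OF e, of "\<lambda>x. x \<bullet> p"] 3 by (simp add: inner_add_left)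
      then have "\<bar>t\<bar> = 1" using p_ne_0 by simp
      then have "t *\<^sub>R u = 0" "t \<noteq> 0" using e by auto
      then show False using u by simp
    qed
    obtain t where t: "t \<in> {-1..1}" "v \<bullet> cen (t *\<^sub>R u + (1 - \<bar>t\<bar>) *\<^sub>R p) = 0"
      using zero_on_half_circle[OF u(1) 3(1) nz] by blast
    have nn: "0 \<le> (1 - \<bar>t\<bar>) * (p \<bullet> p)"
      using t(1) by (intro mult_nonneg_nonneg) (simp_all add: abs_le_iff)
    have "(t *\<^sub>R u + (1 - \<bar>t\<bar>) *\<^sub>R p) \<bullet> cen v = 0"
      by (rule polar_duality[OF nz _ v t(2)]) (use nn 3(1) in \<open>simp add: inner_add_left\<close>)
    then have "\<bar>t\<bar> = 1" using uc pc by (simp add: inner_add_left)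
    then have "t = 1 \<or> t = -1" by linarith
    then show ?thesis
    proof
      assume "t = 1"
      then show ?thesis using t(2) by simp
    next
      assume "t = -1"
      then have "v \<bullet> cen (- u) = 0" using t(2) by simp
      then show ?thesis by (simp add: cen_uminus[OF u(1) 3(1)])
    qed
  qed
qed

text \<open>The normals whose tangent hyperplane separates B strictly from the origin. For them v
  \<bullet> p < 0 and \<open>cen v\<close> is nonzero, so the duality holds in both
  directions.\<close>

definition W :: "'a set" where "W = {v. v \<bullet> p + r * norm v < 0}"

lemma W_h: "v \<in> W \<longleftrightarrow> h v < 0"
  by (simp add: W_def h_def)

lemma W_D: "v \<in> W \<Longrightarrow> v \<noteq> 0" "v \<in> W \<Longrightarrow> v \<bullet> p < 0" "v \<in> W \<Longrightarrow> cen v \<noteq> 0"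
proof -
  assume v: "v \<in> W"
  then show v0: "v \<noteq> 0" by (auto simp: W_def)
  have "r * norm v > 0" using v0 r_pos by simp
  then show "v \<bullet> p < 0" using v by (simp add: W_def)
  show "cen v \<noteq> 0" using inner_cen[OF v0] v by (auto simp: W_h)
qed

lemma open_W: "open W"
  unfolding W_def by (intro open_Collect_less continuous_intros)

lemma minus_p_in_W: "- p \<in> W"
proof -
  have "r * norm p < norm p * norm p" using r_less_norm_p p_ne_0 by simp
  then show ?thesis by (simp add: W_def dot_square_norm power2_eq_square)
qed

lemma cone_W: "cone_set W"
proof -
  have "v + w \<in> W" if "v \<in> W" "w \<in> W" for v w
  proof -
    have "r * norm (v + w) \<le> r * norm v + r * norm w"
      using mult_left_mono[OF norm_triangle_ineq[of v w], of r] r_pos by (simp add: distrib_left)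
    then show ?thesis using that by (simp add: W_def inner_add_left)
  qed
  moreover have "t *\<^sub>R v \<in> W" if "v \<in> W" "t > 0" for v t
    using that by (simp add: W_h h_scale mult_pos_neg)
  ultimately show ?thesis by (simp add: cone_set_def)
qed

lemma duality_W: "v \<in> W \<Longrightarrow> u \<noteq> 0 \<Longrightarrow> u \<bullet> p \<ge> 0 \<Longrightarrow> v \<bullet> cen u = 0 \<longleftrightarrow> u \<bullet> cen v = 0"
  using polar_duality polar_duality_converse W_D by blast

text \<open>If the centres of a basis in W did not span, some u with u \<bullet> p \<ge> 0 would be
  orthogonal to all of them. By duality \<open>cen u\<close> would be orthogonal to the whole basis,
  against u \<bullet> cen u = h u > 0.\<close>

lemma cen_independent:
  assumes S: "S \<subseteq> W" "independent S"
  shows "independent (cen ` S)" "inj_on cen S"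
proof -
  obtain B where B: "S \<subseteq> B" "B \<subseteq> W" "independent B" "W \<subseteq> span B"
    using maximal_independent_subset_extend[OF S] by metis
  have finB: "finite B" using B(3) by (rule independent_imp_finite)
  have "dim W = DIM('a)" using minus_p_in_W by (intro dim_open open_W) auto
  then have dimB: "dim B = DIM('a)" using B dim_subset[of W "span B"] dim_subset_UNIV[of B] by simp
  then have spanB: "span B = UNIV" by (simp add: dim_eq_full)
  have cardB: "card B = DIM('a)" using dimB dim_eq_card_independent[OF B(3)] by simp
  have "dim (cen ` B) = DIM('a)"
  proof (rule ccontr)
    assume "dim (cen ` B) \<noteq> DIM('a)"
    then have d: "dim (cen ` B) < DIM('a)" using dim_subset_UNIV[of "cen ` B"] by simp
    have "\<exists>x. x \<noteq> 0 \<and> (\<forall>y\<in>span (cen ` B). orthogonal x y)"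
      by (rule orthogonal_to_subspace_exists[OF d]) blast
    then obtain x where x: "x \<noteq> 0" "\<And>b. b \<in> B \<Longrightarrow> x \<bullet> cen b = 0"
      by (auto simp: orthogonal_def span_base)
    define u where "u = (if x \<bullet> p \<ge> 0 then x else - x)"
    have u: "u \<noteq> 0" "u \<bullet> p \<ge> 0" "\<And>b. b \<in> B \<Longrightarrow> u \<bullet> cen b = 0"
      using x by (auto simp: u_def)
    have "cen u \<bullet> b = 0" if "b \<in> B" for b
      using duality_W[of b u] u that B(2) by (auto simp: inner_commute)
    then have "orthogonal (cen u) u"
      using orthogonal_to_span[of u B "cen u"] spanB by (auto simp: orthogonal_def)
    then show False using inner_cen[OF u(1)] h_pos[OF u(1,2)] by (simp add: orthogonal_def inner_commute)
  qed
  then have c: "card B \<le> dim (cen ` B)" using cardB by simp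
  also have "\<dots> \<le> card (cen ` B)" using finB by (intro dim_le_card') simp
  finally have "card (cen ` B) = card B" using card_image_le[OF finB, of cen] by simp
  then have inj: "inj_on cen B" using eq_card_imp_inj_on[OF finB] by blast
  have "independent (cen ` B)"
    using c \<open>card (cen ` B) = card B\<close> finB
    by (intro card_le_dim_spanning[of "cen ` B" "cen ` B"]) (auto intro: span_base)
  then show "independent (cen ` S)" "inj_on cen S"
    using independent_mono[OF _ image_mono[OF B(1)]] inj_on_subset[OF inj B(1)] by blast+
qed

text \<open>The relation between v, w and v + w becomes linear on the dual side: a vector orthogonal
  to \<open>cen v\<close> and \<open>cen w\<close> has, up to sign, a centre orthogonal to v and w,
  hence to v + w.\<close>

sublocale collin: cone_collineation W cen
proof
  show "3 \<le> DIM('a)" by (rule dim3)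
  show "open W" "cone_set W" by (fact open_W cone_W)+
  show "W \<noteq> {}" using minus_p_in_W by blast
  show "continuous_on W cen"
    by (rule continuous_on_subset[OF continuous_cen]) (use W_D in auto)
  show "cen (t *\<^sub>R v) = cen v" if "v \<in> W" "t > 0" for v t using that by (simp add: cen_scale)
  show "cen (v + w) \<in> span {cen v, cen w}" if vw: "v \<in> W" "w \<in> W" for v w
  proof (rule in_span_orthogonal)
    fix z assume z: "\<And>y. y \<in> {cen v, cen w} \<Longrightarrow> z \<bullet> y = 0"
    have vwW: "v + w \<in> W" using cone_W vw by (simp add: cone_set_def)
    have "u \<bullet> cen (v + w) = 0" if u: "u \<noteq> 0" "u \<bullet> p \<ge> 0" "u \<bullet> cen v = 0" "u \<bullet> cen w = 0" for u
      using duality_W[OF vw(1) u(1,2)] duality_W[OF vw(2) u(1,2)] duality_W[OF vwW u(1,2)] u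
      by (simp add: inner_add_left)
    from this[of z] this[of "- z"] z show "z \<bullet> cen (v + w) = 0"
      by (cases "z = 0"; cases "z \<bullet> p \<ge> 0") auto
  qed
  show "indep3 (cen u) (cen v) (cen w)" if uvw: "u \<in> W" "v \<in> W" "w \<in> W" "indep3 u v w" for u v w
    using uvw cen_independent[of "{w, v, u}"] unfolding indep3_iff_independent
    by (auto simp: inj_on_def)
qed

text \<open>The description of centres is carried back and forth: from \<open>W'\<close> to
  \<open>T\<close> for those u with u \<bullet> p \<ge> 0 for which some v in \<open>W'\<close> is
  orthogonal to \<open>T u\<close>, from these to \<open>A\<close> on all v with v \<bullet> p < 0,
  and from there back to \<open>T\<close> on all u with u \<bullet> p \<ge> 0.\<close>

theorem polarity:
  "\<exists>A. linear A \<and> (\<forall>x y. x \<bullet> A y = A x \<bullet> y) \<and> (\<forall>x. x \<noteq> 0 \<longrightarrow> x \<bullet> A x > 0) \<and>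
    (\<forall>w. w \<noteq> 0 \<longrightarrow> cen w = (h w / (w \<bullet> A w)) *\<^sub>R A w)"
proof -
  obtain W' A where W': "open W'" "W' \<noteq> {}" "W' \<subseteq> W" and A: "linear A"
    and gA: "\<And>v. v \<in> W' \<Longrightarrow> \<exists>c. c \<noteq> 0 \<and> A v = c *\<^sub>R cen v"
    using collin.collineation_linear by blast
  define T where "T = adjoint A"
  have T: "linear T" unfolding T_def by (rule adjoint_linear[OF A])
  have adj: "x \<bullet> T y = A x \<bullet> y" for x y unfolding T_def by (rule adjoint_works[OF A])
  have dual: "v \<bullet> cen u = 0 \<longleftrightarrow> v \<bullet> T u = 0" if vu: "v \<in> W'" "u \<noteq> 0" "u \<bullet> p \<ge> 0" for u v
  proof -
    obtain c where "c \<noteq> 0" "A v = c *\<^sub>R cen v" using gA[OF vu(1)] by blast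
    moreover have "v \<bullet> cen u = 0 \<longleftrightarrow> u \<bullet> cen v = 0" using duality_W vu W' by blast
    ultimately show ?thesis by (simp add: adj inner_commute)
  qed
  obtain v1 where v1: "v1 \<in> W'" using W' by blast
  \<comment> \<open>Inside the open set \<open>W'\<close>, \<open>cen u\<close> and
    \<open>T u\<close> have the same orthogonal vectors. If \<open>W'\<close> meets the hyperplane
    orthogonal to \<open>T u\<close>, this settles all directions of that hyperplane.\<close>
  have cen_T: "cen u \<in> span {T u}" if u: "u \<noteq> 0" "u \<bullet> p \<ge> 0" and v: "v \<in> W'" "v \<bullet> T u = 0" for u v
  proof (rule span1_orthogonal)
    fix d assume d: "d \<bullet> T u = 0"
    obtain \<epsilon> where e: "\<epsilon> > 0" "v + \<epsilon> *\<^sub>R d \<in> W'"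
      using interior_shift[of v W' d] v W' by (auto simp: interior_open)
    have "(v + \<epsilon> *\<^sub>R d) \<bullet> cen u = 0" "v \<bullet> cen u = 0"
      using dual[OF e(2) u] dual[OF v(1) u] v(2) d by (auto simp: inner_add_left)
    then show "d \<bullet> cen u = 0" using e by (simp add: inner_add_left)
  qed
  have T_inj0: "T u \<noteq> 0" if u: "u \<noteq> 0" "u \<bullet> p \<ge> 0" for u
  proof
    assume "T u = 0"
    then have "cen u \<in> span {0}" using cen_T[OF u v1] by simp
    then have "cen u = 0" by simp
    then show False using inner_cen[OF u(1)] h_pos[OF u] by simp
  qed
  have T_inj: "T u \<noteq> 0" if u: "u \<noteq> 0" for u
    using T_inj0[of u] T_inj0[of "- u"] u linear_neg[OF T, of u] by (cases "u \<bullet> p \<ge> 0") auto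
  then have "inj T" using T by (simp add: linear_injective_0) blast
  then have surjT: "surj T" using linear_injective_imp_surjective[OF T] by blast
  have A_inj: "A u \<noteq> 0" if "u \<noteq> 0" for u
  proof
    assume "A u = 0"
    obtain w where "u = T w" using surjT by (metis surjD)
    then have "u \<bullet> u = A u \<bullet> w" using adj by metis
    then show False using \<open>A u = 0\<close> that by simp
  qed
  have cen_A: "cen v \<in> span {A v}" if v: "v \<bullet> p < 0" for v
  proof (rule span1_orthogonal)
    \<comment> \<open>Orthogonality to \<open>A v1\<close> makes \<open>v1\<close> orthogonal to
      \<open>T u1\<close>, so \<open>cen_T\<close> is applicable at \<open>u1\<close>; orthogonality
      to \<open>A v\<close> is the relation to be dualised.\<close>
    obtain x where x: "x \<noteq> 0" "x \<bullet> A v = 0" "x \<bullet> A v1 = 0" using orthogonal_exists2[OF dim3] by blast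
    define u1 where "u1 = (if x \<bullet> p \<ge> 0 then x else - x)"
    have u1: "u1 \<noteq> 0" "u1 \<bullet> A v = 0" "u1 \<bullet> A v1 = 0" "u1 \<bullet> p \<ge> 0" using x by (auto simp: u1_def)
    have *: "\<exists>\<epsilon>>0. (u1 + \<epsilon> *\<^sub>R d) \<bullet> cen v = 0" if d: "d \<bullet> A v = 0" "d \<bullet> p \<ge> 0" for d
    proof -
      define u where "u \<epsilon> = u1 + \<epsilon> *\<^sub>R d" for \<epsilon>
      have ulim: "(u \<longlongrightarrow> u1) (at_right 0)" unfolding u_def by (rule tendsto_line)
      have Tlim: "((\<lambda>\<epsilon>. T (u \<epsilon>)) \<longlongrightarrow> T u1) (at_right 0)"
        by (rule bounded_linear.tendsto[OF T[unfolded linear_conv_bounded_linear] ulim] )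
      \<comment> \<open>\<open>v1\<close> corrected to be orthogonal to
        \<open>T (u \<epsilon>)\<close>. The correction tends to 0, so the vector stays in
        \<open>W'\<close>.\<close>
      define v' where "v' \<epsilon> = v1 - ((u \<epsilon> \<bullet> A v1) / (T (u \<epsilon>) \<bullet> T (u \<epsilon>))) *\<^sub>R T (u \<epsilon>)" for \<epsilon>
      have "(v' \<longlongrightarrow> v1 - ((u1 \<bullet> A v1) / (T u1 \<bullet> T u1)) *\<^sub>R T u1) (at_right 0)"
        unfolding v'_def using T_inj[OF u1(1)] by (intro tendsto_intros ulim Tlim) simp
      then have "(v' \<longlongrightarrow> v1) (at_right 0)" using u1 by simp
      then have "eventually (\<lambda>\<epsilon>. v' \<epsilon> \<in> W') (at_right 0)" using W'(1) v1 by (simp add: topological_tendstoD)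
      moreover have "eventually (\<lambda>\<epsilon>. u \<epsilon> \<noteq> 0) (at_right 0)"
        using ulim u1(1) by (simp add: tendsto_imp_eventually_ne)
      moreover have "eventually (\<lambda>\<epsilon>::real. \<epsilon> > 0) (at_right 0)" by (rule eventually_at_right_less)
      ultimately have "eventually (\<lambda>\<epsilon>. u \<epsilon> \<bullet> cen v = 0) (at_right 0)"
      proof eventually_elim
        case (elim \<epsilon>)
        have pu: "u \<epsilon> \<bullet> p \<ge> 0" using u1 d elim by (simp add: u_def inner_add_left)
        have "v' \<epsilon> \<bullet> T (u \<epsilon>) = 0"
          using T_inj[OF elim(2)] adj[of v1 "u \<epsilon>"]
          by (simp add: v'_def inner_diff_left inner_commute[of "A v1"])
        then have "cen (u \<epsilon>) \<in> span {T (u \<epsilon>)}" by (rule cen_T[OF elim(2) pu elim(1)])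
        then obtain c where c: "cen (u \<epsilon>) = c *\<^sub>R T (u \<epsilon>)" by (auto simp: in_span1)
        have "v \<bullet> cen (u \<epsilon>) = c * (u \<epsilon> \<bullet> A v)" by (simp add: c adj inner_commute)
        also have "\<dots> = 0" using u1 d by (simp add: u_def inner_add_left)
        finally show ?case by (rule polar_duality[OF elim(2) pu v])
      qed
      then show ?thesis unfolding u_def by (rule eventually_at_right_ex)
    qed
    have u1c: "u1 \<bullet> cen v = 0" using *[of 0] by simp
    have **: "d \<bullet> cen v = 0" if d: "d \<bullet> A v = 0" "d \<bullet> p \<ge> 0" for d
      using *[OF d] u1c by (auto simp: inner_add_left)
    fix d assume "d \<bullet> A v = 0"
    then show "d \<bullet> cen v = 0" using **[of d] **[of "- d"] by (cases "d \<bullet> p \<ge> 0") auto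
  qed
  have cen_T1: "cen u \<in> span {T u}" if u: "u \<noteq> 0" "u \<bullet> p \<ge> 0" and np: "T u \<notin> span {p}" for u
  proof (rule span1_orthogonal)
    \<comment> \<open>Sought is g orthogonal to \<open>T u\<close> with g \<bullet> p < 0 and h g >
      0: near it centres are nonzero, so the converse duality applies. A small tilt of
      \<open>g0\<close>, where g0 \<bullet> p = 0 and h g0 > 0, achieves this.\<close>
    obtain g0 where g0: "g0 \<noteq> 0" "g0 \<bullet> T u = 0" "g0 \<bullet> p = 0" using orthogonal_exists2[OF dim3] by blast
    have "indep2 p (T u)" using np p_ne_0 by (simp add: indep2_iff)
    then obtain y0 where y0: "y0 \<bullet> T u = 0" "y0 \<bullet> p \<noteq> 0"
      using indep2_separate[OF indep2_commute] by blast
    define y where "y = (- (y0 \<bullet> p)) *\<^sub>R y0"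
    have y: "y \<bullet> T u = 0" "y \<bullet> p < 0"
      using y0 by (auto simp: y_def zero_less_mult_iff linorder_neq_iff)
    have "((\<lambda>\<epsilon>. h (g0 + \<epsilon> *\<^sub>R y)) \<longlongrightarrow> h g0) (at_right 0)"
      unfolding h_def by (intro tendsto_intros tendsto_line)
    moreover have "h g0 > 0" using g0 h_pos by simp
    ultimately have "eventually (\<lambda>\<epsilon>. h (g0 + \<epsilon> *\<^sub>R y) > 0) (at_right 0)" by (rule order_tendstoD)
    then obtain \<delta> where \<delta>: "\<delta> > 0" "h (g0 + \<delta> *\<^sub>R y) > 0" using eventually_at_right_ex by blast
    define g where "g = g0 + \<delta> *\<^sub>R y"
    have g: "h g > 0" "g \<bullet> p < 0" "g \<bullet> T u = 0"
      using \<delta> g0 y by (auto simp: g_def inner_add_left mult_pos_neg)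
    have *: "v \<bullet> cen u = 0" if v: "h v > 0" "v \<bullet> p < 0" "v \<bullet> T u = 0" for v
    proof -
      have v0: "v \<noteq> 0" using v by auto
      have "cen v \<noteq> 0" using inner_cen[OF v0] v by auto
      moreover obtain c where "cen v = c *\<^sub>R A v" using cen_A[OF v(2)] by (auto simp: in_span1)
      then have "u \<bullet> cen v = 0" using v(3) by (simp add: adj inner_commute)
      ultimately show ?thesis using polar_duality_converse[OF u v(2)] by blast
    qed
    fix d assume d: "d \<bullet> T u = 0"
    have "((\<lambda>\<epsilon>. h (g + \<epsilon> *\<^sub>R d)) \<longlongrightarrow> h g) (at_right 0)" "((\<lambda>\<epsilon>. (g + \<epsilon> *\<^sub>R d) \<bullet> p) \<longlongrightarrow> g \<bullet> p) (at_right 0)"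
      unfolding h_def by (intro tendsto_intros tendsto_line)+
    then have "eventually (\<lambda>\<epsilon>. h (g + \<epsilon> *\<^sub>R d) > 0 \<and> (g + \<epsilon> *\<^sub>R d) \<bullet> p < 0) (at_right 0)"
      using g by (intro eventually_conj order_tendstoD) auto
    then obtain \<epsilon> where e: "\<epsilon> > 0" "h (g + \<epsilon> *\<^sub>R d) > 0" "(g + \<epsilon> *\<^sub>R d) \<bullet> p < 0"
      using eventually_at_right_ex by blast
    then have "(g + \<epsilon> *\<^sub>R d) \<bullet> cen u = 0" using g d by (intro *) (auto simp: inner_add_left)
    moreover have "g \<bullet> cen u = 0" using * g by blast
    ultimately show "d \<bullet> cen u = 0" using e by (simp add: inner_add_left)
  qed
  have cen_T2: "cen u \<in> span {T u}" if u: "u \<noteq> 0" "u \<bullet> p \<ge> 0" for u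
  proof (cases "T u \<in> span {p}")
    case True
    obtain x where x: "x \<notin> span {p, p}" using collin.escape_span2[OF open_UNIV UNIV_not_empty, of p p] by blast
    obtain w0 where "x = T w0" using surjT by (metis surjD)
    define w where "w = (if w0 \<bullet> p \<ge> 0 then w0 else - w0)"
    have w: "T w \<notin> span {p}" "w \<bullet> p \<ge> 0"
      using x \<open>x = T w0\<close> linear_neg[OF T, of w0] span_neg[of "- x" "{p}"] by (auto simp: w_def)
    show ?thesis
    proof (rule span1_limit)
      show "((\<lambda>\<epsilon>. cen (u + \<epsilon> *\<^sub>R w)) \<longlongrightarrow> cen u) (at_right 0)" by (intro tendsto_cen tendsto_line u)
      show "((\<lambda>\<epsilon>. T (u + \<epsilon> *\<^sub>R w)) \<longlongrightarrow> T u) (at_right 0)"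
        by (rule bounded_linear.tendsto[OF T[unfolded linear_conv_bounded_linear] tendsto_line])
      show "T u \<noteq> 0" by (rule T_inj[OF u(1)])
      show "eventually (\<lambda>\<epsilon>. cen (u + \<epsilon> *\<^sub>R w) \<in> span {T (u + \<epsilon> *\<^sub>R w)}) (at_right 0)"
        using eventually_at_right_less[of "0::real"]
      proof eventually_elim
        case (elim \<epsilon>)
        have "T (u + \<epsilon> *\<^sub>R w) = T u + \<epsilon> *\<^sub>R T w" using T by (simp add: linear_add linear_scale)
        moreover have "\<epsilon> *\<^sub>R T w \<notin> span {p}" using w(1) elim span_scale[of "\<epsilon> *\<^sub>R T w" "{p}" "inverse \<epsilon>"] by auto
        ultimately have "T (u + \<epsilon> *\<^sub>R w) \<notin> span {p}" using True by (simp add: span_add_eq)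
        moreover from this have "u + \<epsilon> *\<^sub>R w \<noteq> 0" using span_zero linear_0[OF T] by metis
        ultimately show ?case using u w elim by (intro cen_T1) (auto simp: inner_add_left)
      qed
    qed
  qed (rule cen_T1[OF u])
  have cen_A0: "cen u \<in> span {A u}" if u: "u \<noteq> 0" "u \<bullet> p = 0" for u
  proof (rule span1_limit)
    show "((\<lambda>\<epsilon>. cen (u + \<epsilon> *\<^sub>R (- p))) \<longlongrightarrow> cen u) (at_right 0)" by (intro tendsto_cen tendsto_line u)
    show "((\<lambda>\<epsilon>. A (u + \<epsilon> *\<^sub>R (- p))) \<longlongrightarrow> A u) (at_right 0)"
      by (rule bounded_linear.tendsto[OF A[unfolded linear_conv_bounded_linear] tendsto_line])
    show "A u \<noteq> 0" by (rule A_inj[OF u(1)])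
    show "eventually (\<lambda>\<epsilon>. cen (u + \<epsilon> *\<^sub>R (- p)) \<in> span {A (u + \<epsilon> *\<^sub>R (- p))}) (at_right 0)"
      using eventually_at_right_less[of "0::real"]
    proof eventually_elim
      case (elim \<epsilon>)
      show ?case by (rule cen_A) (use u elim p_ne_0 in \<open>auto simp: inner_diff_left\<close>)
    qed
  qed
  \<comment> \<open>Here \<open>cen u\<close> is a multiple of both \<open>A u\<close> and
    \<open>T u\<close>, and u \<bullet> T u = u \<bullet> A u makes the factors equal.\<close>
  have AT0: "A u = T u" if u: "u \<bullet> p = 0" for u
  proof (cases "u = 0")
    case False
    obtain a where a: "cen u = a *\<^sub>R A u" using cen_A0[OF False u] by (auto simp: in_span1)
    obtain b where b: "cen u = b *\<^sub>R T u" using cen_T2[of u] False u by (auto simp: in_span1)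
    have "u \<bullet> cen u > 0" using inner_cen[OF False] h_pos[OF False] u by simp
    moreover have "u \<bullet> T u = u \<bullet> A u" by (simp add: adj inner_commute)
    moreover have "u \<bullet> cen u = a * (u \<bullet> A u)" by (simp add: a)
    moreover have "u \<bullet> cen u = b * (u \<bullet> T u)" by (simp add: b)
    ultimately have "a = b" "a \<noteq> 0" by auto
    then have "a *\<^sub>R A u = a *\<^sub>R T u" using a b by simp
    then show ?thesis using \<open>a \<noteq> 0\<close> by simp
  qed (simp add: linear_0 A T)
  have AT: "A x = T x" for x
  proof -
    have "A p = T p"
    proof (rule vector_eq_ldot[THEN iffD1], rule allI)
      fix z
      define c where "c = (z \<bullet> p) / (p \<bullet> p)"
      define u where "u = z - c *\<^sub>R p"
      have u: "u \<bullet> p = 0" using p_ne_0 by (simp add: u_def c_def inner_diff_left)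
      have z: "z = u + c *\<^sub>R p" by (simp add: u_def)
      have "u \<bullet> A p = u \<bullet> T p"
        using adj[of p u] adj[of u p] AT0[OF u] by (simp add: inner_commute)
      moreover have "p \<bullet> A p = p \<bullet> T p" using adj[of p p] by (simp add: inner_commute)
      ultimately show "z \<bullet> A p = z \<bullet> T p" by (simp add: z inner_add_left)
    qed
    define c where "c = (x \<bullet> p) / (p \<bullet> p)"
    define u where "u = x - c *\<^sub>R p"
    have u: "u \<bullet> p = 0" using p_ne_0 by (simp add: u_def c_def inner_diff_left)
    have x: "x = u + c *\<^sub>R p" by (simp add: u_def)
    show ?thesis unfolding x using AT0[OF u] \<open>A p = T p\<close> A T by (simp add: linear_add linear_scale)
  qed
  have symA: "x \<bullet> A y = A x \<bullet> y" for x y using adj by (simp add: AT)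
  have cenA: "cen w \<in> span {A w}" if "w \<noteq> 0" for w
    using cen_A[of w] cen_T2[OF that] by (cases "w \<bullet> p \<ge> 0") (auto simp: AT)
  have quad0: "w \<bullet> A w \<noteq> 0" if w: "w \<noteq> 0" "w \<bullet> p \<ge> 0" for w
    using cenA[OF w(1)] inner_cen[OF w(1)] h_pos[OF w] by (auto simp: in_span1)
  have quad: "w \<bullet> A w \<noteq> 0" if w: "w \<noteq> 0" for w
    using quad0[of w] quad0[of "- w"] w linear_neg[OF A, of w] by (cases "w \<bullet> p \<ge> 0") auto
  have cen_eq: "cen w = (h w / (w \<bullet> A w)) *\<^sub>R A w" if w: "w \<noteq> 0" for w
  proof -
    obtain c where c: "cen w = c *\<^sub>R A w" using cenA[OF w] by (auto simp: in_span1)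
    then have "c * (w \<bullet> A w) = h w" using inner_cen[OF w] by simp
    then show ?thesis using c quad[OF w] by (simp add: field_simps)
  qed
  have contA: "continuous_on S A" for S by (rule linear_continuous_on[OF A[unfolded linear_conv_bounded_linear]])
  have "connected (- {0::'a})" using dim3 by (intro connected_punctured_universe) simp
  then have conn: "connected ((\<lambda>w. w \<bullet> A w) ` (- {0}))"
    by (intro connected_continuous_image continuous_intros contA)
  have "(\<forall>w. w \<noteq> 0 \<longrightarrow> w \<bullet> A w > 0) \<or> (\<forall>w. w \<noteq> 0 \<longrightarrow> w \<bullet> A w < 0)"
  proof (rule ccontr)
    assume "\<not> ?thesis"
    then obtain w z where "w \<noteq> 0" "w \<bullet> A w \<le> 0" "z \<noteq> 0" "z \<bullet> A z \<ge> 0" by (auto simp: not_less)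
    then have "0 \<in> (\<lambda>w. w \<bullet> A w) ` (- {0})"
      using connectedD_interval[OF conn, of "w \<bullet> A w" "z \<bullet> A z" 0] by auto
    then obtain x where "x \<noteq> 0" "x \<bullet> A x = 0" by force
    then show False using quad by blast
  qed
  then show ?thesis
  proof
    assume "\<forall>w. w \<noteq> 0 \<longrightarrow> w \<bullet> A w > 0"
    then show ?thesis using A symA cen_eq by blast
  next
    \<comment> \<open>The formula for \<open>cen\<close> does not change when A is replaced by
      -A.\<close>
    assume neg: "\<forall>w. w \<noteq> 0 \<longrightarrow> w \<bullet> A w < 0"
    have "linear (\<lambda>x. - A x)" using A by (intro linear_compose_neg)
    moreover have "x \<bullet> - A y = - A x \<bullet> y" for x y using symA by simp
    moreover have "x \<bullet> - A x > 0" if "x \<noteq> 0" for x using neg that by simp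
    moreover have "cen w = (h w / (w \<bullet> - A w)) *\<^sub>R - A w" if "w \<noteq> 0" for w
      using cen_eq[OF that] by simp
    ultimately show ?thesis by (intro exI[of _ "\<lambda>x. - A x"]) blast
  qed
qed

end

section \<open>Invariance under reflections of tangent sections\<close>

text \<open>If neither functional vanishes on the hyperplane orthogonal to c, the projections of a
  and g to it are nonzero. Testing at the first projection makes them orthogonal, and testing at
  their sum gives a contradiction.\<close>

lemma vanishing_product:
  fixes a g c :: "'a::euclidean_space"
  assumes "\<And>v. v \<bullet> c = 0 \<Longrightarrow> (a \<bullet> v) * (g \<bullet> v) = 0"
  shows "a \<in> span {c} \<or> g \<in> span {c}"
proof (rule ccontr)
  assume n: "\<not> ?thesis"
  define pr where "pr x = x - ((x \<bullet> c) / (c \<bullet> c)) *\<^sub>R c" for x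
  have pr: "pr x \<bullet> c = 0" for x by (simp add: pr_def inner_diff_left)
  have ip: "x \<bullet> v = pr x \<bullet> v" if "v \<bullet> c = 0" for x v
    using that by (simp add: pr_def inner_diff_left inner_commute[of c v])
  have ne: "pr x \<noteq> 0" if "x \<notin> span {c}" for x
  proof
    assume "pr x = 0"
    then have "x = ((x \<bullet> c) / (c \<bullet> c)) *\<^sub>R c" unfolding pr_def by (rule eq_iff_diff_eq_0[THEN iffD2])
    then have "x \<in> span {c}" unfolding in_span1 by (rule exI)
    then show False using that by simp
  qed
  have nz: "pr a \<noteq> 0" "pr g \<noteq> 0" using n ne by blast+
  have e: "(pr a \<bullet> v) * (pr g \<bullet> v) = 0" if "v \<bullet> c = 0" for v
    using assms[OF that] by (simp only: ip[OF that, of a, symmetric] ip[OF that, of g, symmetric])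
  have "(pr a \<bullet> pr a) * (pr g \<bullet> pr a) = 0" by (rule e[OF pr])
  then have o: "pr g \<bullet> pr a = 0" using nz by simp
  have "(pr a \<bullet> (pr a + pr g)) * (pr g \<bullet> (pr a + pr g)) = 0" by (rule e) (simp add: inner_add_left pr)
  then have "(pr a \<bullet> pr a) * (pr g \<bullet> pr g) = 0"
    using o by (simp add: inner_add_right inner_commute[of "pr a" "pr g"])
  then show False using nz by simp
qed

lemma finite_quadratic_roots:
  fixes a b c :: real
  assumes "c \<noteq> 0"
  shows "finite {t. a + b * t + c * t\<^sup>2 = 0}"
proof -
  have "finite {t. poly [:a, b, c:] t = 0}" using assms by (intro poly_roots_finite) simp
  then show ?thesis by (simp add: algebra_simps power2_eq_square)
qed

text \<open>The map in \<open>reflect\<close> is the half-turn about the line through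
  \<open>A w\<close> for the form x \<bullet> J x: the centre of a tangent section is the
  J-orthogonal projection to this line of every point of the section.\<close>

locale reflection_body =
  fixes K :: "'a::euclidean_space set" and p :: 'a and r :: real and A J :: "'a \<Rightarrow> 'a"
  assumes dim3: "3 \<le> DIM('a)"
    and compact_K: "compact K" and convex_K: "convex K" and uminus_K: "\<And>x. x \<in> K \<Longrightarrow> - x \<in> K"
    and r_pos: "r > 0" and ball_in: "cball p r \<subseteq> interior K" and p_ne_0: "p \<noteq> 0"
    and A: "linear A" and J: "linear J" and AJ: "\<And>x. A (J x) = x" and JA: "\<And>x. J (A x) = x"
    and symA: "\<And>x y. x \<bullet> A y = A x \<bullet> y" and posA: "\<And>x. x \<noteq> 0 \<Longrightarrow> x \<bullet> A x > 0"
    and reflect: "\<And>w y. norm w = 1 \<Longrightarrow> y \<in> K \<Longrightarrow> w \<bullet> (y - p) = r \<Longrightarrow>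
      (2 * (w \<bullet> y) / (w \<bullet> A w)) *\<^sub>R A w - y \<in> K"
begin

lemma A_simps: "A (x + y) = A x + A y" "A (x - y) = A x - A y" "A (t *\<^sub>R x) = t *\<^sub>R A x" "A 0 = 0"
  by (fact linear_add[OF A] linear_diff[OF A] linear_scale[OF A] linear_0[OF A])+

lemma J_simps: "J (x + y) = J x + J y" "J (x - y) = J x - J y" "J (t *\<^sub>R x) = t *\<^sub>R J x" "J 0 = 0" "J (- x) = - J x"
  by (fact linear_add[OF J] linear_diff[OF J] linear_scale[OF J] linear_0[OF J] linear_neg[OF J])+

lemma symJ: "x \<bullet> J y = J x \<bullet> y"
  using symA[of "J x" "J y"] by (simp add: AJ)

lemma posJ: "x \<noteq> 0 \<Longrightarrow> x \<bullet> J x > 0"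
proof -
  assume "x \<noteq> 0"
  then have "J x \<noteq> 0" using AJ[of x] A_simps(4) by auto
  from posA[OF this] show ?thesis by (simp add: AJ inner_commute)
qed

lemma A_J_inner: "A w \<bullet> J x = w \<bullet> x"
  using symJ[of "A w" x] by (simp add: JA)

lemma cont_A: "continuous_on S A" and cont_J: "continuous_on S J"
  by (rule linear_continuous_on[OF A[unfolded linear_conv_bounded_linear]],
      rule linear_continuous_on[OF J[unfolded linear_conv_bounded_linear]])

lemma nonempty: "p \<in> K" "0 \<in> K"
proof -
  have "p \<in> cball p r" using r_pos by simp
  then show "p \<in> K" using ball_in interior_subset by blast
  from convexD[OF convex_K this uminus_K[OF this], of "1/2" "1/2"] show "0 \<in> K" by simp
qed

section \<open>The level set of the maximum and its half-turns\<close>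

definition m :: real where "m = Sup ((\<lambda>x. x \<bullet> J x) ` K)"

lemma m_attained: "\<exists>x\<in>K. x \<bullet> J x = m" and m_upper: "x \<in> K \<Longrightarrow> x \<bullet> J x \<le> m"
proof -
  have "\<exists>x\<in>K. \<forall>y\<in>K. y \<bullet> J y \<le> x \<bullet> J x"
    using compact_K nonempty by (intro continuous_attains_sup continuous_intros cont_J) auto
  then obtain z where z: "z \<in> K" "\<And>y. y \<in> K \<Longrightarrow> y \<bullet> J y \<le> z \<bullet> J z" by blast
  have "m = z \<bullet> J z" unfolding m_def using z by (intro cSup_eq_maximum) auto
  then show "\<exists>x\<in>K. x \<bullet> J x = m" and "x \<in> K \<Longrightarrow> x \<bullet> J x \<le> m" using z by auto
qed

lemma m_pos: "m > 0"
  using m_upper[OF nonempty(1)] posJ[OF p_ne_0] by simp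

definition M :: "'a set" where "M = {x \<in> K. x \<bullet> J x = m}"

lemma M_D: "x \<in> M \<Longrightarrow> x \<in> K" "x \<in> M \<Longrightarrow> x \<bullet> J x = m" "x \<in> M \<Longrightarrow> x \<noteq> 0"
  using m_pos by (auto simp: M_def)

lemma compact_M: "compact M"
proof -
  have "closed {x. x \<bullet> J x = m}" by (intro closed_Collect_eq continuous_intros cont_J)
  moreover have "M = K \<inter> {x. x \<bullet> J x = m}" by (auto simp: M_def)
  ultimately show ?thesis using compact_Int_closed[OF compact_K] by simp
qed

lemma M_not_interior: "y \<in> M \<Longrightarrow> y \<notin> interior K"
proof
  assume y: "y \<in> M" "y \<in> interior K"
  obtain \<epsilon> where e: "\<epsilon> > 0" "y + \<epsilon> *\<^sub>R y \<in> interior K" using interior_shift[OF y(2)] by blast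
  then have "(y + \<epsilon> *\<^sub>R y) \<bullet> J (y + \<epsilon> *\<^sub>R y) \<le> m" using m_upper interior_subset by blast
  moreover have "(y + \<epsilon> *\<^sub>R y) \<bullet> J (y + \<epsilon> *\<^sub>R y) = (1 + \<epsilon>)\<^sup>2 * m"
    using M_D[OF y(1)] by (simp add: J_simps inner_add_left inner_add_right power2_eq_square algebra_simps)
  moreover have "(1 + \<epsilon>)\<^sup>2 > 1" using e by (simp add: power2_eq_square algebra_simps add_pos_pos)
  ultimately show False using m_pos by (simp add: mult_le_cancel_right1 not_le)
qed

text \<open>Points of \<open>M\<close> are not interior to K, hence lie outside the ball. This makes
  the sphere of tangent normals through them nondegenerate.\<close>

lemma M_far: "y \<in> M \<Longrightarrow> (y - p) \<bullet> (y - p) > r\<^sup>2"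
proof -
  assume "y \<in> M"
  then have "y \<notin> cball p r" using M_not_interior ball_in by blast
  then have "norm (y - p) > r" by (simp add: dist_norm norm_minus_commute)
  then show ?thesis using r_pos by (simp add: dot_square_norm power_strict_mono)
qed

lemma strict_CS:
  assumes "x \<bullet> J x = m" "y \<bullet> J y = m" "x \<noteq> y"
  shows "x \<bullet> J y < m"
proof -
  have "(x - y) \<bullet> J (x - y) > 0" using assms by (intro posJ) simp
  moreover have "y \<bullet> J x = x \<bullet> J y" using symJ[of y x] by (simp add: inner_commute)
  ultimately show ?thesis using assms by (simp add: J_simps inner_diff_left inner_diff_right)
qed

definition image_pt :: "'a \<Rightarrow> 'a \<Rightarrow> 'a" where
  "image_pt y w = (2 * (w \<bullet> y) / (w \<bullet> A w)) *\<^sub>R A w - y"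

text \<open>The unit outer normals of the tangent hyperplanes of the ball that pass through
  y.\<close>

definition tangents :: "'a \<Rightarrow> 'a set" where
  "tangents y = {w. norm w = 1 \<and> w \<bullet> (y - p) = r}"

lemma tangents_D: "w \<in> tangents y \<Longrightarrow> w \<noteq> 0" "w \<in> tangents y \<Longrightarrow> w \<bullet> A w > 0"
proof -
  assume "w \<in> tangents y"
  then show "w \<noteq> 0" by (auto simp: tangents_def)
  then show "w \<bullet> A w > 0" by (rule posA)
qed

lemma inner_image_pt: "w \<in> tangents y \<Longrightarrow> w \<bullet> image_pt y w = w \<bullet> y"
  using tangents_D(2)[of w y] by (simp add: image_pt_def inner_diff_right)

lemma image_pt_M: "y \<in> M \<Longrightarrow> w \<in> tangents y \<Longrightarrow> image_pt y w \<in> M"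
proof -
  assume y: "y \<in> M" and w: "w \<in> tangents y"
  have "image_pt y w \<in> K"
    unfolding image_pt_def using reflect[of w y] M_D(1)[OF y] w by (simp add: tangents_def)
  moreover have "image_pt y w \<bullet> J (image_pt y w) = y \<bullet> J y"
  proof -
    define t where "t = 2 * (w \<bullet> y) / (w \<bullet> A w)"
    have I: "image_pt y w = t *\<^sub>R A w - y" by (simp add: image_pt_def t_def)
    have "image_pt y w \<bullet> J (image_pt y w) = t * (t * (w \<bullet> A w)) - 2 * t * (w \<bullet> y) + y \<bullet> J y"
      unfolding I by (simp add: J_simps JA inner_diff_left inner_diff_right A_J_inner inner_commute[of y w]
          inner_commute[of "A w" w] algebra_simps)
    moreover have "t * (w \<bullet> A w) = 2 * (w \<bullet> y)" using tangents_D(2)[OF w] by (simp add: t_def)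
    ultimately show ?thesis by simp
  qed
  ultimately show ?thesis using M_D(2)[OF y] by (simp add: M_def)
qed

lemma tangents_image_pt: "w \<in> tangents y \<Longrightarrow> w \<in> tangents (image_pt y w)"
  using inner_image_pt[of w y] by (simp add: tangents_def inner_diff_right)

lemma image_pt_image_pt: "w \<in> tangents y \<Longrightarrow> image_pt (image_pt y w) w = y"
  unfolding image_pt_def[of "image_pt y w"] inner_image_pt by (simp add: image_pt_def)

text \<open>With a = y - p, the set \<open>tangents y\<close> is the sphere with centre
  \<open>foot a\<close> and radius \<open>rad a\<close> inside the hyperplane w \<bullet> a =
  r.\<close>

definition foot :: "'a \<Rightarrow> 'a" where "foot a = (r / (a \<bullet> a)) *\<^sub>R a"

definition rad :: "'a \<Rightarrow> real" where "rad a = sqrt (1 - r\<^sup>2 / (a \<bullet> a))"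

lemma rad: "a \<bullet> a > r\<^sup>2 \<Longrightarrow> rad a > 0" "a \<bullet> a > r\<^sup>2 \<Longrightarrow> (rad a)\<^sup>2 = 1 - r\<^sup>2 / (a \<bullet> a)"
proof -
  assume a: "a \<bullet> a > r\<^sup>2"
  then have "a \<bullet> a > 0" using zero_le_power2[of r] by linarith
  then have "r\<^sup>2 / (a \<bullet> a) < 1" using a by simp
  then show "rad a > 0" "(rad a)\<^sup>2 = 1 - r\<^sup>2 / (a \<bullet> a)" by (simp_all add: rad_def)
qed

lemma tangent_foot:
  assumes y: "(y - p) \<bullet> (y - p) > r\<^sup>2" and e: "e \<bullet> (y - p) = 0" "e \<bullet> e = (rad (y - p))\<^sup>2"
  shows "foot (y - p) + e \<in> tangents y"
proof -
  define a where "a = y - p"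
  have a: "a \<bullet> a > 0" using y zero_le_power2[of r] unfolding a_def by linarith
  have "(foot a + e) \<bullet> a = r" using e a by (simp add: foot_def inner_add_left a_def)
  moreover have "foot a \<bullet> foot a = r\<^sup>2 / (a \<bullet> a)" using a by (simp add: foot_def power2_eq_square)
  moreover have "foot a \<bullet> e = 0" "e \<bullet> foot a = 0" using e by (simp_all add: foot_def a_def inner_commute)
  ultimately have "(foot a + e) \<bullet> (foot a + e) = 1" "(foot a + e) \<bullet> a = r"
    using e(2) rad(2)[OF y] by (auto simp: inner_add_left inner_add_right a_def)
  then show ?thesis by (simp add: tangents_def a_def norm_eq_1)
qed

lemma tangent_decomp:
  assumes y: "(y - p) \<bullet> (y - p) > r\<^sup>2" and w: "w \<in> tangents y"
  defines "e \<equiv> w - foot (y - p)"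
  shows "e \<bullet> (y - p) = 0" "e \<bullet> e = (rad (y - p))\<^sup>2"
proof -
  define a where "a = y - p"
  have a: "a \<bullet> a > 0" using y zero_le_power2[of r] unfolding a_def by linarith
  have w: "w \<bullet> w = 1" "w \<bullet> a = r" using w by (auto simp: tangents_def norm_eq_1 a_def)
  show "e \<bullet> (y - p) = 0" using a w by (simp add: e_def foot_def inner_diff_left a_def[symmetric])
  have "foot a \<bullet> foot a = r\<^sup>2 / (a \<bullet> a)" "foot a \<bullet> w = r\<^sup>2 / (a \<bullet> a)"
    using a w by (simp_all add: foot_def power2_eq_square inner_commute)
  then show "e \<bullet> e = (rad (y - p))\<^sup>2"
    using rad(2)[OF y] w
    by (simp add: e_def a_def[symmetric] inner_diff_left inner_diff_right inner_commute[of w "foot a"])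
qed

text \<open>Great circles of the sphere of tangent normals; they supply the curves for derivatives,
  limits and connectedness.\<close>

lemma tangent_curve:
  assumes y: "(y - p) \<bullet> (y - p) > r\<^sup>2"
    and e: "e \<bullet> (y - p) = 0" "e \<bullet> e = (rad (y - p))\<^sup>2"
    and f: "f \<bullet> (y - p) = 0" "f \<bullet> f = (rad (y - p))\<^sup>2" "e \<bullet> f = 0"
  shows "foot (y - p) + (cos \<theta> *\<^sub>R e + sin \<theta> *\<^sub>R f) \<in> tangents y"
proof (rule tangent_foot[OF y])
  show "(cos \<theta> *\<^sub>R e + sin \<theta> *\<^sub>R f) \<bullet> (y - p) = 0" using e f by (simp add: inner_add_left)
  have "(cos \<theta> *\<^sub>R e + sin \<theta> *\<^sub>R f) \<bullet> (cos \<theta> *\<^sub>R e + sin \<theta> *\<^sub>R f) =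
      (cos \<theta>)\<^sup>2 * (e \<bullet> e) + (sin \<theta>)\<^sup>2 * (f \<bullet> f)"
    using f(3) by (simp add: inner_add_left inner_add_right inner_commute[of f e] power2_eq_square)
  also have "\<dots> = ((cos \<theta>)\<^sup>2 + (sin \<theta>)\<^sup>2) * (rad (y - p))\<^sup>2"
    by (simp only: e(2) f(2) distrib_right)
  finally show "(cos \<theta> *\<^sub>R e + sin \<theta> *\<^sub>R f) \<bullet> (cos \<theta> *\<^sub>R e + sin \<theta> *\<^sub>R f) = (rad (y - p))\<^sup>2" by simp
qed

lemma rescale:
  fixes v :: 'a
  assumes "v \<noteq> 0"
  shows "((s / norm v) *\<^sub>R v) \<bullet> ((s / norm v) *\<^sub>R v) = s\<^sup>2"
  using assms by (simp add: dot_square_norm power2_eq_square)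

section \<open>Nearest points and the first-order condition\<close>

text \<open>On the level set (x - z) \<bullet> J (x - z) = 2 m - 2 (x \<bullet> J z), so maximising
  x \<bullet> J z means minimising the J-distance from x.\<close>

definition nearest :: "'a \<Rightarrow> 'a \<Rightarrow> bool" where
  "nearest x y \<longleftrightarrow> x \<bullet> J x = m \<and> x \<notin> K \<and> y \<in> M \<and> (\<forall>z\<in>M. x \<bullet> J z \<le> x \<bullet> J y)"

lemma indep2_M:
  assumes "x \<bullet> J x = m" "x \<notin> K" "y \<in> M"
  shows "indep2 x y"
proof -
  have x: "x \<noteq> 0" using assms m_pos by auto
  have False if c: "y = c *\<^sub>R x" for c
  proof -
    have "c * (c * m) = m" using M_D(2)[OF assms(3)] assms(1) by (simp add: c J_simps)
    then have "c * c = 1" using m_pos by (simp add: mult.assoc[symmetric])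
    then have "c = 1 \<or> c = -1" by (simp add: square_eq_1_iff)
    then show False using c assms(2,3) uminus_K[of y] M_D(1) by auto
  qed
  then show ?thesis using x by (auto simp: indep2_iff in_span1)
qed

text \<open>For \<xi> orthogonal to y, \<open>E \<xi> y w\<close> is w \<bullet> A w times \<xi>
  \<bullet> (p + r w - z) with z = image_pt y w. It vanishes when \<xi> is orthogonal to the segment
  from the touching point to z; the factor makes it a cubic polynomial in w.\<close>

definition E :: "'a \<Rightarrow> 'a \<Rightarrow> 'a \<Rightarrow> real" where
  "E \<xi> y w = (w \<bullet> A w) * (\<xi> \<bullet> (p + r *\<^sub>R w)) - 2 * (w \<bullet> y) * (\<xi> \<bullet> A w)"

text \<open>First-order condition: \<open>y\<close> maximises \<open>\<lambda>z. x \<bullet> J z\<close> on \<open>M\<close>, in particular among the images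
  of \<open>z = image_pt y w\<close>, one of which is \<open>y\<close> itself.\<close>

lemma E_zero_generic:
  assumes n: "nearest x y" and w: "w \<in> tangents y" and nd: "w \<bullet> y \<noteq> 0 \<or> w \<bullet> x \<noteq> 0"
    and \<xi>: "\<xi> \<bullet> x = 0" "\<xi> \<bullet> y = 0"
  shows "E \<xi> y w = 0"
proof -
  have x: "x \<bullet> J x = m" "x \<notin> K" and y: "y \<in> M" and ymax: "\<And>z. z \<in> M \<Longrightarrow> x \<bullet> J z \<le> x \<bullet> J y"
    using n by (auto simp: nearest_def)
  define k where "k = w \<bullet> y"
  define z where "z = image_pt y w"
  have z: "z \<in> M" and wz: "w \<in> tangents z" and kz: "w \<bullet> z = k" and yz: "image_pt z w = y"
    unfolding z_def k_def using image_pt_M[OF y w] tangents_image_pt[OF w] inner_image_pt[OF w] image_pt_image_pt[OF w]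
    by auto
  note far = M_far[OF z]
  define a where "a = z - p"
  have wa: "w \<bullet> w = 1" "w \<bullet> a = r" using wz by (auto simp: tangents_def norm_eq_1 a_def)
  \<comment> \<open>The vector from the touching point p + r w to z, which is the component of z - p
    orthogonal to w.\<close>
  define t where "t = a - r *\<^sub>R w"
  have tw: "t \<bullet> w = 0" using wa by (simp add: t_def inner_diff_left inner_commute[of a w])
  have "t \<bullet> t = a \<bullet> a - r\<^sup>2"
    using wa by (simp add: t_def inner_diff_left inner_diff_right inner_commute power2_eq_square)
  then have tt: "t \<bullet> t > 0" using far by (simp add: a_def)
  \<comment> \<open>The combination of x and y orthogonal to w, nonzero by \<open>nd\<close>. The
    goal is that V is parallel to t; then \<xi>, orthogonal to V, is orthogonal to t.\<close>
  define V where "V = k *\<^sub>R x - (w \<bullet> x) *\<^sub>R y"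
  have Vw: "V \<bullet> w = 0" by (simp add: V_def inner_diff_left k_def inner_commute[of x w] inner_commute[of y w])
  \<comment> \<open>The part of V orthogonal to t. If nonzero, it is a direction in which w can move
    within \<open>tangents z\<close>, and the derivative there is proportional to V' \<bullet>
    V'.\<close>
  define V' where "V' = V - ((V \<bullet> t) / (t \<bullet> t)) *\<^sub>R t"
  have V't: "V' \<bullet> t = 0" using tt by (simp add: V'_def inner_diff_left)
  have V'w: "V' \<bullet> w = 0" using Vw tw by (simp add: V'_def inner_diff_left)
  have V'a: "V' \<bullet> a = 0"
  proof -
    have "a = t + r *\<^sub>R w" by (simp add: t_def)
    then show ?thesis using V't V'w by (simp add: inner_add_right)
  qed
  have V'V: "V' \<bullet> V = V' \<bullet> V'" using V't by (simp add: V'_def inner_diff_right)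
  have Awpos: "w \<bullet> A w > 0" by (rule tangents_D(2)[OF w])
  have "V' = 0"
  proof (rule ccontr)
    assume V'0: "V' \<noteq> 0"
    define e where "e = w - foot a"
    define f where "f = (rad a / norm V') *\<^sub>R V'"
    have e: "e \<bullet> a = 0" "e \<bullet> e = (rad a)\<^sup>2"
      using tangent_decomp[OF far wz] by (auto simp: e_def a_def)
    have ff: "f \<bullet> f = (rad a)\<^sup>2" unfolding f_def by (rule rescale[OF V'0])
    have fa: "f \<bullet> a = 0" using V'a by (simp add: f_def)
    have fw: "f \<bullet> w = 0" using V'w by (simp add: f_def)
    have ef: "e \<bullet> f = 0" using fa fw by (simp add: e_def foot_def inner_diff_left inner_commute[of w f] inner_commute[of a f])
    define W where "W \<theta> = foot a + (cos \<theta> *\<^sub>R e + sin \<theta> *\<^sub>R f)" for \<theta>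
    have W: "W \<theta> \<in> tangents z" for \<theta>
      unfolding W_def a_def by (rule tangent_curve[OF far]) (use e ff fa ef in \<open>auto simp: a_def\<close>)
    have W0: "W 0 = w" by (simp add: W_def e_def)
    \<comment> \<open>Up to the factor 2 and the constant x \<bullet> J z this is x \<bullet> J of
      the image of z, and \<theta> = 0 gives y itself.\<close>
    define G where "G \<theta> = (W \<theta> \<bullet> z) * (W \<theta> \<bullet> x) / (W \<theta> \<bullet> A (W \<theta>))" for \<theta>
    have xJ: "x \<bullet> J (image_pt z (W \<theta>)) = 2 * G \<theta> - x \<bullet> J z" for \<theta>
      by (simp add: image_pt_def J_simps JA inner_diff_right G_def inner_commute)
    have Gmax: "G \<theta> \<le> G 0" for \<theta>
      using ymax[OF image_pt_M[OF z W[of \<theta>]]] xJ[of \<theta>] xJ[of 0] yz by (simp add: W0)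
    have dW: "((\<lambda>\<theta>. W \<theta>) has_vector_derivative f) (at 0)"
      unfolding W_def by (auto intro!: derivative_eq_intros)
    have dAW: "((\<lambda>\<theta>. A (W \<theta>)) has_vector_derivative A f) (at 0)"
      using bounded_linear.has_vector_derivative[OF A[unfolded linear_conv_bounded_linear] dW] .
    have d1: "((\<lambda>\<theta>. W \<theta> \<bullet> u) has_real_derivative f \<bullet> u) (at 0)" for u
      using bounded_linear.has_vector_derivative[OF bounded_linear_inner_left dW, of u]
      by (simp add: has_real_derivative_iff_has_vector_derivative)
    have d2: "((\<lambda>\<theta>. W \<theta> \<bullet> A (W \<theta>)) has_real_derivative 2 * (f \<bullet> A w)) (at 0)"
      using bounded_bilinear.has_vector_derivative[OF bounded_bilinear_inner dW dAW]
      by (simp add: has_real_derivative_iff_has_vector_derivative W0 symA[of w f] inner_commute)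
    have "(G has_real_derivative (((f \<bullet> z) * (w \<bullet> x) + (f \<bullet> x) * k) * (w \<bullet> A w) -
        k * (w \<bullet> x) * (2 * (f \<bullet> A w))) / ((w \<bullet> A w) * (w \<bullet> A w))) (at 0)"
      unfolding G_def using Awpos
      by (auto intro!: derivative_eq_intros d1 d2 simp: W0 kz)
    from DERIV_local_max[OF this, of 1] Gmax
    have "((f \<bullet> z) * (w \<bullet> x) + (f \<bullet> x) * k) * (w \<bullet> A w) - k * (w \<bullet> x) * (2 * (f \<bullet> A w)) = 0"
      using Awpos by auto
    moreover have "2 * k * (f \<bullet> A w) = (w \<bullet> A w) * (f \<bullet> y + f \<bullet> z)"
    proof -
      have "y + z = (2 * k / (w \<bullet> A w)) *\<^sub>R A w" by (simp add: z_def image_pt_def k_def)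
      then have "f \<bullet> (y + z) = 2 * k / (w \<bullet> A w) * (f \<bullet> A w)" by simp
      then show ?thesis using Awpos by (simp add: inner_add_right field_simps)
    qed
    ultimately have "((f \<bullet> z) * (w \<bullet> x) + (f \<bullet> x) * k) * (w \<bullet> A w) - (w \<bullet> x) * ((w \<bullet> A w) * (f \<bullet> y + f \<bullet> z)) = 0"
      by (metis (no_types, opaque_lifting) mult.assoc mult.commute)
    then have "(w \<bullet> A w) * (f \<bullet> V) = 0"
      by (simp add: V_def inner_diff_right algebra_simps)
    then have "f \<bullet> V = 0" using Awpos by simp
    then have "V' \<bullet> V' = 0" using V'V V'0 rad(1)[OF far] by (auto simp: f_def a_def)
    then show False using V'0 by simp
  qed
  then have V: "V = ((V \<bullet> t) / (t \<bullet> t)) *\<^sub>R t" by (simp add: V'_def)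
  have "V \<noteq> 0"
  proof
    assume "V = 0"
    then have "k *\<^sub>R x + (- (w \<bullet> x)) *\<^sub>R y = 0" by (simp add: V_def)
    then show False using indep2_M[OF x y] nd unfolding indep2_def k_def by fastforce
  qed
  then have "V \<bullet> t \<noteq> 0" using V by auto
  moreover have "\<xi> \<bullet> V = 0" using \<xi> by (simp add: V_def inner_diff_right)
  ultimately have "\<xi> \<bullet> t = 0" using V tt by (metis divide_eq_0_iff inner_scaleR_right mult_eq_0_iff less_irrefl)
  then have "\<xi> \<bullet> (p + r *\<^sub>R w) = \<xi> \<bullet> z"
    by (simp add: t_def a_def inner_diff_right inner_add_right)
  also have "\<dots> = 2 * k / (w \<bullet> A w) * (\<xi> \<bullet> A w)"
    using \<xi> by (simp add: z_def image_pt_def k_def inner_diff_right)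
  finally show ?thesis using Awpos by (simp add: E_def k_def)
qed


lemma continuous_E: "continuous_on S (E \<xi> y)"
  unfolding E_def by (intro continuous_intros cont_A)

text \<open>A normal with w \<bullet> y = 0 is approached along a great circle whose nearby normals
  have nonzero product with y; continuity of E does the rest.\<close>

lemma E_zero:
  assumes n: "nearest x y" and w: "w \<in> tangents y" and \<xi>: "\<xi> \<bullet> x = 0" "\<xi> \<bullet> y = 0"
  shows "E \<xi> y w = 0"
proof (cases "w \<bullet> y = 0")
  case True
  have y: "y \<in> M" using n by (simp add: nearest_def)
  note far = M_far[OF y]
  define a where "a = y - p"
  define e where "e = w - foot a"
  have e: "e \<bullet> a = 0" "e \<bullet> e = (rad a)\<^sup>2"
    using tangent_decomp[OF far w] by (auto simp: e_def a_def)
  define k0 where "k0 = foot a \<bullet> y"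
  have ey: "e \<bullet> y = - k0" using True by (simp add: e_def k0_def inner_diff_left)
  \<comment> \<open>Along the circle the product with y is (1 - cos \<theta>) * k0 + sin \<theta> *
    (f \<bullet> y). The two coefficients are arranged to have no opposite signs and not both to
    vanish.\<close>
  have "\<exists>f0. f0 \<noteq> 0 \<and> f0 \<bullet> a = 0 \<and> f0 \<bullet> e = 0 \<and> (k0 \<noteq> 0 \<or> f0 \<bullet> y \<noteq> 0) \<and> k0 * (f0 \<bullet> y) \<ge> 0"
  proof (cases "k0 = 0")
    case True
    have "y \<notin> span {a, e}"
    proof
      assume "y \<in> span {a, e}"
      then obtain c d where cd: "y = c *\<^sub>R a + d *\<^sub>R e" by (auto simp: in_span2)
      have "a \<bullet> a > 0" using far zero_le_power2[of r] unfolding a_def by linarith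
      then have "a \<bullet> y = 0" using True r_pos by (simp add: k0_def foot_def)
      then have "y \<bullet> y = 0" using ey True cd by (metis add.right_neutral inner_add_left inner_scaleR_left mult_zero_right minus_zero)
      then show False using M_D(3)[OF y] by simp
    qed
    then obtain f0 where f0: "\<forall>z\<in>{a, e}. f0 \<bullet> z = 0" "f0 \<bullet> y \<noteq> 0"
      using in_span_orthogonal[of "{a, e}" y] by metis
    then have "f0 \<noteq> 0" by auto
    then show ?thesis using f0 True by auto
  next
    case False
    obtain f1 where f1: "f1 \<noteq> 0" "f1 \<bullet> a = 0" "f1 \<bullet> e = 0" using orthogonal_exists2[OF dim3] by blast
    show ?thesis
    proof (cases "k0 * (f1 \<bullet> y) \<ge> 0")
      case True
      then show ?thesis using f1 False by blast
    next
      case False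
      then show ?thesis using f1 \<open>k0 \<noteq> 0\<close> by (intro exI[of _ "- f1"]) simp
    qed
  qed
  then obtain f0 where f0: "f0 \<noteq> 0" "f0 \<bullet> a = 0" "f0 \<bullet> e = 0" "k0 \<noteq> 0 \<or> f0 \<bullet> y \<noteq> 0" "k0 * (f0 \<bullet> y) \<ge> 0"
    by blast
  define f where "f = (rad a / norm f0) *\<^sub>R f0"
  have rada: "rad a > 0" using rad(1)[OF far] by (simp add: a_def)
  have ff: "f \<bullet> f = (rad a)\<^sup>2" unfolding f_def by (rule rescale[OF f0(1)])
  have fa: "f \<bullet> a = 0" and ef: "e \<bullet> f = 0" using f0 by (simp_all add: f_def inner_commute)
  have fy: "k0 \<noteq> 0 \<or> f \<bullet> y \<noteq> 0" using f0 rada by (simp add: f_def)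
  have kf: "k0 * (f \<bullet> y) \<ge> 0"
  proof -
    have "k0 * (f \<bullet> y) = (rad a / norm f0) * (k0 * (f0 \<bullet> y))" by (simp add: f_def)
    then show ?thesis using f0(5) rada by simp
  qed
  define W where "W \<theta> = foot a + (cos \<theta> *\<^sub>R e + sin \<theta> *\<^sub>R f)" for \<theta>
  have W: "W \<theta> \<in> tangents y" for \<theta>
    unfolding W_def a_def by (rule tangent_curve[OF far]) (use e ff fa ef in \<open>auto simp: a_def\<close>)
  have W0: "W 0 = w" by (simp add: W_def e_def)
  have nz: "W \<theta> \<bullet> y \<noteq> 0" if t: "0 < \<theta>" "\<theta> < pi / 2" for \<theta>
  proof
    assume z: "W \<theta> \<bullet> y = 0"
    have s: "sin \<theta> > 0" using t by (intro sin_gt_zero) auto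
    have "cos \<theta> < cos 0" using t by (subst cos_mono_less_eq) auto
    then have c: "1 - cos \<theta> > 0" by simp
    have "W \<theta> \<bullet> y = (1 - cos \<theta>) * k0 + sin \<theta> * (f \<bullet> y)"
      by (simp add: W_def inner_add_left ey k0_def[symmetric] algebra_simps)
    then have eq: "(1 - cos \<theta>) * k0 + sin \<theta> * (f \<bullet> y) = 0" using z by simp
    show False
    proof (cases "k0 = 0")
      case True
      then show False using eq s fy by simp
    next
      case False
      have "(1 - cos \<theta>) * (k0 * k0) + sin \<theta> * (k0 * (f \<bullet> y)) = k0 * ((1 - cos \<theta>) * k0 + sin \<theta> * (f \<bullet> y))"
        by (simp add: algebra_simps)
      also have "\<dots> = 0" by (simp only: eq mult_zero_right)
      finally have "(1 - cos \<theta>) * (k0 * k0) + sin \<theta> * (k0 * (f \<bullet> y)) = 0" .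
      moreover have "k0 * k0 > 0" using False by (metis not_real_square_gt_zero)
      then have "(1 - cos \<theta>) * (k0 * k0) > 0" by (rule mult_pos_pos[OF c])
      moreover have "sin \<theta> * (k0 * (f \<bullet> y)) \<ge> 0" using s kf by simp
      ultimately show False by linarith
    qed
  qed
  have lim: "((\<lambda>\<theta>. E \<xi> y (W \<theta>)) \<longlongrightarrow> E \<xi> y (W 0)) (at_right 0)"
  proof -
    have "continuous_on UNIV (\<lambda>\<theta>. E \<xi> y (W \<theta>))"
      by (rule continuous_on_compose2[OF continuous_E[of UNIV]])
        (auto simp: W_def intro!: continuous_intros)
    then have "((\<lambda>\<theta>. E \<xi> y (W \<theta>)) \<longlongrightarrow> E \<xi> y (W 0)) (at 0)"
      by (simp add: continuous_on_eq_continuous_at isCont_def)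
    then show ?thesis by (rule tendsto_within_subset) simp
  qed
  have "eventually (\<lambda>\<theta>::real. 0 < \<theta> \<and> \<theta> < pi / 2) (at_right 0)"
    by (rule eventually_at_rightI[of 0 "pi / 2"]) auto
  then have "eventually (\<lambda>\<theta>. E \<xi> y (W \<theta>) = 0) (at_right 0)"
  proof eventually_elim
    case (elim \<theta>)
    show ?case by (rule E_zero_generic[OF n W _ \<xi>]) (use nz elim in blast)
  qed
  from Lim_transform_eventually[OF lim this] have "((\<lambda>_. 0) \<longlongrightarrow> E \<xi> y (W 0)) (at_right (0::real))" .
  then show ?thesis by (simp add: W0 tendsto_const_iff)
next
  case False
  then show ?thesis using E_zero_generic[OF n w _ \<xi>] by blast
qed

lemma E_zero_sphere:
  assumes n: "nearest x y" and \<xi>: "\<xi> \<bullet> x = 0" "\<xi> \<bullet> y = 0"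
    and e: "e \<bullet> (y - p) = 0" "e \<bullet> e = (rad (y - p))\<^sup>2"
  shows "E \<xi> y (foot (y - p) + e) = 0" "E \<xi> y (foot (y - p) - e) = 0"
proof -
  have y: "y \<in> M" using n by (simp add: nearest_def)
  show "E \<xi> y (foot (y - p) + e) = 0"
    by (rule E_zero[OF n tangent_foot[OF M_far[OF y] e] \<xi>])
  have "foot (y - p) + (- e) \<in> tangents y" using tangent_foot[OF M_far[OF y], of "- e"] e by simp
  then show "E \<xi> y (foot (y - p) - e) = 0" using E_zero[OF n _ \<xi>] by simp
qed

text \<open>If \<xi> were a multiple of a = y - p, then a \<bullet> y = 0, and a tangent normal w
  with w \<bullet> y = 0 exists. There E = 0 reduces to a \<bullet> a = r * r, against
  \<open>M_far\<close>.\<close>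

lemma normal_not_parallel:
  assumes n: "nearest x y" and \<xi>: "\<xi> \<bullet> x = 0" "\<xi> \<bullet> y = 0" "\<xi> \<noteq> 0"
  shows "\<xi> \<notin> span {y - p}"
proof
  define a where "a = y - p"
  have y: "y \<in> M" using n by (simp add: nearest_def)
  note far = M_far[OF y]
  assume "\<xi> \<in> span {y - p}"
  then obtain l where l: "\<xi> = l *\<^sub>R a" by (auto simp: in_span1 a_def)
  then have l0: "l \<noteq> 0" and ay: "a \<bullet> y = 0" using \<xi> by auto
  obtain e0 where e0: "e0 \<noteq> 0" "e0 \<bullet> a = 0" "e0 \<bullet> y = 0" using orthogonal_exists2[OF dim3] by blast
  define e where "e = (rad a / norm e0) *\<^sub>R e0"
  have e: "e \<bullet> a = 0" "e \<bullet> e = (rad a)\<^sup>2" "e \<bullet> y = 0"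
    unfolding e_def using rescale[OF e0(1)] e0 by auto
  define w where "w = foot a + e"
  have w: "w \<in> tangents y" unfolding w_def a_def by (rule tangent_foot[OF far]) (use e in \<open>auto simp: a_def\<close>)
  have "w \<bullet> y = 0" using ay e by (simp add: w_def foot_def inner_add_left)
  then have "\<xi> \<bullet> (p + r *\<^sub>R w) = 0"
    using E_zero[OF n w \<xi>(1,2)] tangents_D(2)[OF w] by (simp add: E_def)
  then have "l * (a \<bullet> p + r * (a \<bullet> w)) = 0" using l by (simp add: inner_add_right algebra_simps)
  then have "a \<bullet> p + r * (a \<bullet> w) = 0" using l0 by simp
  moreover have "a \<bullet> w = r" using w by (simp add: tangents_def a_def inner_commute)
  moreover have "a \<bullet> p = - (a \<bullet> a)"
    using ay by (simp add: a_def inner_diff_right)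
  ultimately show False using far by (simp add: a_def power2_eq_square)
qed

text \<open>As a function of \<open>e\<close>, \<open>E\<close> is a cubic polynomial that vanishes on a sphere of the hyperplane
  orthogonal to \<open>y - p\<close>; the odd part of this identity forces its cubic form to be a multiple of the squared norm.\<close>

lemma nearest_scalar:
  assumes n: "nearest x y"
  shows "\<exists>\<gamma>. \<forall>v. v \<bullet> (y - p) = 0 \<longrightarrow> v \<bullet> A v = \<gamma> * (v \<bullet> v)"
proof -
  define a where "a = y - p"
  have y: "y \<in> M" using n by (simp add: nearest_def)
  note far = M_far[OF y]
  have rada: "rad a > 0" using rad(1)[OF far] by (simp add: a_def)
  have aa: "a \<bullet> a > 0" using far zero_le_power2[of r] unfolding a_def by linarith
  obtain \<xi> where \<xi>: "\<xi> \<noteq> 0" "\<xi> \<bullet> x = 0" "\<xi> \<bullet> y = 0" using orthogonal_exists2[OF dim3] by blast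
  define \<xi>' where "\<xi>' = \<xi> - ((\<xi> \<bullet> a) / (a \<bullet> a)) *\<^sub>R a"
  have \<xi>'a: "\<xi>' \<bullet> a = 0" using aa by (simp add: \<xi>'_def inner_diff_left)
  have \<xi>': "\<xi> \<bullet> v = \<xi>' \<bullet> v" if "v \<bullet> a = 0" for v
    using that by (simp add: \<xi>'_def inner_diff_left inner_commute[of a v])
  have \<xi>'0: "\<xi>' \<noteq> 0"
  proof
    assume "\<xi>' = 0"
    then have "\<xi> = ((\<xi> \<bullet> a) / (a \<bullet> a)) *\<^sub>R a" unfolding \<xi>'_def by (rule eq_iff_diff_eq_0[THEN iffD2])
    then have "\<xi> \<in> span {a}" unfolding in_span1 by (rule exI)
    then show False using normal_not_parallel[OF n \<xi>(2,3,1)] by (simp add: a_def)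
  qed
  define w0 where "w0 = foot a"
  define \<pi>' where "\<pi>' = \<xi> \<bullet> p + r * (\<xi> \<bullet> w0)"
  \<comment> \<open>The linear part of E in e at w0 + e. The even terms cancel in the difference of
    the values at w0 + e and w0 - e.\<close>
  define \<Lambda> where "\<Lambda> v = (w0 \<bullet> A w0) * r * (\<xi> \<bullet> v) + 2 * \<pi>' * (w0 \<bullet> A v)
      - 2 * (w0 \<bullet> y) * (\<xi> \<bullet> A v) - 2 * (v \<bullet> y) * (\<xi> \<bullet> A w0)" for v
  have \<Lambda>_add: "\<Lambda> (u + v) = \<Lambda> u + \<Lambda> v" "\<Lambda> (u - v) = \<Lambda> u - \<Lambda> v" "\<Lambda> (t *\<^sub>R v) = t * \<Lambda> v" for u v t
    by (simp_all add: \<Lambda>_def A_simps inner_add_left inner_add_right inner_diff_left inner_diff_right algebra_simps)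
  have sphere: "r * (e \<bullet> A e) * (\<xi> \<bullet> e) + \<Lambda> e = 0" if e: "e \<bullet> a = 0" "e \<bullet> e = (rad a)\<^sup>2" for e
  proof -
    have "E \<xi> y (w0 + e) - E \<xi> y (w0 - e) = 2 * (r * (e \<bullet> A e) * (\<xi> \<bullet> e) + \<Lambda> e)"
      unfolding E_def \<Lambda>_def \<pi>'_def using symA[of e w0]
      by (simp add: A_simps inner_add_left inner_add_right inner_diff_left inner_diff_right
          inner_commute[of "A e" w0] algebra_simps)
    moreover have "E \<xi> y (w0 + e) = 0" "E \<xi> y (w0 - e) = 0"
      unfolding w0_def a_def by (rule E_zero_sphere[OF n \<xi>(2,3)]; use e in \<open>simp add: a_def\<close>)+
    ultimately show ?thesis by simp
  qed
  \<comment> \<open>Scaling v to the sphere turns the identity into one between cubic forms on the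
    whole hyperplane.\<close>
  have hom: "r * (rad a)\<^sup>2 * (v \<bullet> A v) * (\<xi> \<bullet> v) + (v \<bullet> v) * \<Lambda> v = 0" if v: "v \<bullet> a = 0" for v
  proof (cases "v = 0")
    case False
    define t where "t = rad a / norm v"
    have t: "t > 0" using False rada by (simp add: t_def)
    have "(t *\<^sub>R v) \<bullet> (t *\<^sub>R v) = (rad a)\<^sup>2" unfolding t_def by (rule rescale[OF False])
    then have tv: "t * (t * (v \<bullet> v)) = (rad a)\<^sup>2" by simp
    have "r * ((t *\<^sub>R v) \<bullet> A (t *\<^sub>R v)) * (\<xi> \<bullet> (t *\<^sub>R v)) + \<Lambda> (t *\<^sub>R v) = 0"
      by (rule sphere) (use v in simp, rule \<open>(t *\<^sub>R v) \<bullet> (t *\<^sub>R v) = (rad a)\<^sup>2\<close>)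
    then have "t * (r * (t * t) * (v \<bullet> A v) * (\<xi> \<bullet> v) + \<Lambda> v) = 0"
      by (simp add: A_simps \<Lambda>_add algebra_simps)
    then have "(v \<bullet> v) * (r * (t * t) * (v \<bullet> A v) * (\<xi> \<bullet> v) + \<Lambda> v) = 0" using t by simp
    then show ?thesis by (simp add: tv[symmetric] algebra_simps)
  qed (simp add: A_simps)
  define c where "c = r * (rad a)\<^sup>2"
  have c: "c > 0" using r_pos rada by (simp add: c_def)
  define N where "N = \<xi>' \<bullet> \<xi>'"
  have N: "N > 0" using \<xi>'0 by (simp add: N_def)
  define \<gamma> where "\<gamma> = (\<xi>' \<bullet> A \<xi>') / N"
  have \<xi>\<xi>': "\<xi> \<bullet> \<xi>' = N" using \<xi>'[OF \<xi>'a] by (simp add: N_def)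
  \<comment> \<open>\<open>\<Lambda>\<close> vanishes at u. Of the identities at \<xi>', \<xi>' + u
    and \<xi>' - u, the difference of the last two gives \<xi>' \<bullet> A u = 0, and comparison
    with the first gives u \<bullet> A u = \<xi>' \<bullet> A \<xi>'.\<close>
  have same: "u \<bullet> A u = \<gamma> * N \<and> \<xi>' \<bullet> A u = 0" if u: "u \<bullet> a = 0" "\<xi>' \<bullet> u = 0" "u \<bullet> u = N" for u
  proof -
    have \<xi>u: "\<xi> \<bullet> u = 0" using \<xi>'[OF u(1)] u(2) by simp
    have "\<Lambda> u = 0" using hom[OF u(1)] \<xi>u u(3) N by simp
    have us: "u \<bullet> A \<xi>' = \<xi>' \<bullet> A u" using symA[of u \<xi>'] by (simp add: inner_commute)
    have h0: "c * (\<xi>' \<bullet> A \<xi>') * N + N * \<Lambda> \<xi>' = 0"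
      using hom[OF \<xi>'a] by (simp add: c_def \<xi>\<xi>' N_def[symmetric])
    have "u \<bullet> \<xi>' = 0" using u(2) by (simp add: inner_commute)
    then have nn: "(\<xi>' + u) \<bullet> (\<xi>' + u) = 2 * N" "(\<xi>' - u) \<bullet> (\<xi>' - u) = 2 * N"
      using u by (simp_all add: inner_add_left inner_add_right inner_diff_left inner_diff_right N_def)
    have "(\<xi>' + u) \<bullet> a = 0" "(\<xi>' - u) \<bullet> a = 0"
      using u \<xi>'a by (simp_all add: inner_add_left inner_diff_left)
    from hom[OF this(1)] hom[OF this(2)]
    have h1: "c * (\<xi>' \<bullet> A \<xi>' + 2 * (\<xi>' \<bullet> A u) + u \<bullet> A u) * N + 2 * N * \<Lambda> \<xi>' = 0"
      and h2: "c * (\<xi>' \<bullet> A \<xi>' - 2 * (\<xi>' \<bullet> A u) + u \<bullet> A u) * N + 2 * N * \<Lambda> \<xi>' = 0"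
      unfolding nn \<Lambda>_add \<open>\<Lambda> u = 0\<close> c_def[symmetric]
      by (simp_all add: A_simps inner_add_left inner_add_right inner_diff_left inner_diff_right us \<xi>\<xi>' \<xi>u
          algebra_simps)
    have "4 * (c * N) * (\<xi>' \<bullet> A u) =
        (c * (\<xi>' \<bullet> A \<xi>' + 2 * (\<xi>' \<bullet> A u) + u \<bullet> A u) * N + 2 * N * \<Lambda> \<xi>') -
        (c * (\<xi>' \<bullet> A \<xi>' - 2 * (\<xi>' \<bullet> A u) + u \<bullet> A u) * N + 2 * N * \<Lambda> \<xi>')"
      by (simp add: algebra_simps)
    also have "\<dots> = 0" unfolding h1 h2 by simp
    finally have z: "\<xi>' \<bullet> A u = 0" using c N by simp
    have "c * N * (u \<bullet> A u - \<xi>' \<bullet> A \<xi>') =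
        (c * (\<xi>' \<bullet> A \<xi>' + 2 * (\<xi>' \<bullet> A u) + u \<bullet> A u) * N + 2 * N * \<Lambda> \<xi>') -
        2 * (c * (\<xi>' \<bullet> A \<xi>') * N + N * \<Lambda> \<xi>')"
      using z by (simp add: algebra_simps)
    also have "\<dots> = 0" unfolding h1 h0 by simp
    finally have "c * N * (u \<bullet> A u - \<xi>' \<bullet> A \<xi>') = 0" .
    then show ?thesis using c N z by (simp add: \<gamma>_def)
  qed
  have "v \<bullet> A v = \<gamma> * (v \<bullet> v)" if v: "v \<bullet> a = 0" for v
  proof -
    define t where "t = (v \<bullet> \<xi>') / N"
    define v' where "v' = v - t *\<^sub>R \<xi>'"
    have v'a: "v' \<bullet> a = 0" using v \<xi>'a by (simp add: v'_def inner_diff_left)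
    have v'\<xi>: "v' \<bullet> \<xi>' = 0" using N by (simp add: v'_def t_def inner_diff_left N_def)
    have "v' \<bullet> A v' = \<gamma> * (v' \<bullet> v') \<and> \<xi>' \<bullet> A v' = 0"
    proof (cases "v' = 0")
      case False
      define k where "k = norm \<xi>' / norm v'"
      have k: "k > 0" using False \<xi>'0 by (simp add: k_def)
      have kk: "(k *\<^sub>R v') \<bullet> (k *\<^sub>R v') = N"
        unfolding k_def rescale[OF False] N_def by (simp add: dot_square_norm)
      have "(k *\<^sub>R v') \<bullet> A (k *\<^sub>R v') = \<gamma> * N \<and> \<xi>' \<bullet> A (k *\<^sub>R v') = 0"
        by (rule same[OF _ _ kk]) (use v'a v'\<xi> in \<open>simp_all add: inner_commute\<close>)
      then have "k * (k * (v' \<bullet> A v')) = k * (k * (\<gamma> * (v' \<bullet> v'))) \<and> k * (\<xi>' \<bullet> A v') = 0"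
        unfolding kk[symmetric] by (simp add: A_simps algebra_simps)
      then show ?thesis using k by simp
    qed (simp add: A_simps)
    then have v': "v' \<bullet> A v' = \<gamma> * (v' \<bullet> v')" "\<xi>' \<bullet> A v' = 0" "v' \<bullet> A \<xi>' = 0"
      using symA[of v' \<xi>'] by (auto simp: inner_commute)
    have vv: "v = v' + t *\<^sub>R \<xi>'" by (simp add: v'_def)
    have "\<xi>' \<bullet> v' = 0" using v'\<xi> by (simp add: inner_commute)
    then have "v \<bullet> v = v' \<bullet> v' + t * (t * N)"
      unfolding vv using v'\<xi> by (simp add: inner_add_left inner_add_right N_def)
    moreover have "v \<bullet> A v = v' \<bullet> A v' + t * (t * (\<xi>' \<bullet> A \<xi>'))"
      unfolding vv using v' by (simp add: A_simps inner_add_left inner_add_right)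
    moreover have "\<xi>' \<bullet> A \<xi>' = \<gamma> * N" using N by (simp add: \<gamma>_def)
    ultimately show ?thesis using v' by (simp add: algebra_simps)
  qed
  then show ?thesis unfolding a_def by blast
qed

text \<open>For scalar A, \<open>nearest_scalar\<close> does not restrict y, so the even part of E
  is used instead: (v \<bullet> y) (\<xi> \<bullet> v) is a multiple of v \<bullet> v on the
  hyperplane orthogonal to a. A vector v orthogonal to \<xi> shows that the multiple is 0, and
  \<open>vanishing_product\<close> makes y parallel to y - p.\<close>

lemma nearest_round:
  assumes n: "nearest x y" and scal: "\<And>v. A v = \<gamma> *\<^sub>R v"
  shows "y \<in> span {p}"
proof -
  define a where "a = y - p"
  have y: "y \<in> M" using n by (simp add: nearest_def)
  note far = M_far[OF y]
  have rada: "rad a > 0" using rad(1)[OF far] by (simp add: a_def)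
  have "\<gamma> * (p \<bullet> p) > 0" "p \<bullet> p > 0" using posA[OF p_ne_0] p_ne_0 by (simp_all add: scal)
  then have g: "\<gamma> > 0" by (rule zero_less_mult_pos2)
  obtain \<xi> where \<xi>: "\<xi> \<noteq> 0" "\<xi> \<bullet> x = 0" "\<xi> \<bullet> y = 0" using orthogonal_exists2[OF dim3] by blast
  define w0 where "w0 = foot a"
  have w0e: "w0 \<bullet> e = 0" "e \<bullet> w0 = 0" if "e \<bullet> a = 0" for e
    using that by (simp_all add: w0_def foot_def inner_commute)
  define C where "C = (\<xi> \<bullet> p + r * (\<xi> \<bullet> w0)) - 2 * (w0 \<bullet> y) * (\<xi> \<bullet> w0)"
  have sphere: "2 * (e \<bullet> y) * (\<xi> \<bullet> e) = C" if e: "e \<bullet> a = 0" "e \<bullet> e = (rad a)\<^sup>2" for e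
  proof -
    have t: "w0 + e \<in> tangents y" "w0 - e \<in> tangents y"
      using tangent_foot[OF far, of e] tangent_foot[OF far, of "- e"] e by (simp_all add: w0_def a_def)
    have 1: "w \<bullet> A w = \<gamma>" if "w \<in> tangents y" for w
      using that by (simp add: scal tangents_def norm_eq_1)
    have "E \<xi> y (w0 + e) + E \<xi> y (w0 - e) = 2 * \<gamma> * (C - 2 * (e \<bullet> y) * (\<xi> \<bullet> e))"
      unfolding E_def 1[OF t(1)] 1[OF t(2)]
      by (simp add: scal C_def inner_add_left inner_add_right inner_diff_left inner_diff_right algebra_simps)
    moreover have "E \<xi> y (w0 + e) = 0" "E \<xi> y (w0 - e) = 0" using E_zero[OF n _ \<xi>(2,3)] t by blast+
    ultimately show ?thesis using g by simp
  qed
  have hom: "2 * (rad a)\<^sup>2 * (v \<bullet> y) * (\<xi> \<bullet> v) = C * (v \<bullet> v)" if v: "v \<bullet> a = 0" for v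
  proof (cases "v = 0")
    case False
    define t where "t = rad a / norm v"
    have t: "t > 0" using False rada by (simp add: t_def)
    have tt: "(t *\<^sub>R v) \<bullet> (t *\<^sub>R v) = (rad a)\<^sup>2" unfolding t_def by (rule rescale[OF False])
    then have tv: "t * t * (v \<bullet> v) = (rad a)\<^sup>2" by simp
    have "2 * ((t *\<^sub>R v) \<bullet> y) * (\<xi> \<bullet> (t *\<^sub>R v)) = C" by (rule sphere[OF _ tt]) (use v in simp)
    then have "t * t * (2 * (v \<bullet> y) * (\<xi> \<bullet> v)) = C" by (simp add: algebra_simps)
    then show ?thesis unfolding tv[symmetric] by (metis (no_types, opaque_lifting) mult.assoc mult.commute mult.left_commute)
  qed simp
  have "C = 0"
  proof -
    obtain v where v: "v \<noteq> 0" "v \<bullet> a = 0" "v \<bullet> \<xi> = 0" using orthogonal_exists2[OF dim3] by blast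
    then show ?thesis using hom[OF v(2)] by (simp add: inner_commute)
  qed
  then have "(y \<bullet> v) * (\<xi> \<bullet> v) = 0" if "v \<bullet> a = 0" for v
    using hom[OF that] rada by (simp add: inner_commute)
  then have "y \<in> span {a} \<or> \<xi> \<in> span {a}" by (rule vanishing_product)
  then obtain l where l: "y = l *\<^sub>R (y - p)"
    using normal_not_parallel[OF n \<xi>(2,3,1)] by (auto simp: in_span1 a_def)
  have "l \<noteq> 0" using l M_D(3)[OF y] by auto
  have lp: "l *\<^sub>R p = (l - 1) *\<^sub>R y" using l by (simp add: scaleR_diff_right scaleR_diff_left algebra_simps)
  then have "l - 1 \<noteq> 0" using p_ne_0 \<open>l \<noteq> 0\<close> by auto
  have "(l / (l - 1)) *\<^sub>R p = inverse (l - 1) *\<^sub>R ((l - 1) *\<^sub>R y)"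
    unfolding lp[symmetric] by (simp add: divide_inverse mult.commute)
  then have "y = (l / (l - 1)) *\<^sub>R p" using \<open>l - 1 \<noteq> 0\<close> by simp
  then show ?thesis unfolding in_span1 by blast
qed

section \<open>Finiteness of the set of nearest points\<close>

lemma finite_line: "finite {y. y \<bullet> J y = m \<and> y - p \<in> span {d}}"
proof (cases "d = 0")
  case True
  then have "{y. y \<bullet> J y = m \<and> y - p \<in> span {d}} \<subseteq> {p}" by auto
  then show ?thesis using finite_subset by blast
next
  case False
  have "d \<bullet> J d \<noteq> 0" using posJ[OF False] by simp
  then have fin: "finite {t. (p \<bullet> J p - m) + (2 * (p \<bullet> J d)) * t + (d \<bullet> J d) * t\<^sup>2 = 0}"
    by (rule finite_quadratic_roots)
  have "{y. y \<bullet> J y = m \<and> y - p \<in> span {d}} \<subseteq>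
      (\<lambda>t. p + t *\<^sub>R d) ` {t. (p \<bullet> J p - m) + (2 * (p \<bullet> J d)) * t + (d \<bullet> J d) * t\<^sup>2 = 0}"
  proof
    fix y assume y: "y \<in> {y. y \<bullet> J y = m \<and> y - p \<in> span {d}}"
    then obtain t where "y - p = t *\<^sub>R d" by (auto simp: in_span1)
    then have yt: "y = p + t *\<^sub>R d" by (simp add: algebra_simps)
    have dp: "d \<bullet> J p = p \<bullet> J d" using symJ[of d p] by (simp add: inner_commute)
    have "y \<bullet> J y = p \<bullet> J p + (2 * (p \<bullet> J d)) * t + (d \<bullet> J d) * t\<^sup>2"
      unfolding yt by (simp add: J_simps inner_add_left inner_add_right dp power2_eq_square algebra_simps)
    then show "y \<in> (\<lambda>t. p + t *\<^sub>R d) ` {t. (p \<bullet> J p - m) + (2 * (p \<bullet> J d)) * t + (d \<bullet> J d) * t\<^sup>2 = 0}"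
      using y yt by auto
  qed
  then show ?thesis using finite_subset[OF _ finite_imageI[OF fin]] by blast
qed

text \<open>One nearest point \<open>y1\<close> fixes \<gamma>, and the form of T = A - \<gamma>
  vanishes on the hyperplane orthogonal to a1 = y1 - p, so it factors as (a1 \<bullet> v) (g
  \<bullet> v). Any nearest y gives another hyperplane on which it vanishes, so y - p is parallel to
  \<open>a1\<close> or to g. If g = 0, A is scalar and \<open>nearest_round\<close> applies.\<close>

lemma finite_nearest: "finite {y. \<exists>x. nearest x y}"
proof (cases "\<exists>x y. nearest x y")
  case True
  then obtain x1 y1 where n1: "nearest x1 y1" by blast
  define a1 where "a1 = y1 - p"
  have "y1 \<in> M" using n1 by (simp add: nearest_def)
  then have aa: "a1 \<bullet> a1 > 0" using M_far[of y1] zero_le_power2[of r] unfolding a1_def by (meson le_less_trans)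
  obtain \<gamma> where \<gamma>: "\<And>v. v \<bullet> a1 = 0 \<Longrightarrow> v \<bullet> A v = \<gamma> * (v \<bullet> v)"
    using nearest_scalar[OF n1] unfolding a1_def by blast
  define T where "T v = A v - \<gamma> *\<^sub>R v" for v
  have T_simps: "T (u + v) = T u + T v" "T (t *\<^sub>R v) = t *\<^sub>R T v" for u v t
    by (simp_all add: T_def A_simps algebra_simps)
  have T_sym: "u \<bullet> T v = v \<bullet> T u" for u v
    using symA[of u v] by (simp add: T_def inner_diff_right inner_commute)
  have T0: "v \<bullet> T v = 0" if "v \<bullet> a1 = 0" for v
    using \<gamma>[OF that] by (simp add: T_def inner_diff_right)
  \<comment> \<open>Read off from v = v' + s a1 with v' orthogonal to \<open>a1\<close>: then v
    \<bullet> T v = s (2 (a1 \<bullet> T v) - s (a1 \<bullet> T a1)), and s is a1 \<bullet> v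
    divided by a1 \<bullet> a1.\<close>
  define g where "g = inverse (a1 \<bullet> a1) *\<^sub>R (2 *\<^sub>R T a1 - ((a1 \<bullet> T a1) / (a1 \<bullet> a1)) *\<^sub>R a1)"
  have Tg: "v \<bullet> T v = (a1 \<bullet> v) * (g \<bullet> v)" for v
  proof -
    define s where "s = (v \<bullet> a1) / (a1 \<bullet> a1)"
    define v' where "v' = v - s *\<^sub>R a1"
    have v'a: "v' \<bullet> a1 = 0" using aa by (simp add: v'_def s_def inner_diff_left)
    have v: "v = v' + s *\<^sub>R a1" by (simp add: v'_def)
    have av: "a1 \<bullet> v = s * (a1 \<bullet> a1)" using aa by (simp add: s_def inner_commute)
    have "v \<bullet> T v = 2 * s * (a1 \<bullet> T v') + s * (s * (a1 \<bullet> T a1))"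
      unfolding v using T0[OF v'a] T_sym[of v' a1]
      by (simp add: T_simps inner_add_left inner_add_right algebra_simps)
    moreover have "(a1 \<bullet> a1) * (g \<bullet> v) = 2 * (a1 \<bullet> T v) - s * (a1 \<bullet> T a1)"
    proof -
      have "(a1 \<bullet> a1) * (g \<bullet> v) = (2 *\<^sub>R T a1 - ((a1 \<bullet> T a1) / (a1 \<bullet> a1)) *\<^sub>R a1) \<bullet> v"
        using aa by (simp add: g_def)
      also have "\<dots> = 2 * (v \<bullet> T a1) - ((a1 \<bullet> T a1) / (a1 \<bullet> a1)) * (a1 \<bullet> v)"
        by (simp add: inner_diff_left inner_commute[of "T a1" v])
      also have "((a1 \<bullet> T a1) / (a1 \<bullet> a1)) * (a1 \<bullet> v) = s * (a1 \<bullet> T a1)"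
        using aa by (simp add: av)
      finally show ?thesis by (simp add: T_sym[of v a1])
    qed
    moreover have "a1 \<bullet> T v = a1 \<bullet> T v' + s * (a1 \<bullet> T a1)"
      unfolding v by (simp add: T_simps inner_add_right)
    ultimately have "v \<bullet> T v = s * ((a1 \<bullet> a1) * (g \<bullet> v))" by (simp add: algebra_simps)
    then show ?thesis by (simp add: av)
  qed
  have two: "a1 \<in> span {y - p} \<or> g \<in> span {y - p}" "y - p \<noteq> 0" "y \<bullet> J y = m" if n: "nearest x y" for x y
  proof -
    have y: "y \<in> M" using n by (simp add: nearest_def)
    show "y \<bullet> J y = m" by (rule M_D(2)[OF y])
    show "y - p \<noteq> 0" using M_far[OF y] zero_le_power2[of r] by auto
    obtain \<gamma>2 where \<gamma>2: "\<And>v. v \<bullet> (y - p) = 0 \<Longrightarrow> v \<bullet> A v = \<gamma>2 * (v \<bullet> v)"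
      using nearest_scalar[OF n] by blast
    \<comment> \<open>In dimension at least 3 the two hyperplanes share a nonzero vector, which
      equates the two scalars.\<close>
    obtain v where v: "v \<noteq> 0" "v \<bullet> a1 = 0" "v \<bullet> (y - p) = 0" using orthogonal_exists2[OF dim3] by blast
    have "\<gamma>2 = \<gamma>" using \<gamma>[OF v(2)] \<gamma>2[OF v(3)] v(1) by simp
    then have "v \<bullet> T v = 0" if "v \<bullet> (y - p) = 0" for v
      using \<gamma>2[OF that] by (simp add: T_def inner_diff_right)
    then show "a1 \<in> span {y - p} \<or> g \<in> span {y - p}"
      by (intro vanishing_product) (simp add: Tg)
  qed
  have flip: "v \<in> span {u}" if uv: "u \<in> span {v}" "u \<noteq> 0" for u v :: 'a
  proof -
    obtain c where c: "u = c *\<^sub>R v" using uv(1) by (auto simp: in_span1)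
    then have "c \<noteq> 0" using uv(2) by auto
    then have "v = inverse c *\<^sub>R u" by (simp add: c)
    then show ?thesis unfolding in_span1 by (rule exI)
  qed
  show ?thesis
  proof (cases "g = 0")
    case False
    have "a1 \<noteq> 0" using aa by auto
    have "{y. \<exists>x. nearest x y} \<subseteq> {y. y \<bullet> J y = m \<and> y - p \<in> span {a1}} \<union> {y. y \<bullet> J y = m \<and> y - p \<in> span {g}}"
    proof
      fix y assume "y \<in> {y. \<exists>x. nearest x y}"
      then obtain x where n: "nearest x y" by blast
      have "y - p \<in> span {a1} \<or> y - p \<in> span {g}"
        using two(1)[OF n] flip[of a1 "y - p"] flip[of g "y - p"] False \<open>a1 \<noteq> 0\<close> by blast
      then show "y \<in> {y. y \<bullet> J y = m \<and> y - p \<in> span {a1}} \<union> {y. y \<bullet> J y = m \<and> y - p \<in> span {g}}"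
        using two(3)[OF n] by simp
    qed
    then show ?thesis by (rule finite_subset) (intro finite_UnI finite_line)
  next
    case True
    then have z: "v \<bullet> T v = 0" for v using Tg by simp
    have "T u = 0" for u
    proof -
      \<comment> \<open>Polarisation: the mixed term of the vanishing form is 2 (T u \<bullet> T
        u).\<close>
      have "(T u + u) \<bullet> T (T u + u) = 0" by (rule z)
      then have "2 * (T u \<bullet> T u) = 0"
        using z[of u] z[of "T u"] T_sym[of u "T u"] by (simp add: T_simps inner_add_left inner_add_right)
      then show ?thesis by simp
    qed
    then have scal: "A u = \<gamma> *\<^sub>R u" for u by (simp add: T_def)
    have "{y. \<exists>x. nearest x y} \<subseteq> {y. y \<bullet> J y = m \<and> y - p \<in> span {p}}"
    proof clarify
      fix x y assume n: "nearest x y"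
      show "y \<bullet> J y = m \<and> y - p \<in> span {p}"
        using nearest_round[OF n scal] two(3)[OF n] by (simp add: span_diff span_base)
    qed
    then show ?thesis by (rule finite_subset[OF _ finite_line])
  qed
qed simp

text \<open>If \<open>M\<close> were finite, the images of y along a circle of tangent normals would
  be a single point, by connectedness. Then all \<kappa> W are equal, which forces \<kappa> = 0 and
  makes every normal of the circle orthogonal to y.\<close>

lemma infinite_M: "infinite M"
proof
  assume fin: "finite M"
  obtain y where "y \<in> K" "y \<bullet> J y = m" using m_attained by blast
  then have y: "y \<in> M" by (simp add: M_def)
  note far = M_far[OF y]
  define a where "a = y - p"
  have rada: "rad a > 0" using rad(1)[OF far] by (simp add: a_def)
  have aa: "a \<bullet> a > 0" using far zero_le_power2[of r] unfolding a_def by linarith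
  obtain u where u: "u \<noteq> 0" "u \<bullet> a = 0" using orthogonal_exists2[OF dim3] by blast
  \<comment> \<open>Chosen so that y is not orthogonal to both \<open>foot a\<close> and e.\<close>
  define e0 where "e0 = (if a \<bullet> y = 0 then y else u)"
  have e0: "e0 \<noteq> 0" "e0 \<bullet> a = 0" "a \<bullet> y = 0 \<Longrightarrow> e0 \<bullet> y \<noteq> 0"
    using u M_D(3)[OF y] by (auto simp: e0_def inner_commute)
  obtain f0 where f0: "f0 \<noteq> 0" "f0 \<bullet> a = 0" "f0 \<bullet> e0 = 0" using orthogonal_exists2[OF dim3] by blast
  define e where "e = (rad a / norm e0) *\<^sub>R e0"
  define f where "f = (rad a / norm f0) *\<^sub>R f0"
  have e: "e \<bullet> a = 0" "e \<bullet> e = (rad a)\<^sup>2" "a \<bullet> y = 0 \<Longrightarrow> e \<bullet> y \<noteq> 0" "e \<noteq> 0"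
    unfolding e_def using rescale[OF e0(1)] e0 rada by auto
  have f: "f \<bullet> a = 0" "f \<bullet> f = (rad a)\<^sup>2" "e \<bullet> f = 0"
    unfolding f_def e_def using rescale[OF f0(1)] f0 by (auto simp: inner_commute)
  define W where "W \<theta> = foot a + (cos \<theta> *\<^sub>R e + sin \<theta> *\<^sub>R f)" for \<theta>
  have W: "W \<theta> \<in> tangents y" for \<theta>
    unfolding W_def a_def by (rule tangent_curve[OF far]) (use e f in \<open>auto simp: a_def\<close>)
  have Wa: "W \<theta> \<bullet> a = r" for \<theta> using W[of \<theta>] by (simp add: tangents_def a_def)
  define z where "z \<theta> = image_pt y (W \<theta>)" for \<theta>
  have cW: "continuous_on UNIV W" unfolding W_def by (intro continuous_intros)
  have cAW: "continuous_on UNIV (\<lambda>\<theta>. A (W \<theta>))"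
    by (rule continuous_on_compose2[OF cont_A[of UNIV] cW]) simp
  have "W \<theta> \<bullet> A (W \<theta>) \<noteq> 0" for \<theta> using tangents_D(2)[OF W[of \<theta>]] by simp
  then have "continuous_on UNIV z"
    unfolding z_def image_pt_def by (intro continuous_intros cW cAW) auto
  then have "connected (range z)" by (rule connected_continuous_image) simp
  moreover have "finite (range z)" using fin image_pt_M[OF y W] by (auto simp: z_def intro: finite_subset)
  ultimately have "\<exists>z0. range z = {z0}" using connected_finite_iff_sing[of "range z"] by auto
  then obtain z0 where z0: "z \<theta> = z0" for \<theta> by blast
  define \<kappa> where "\<kappa> \<theta> = 2 * (W \<theta> \<bullet> y) / (W \<theta> \<bullet> A (W \<theta>))" for \<theta>
  have J0: "J (z0 + y) = \<kappa> \<theta> *\<^sub>R W \<theta>" for \<theta>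
    using z0[of \<theta>] by (auto simp: z_def image_pt_def \<kappa>_def J_simps JA)
  \<comment> \<open>All tangent normals have the same product r with a, so the multiplier \<kappa>
    is constant too.\<close>
  have "J (z0 + y) \<bullet> a = \<kappa> \<theta> * r" for \<theta> unfolding J0[of \<theta>] by (simp add: Wa)
  then have \<kappa>: "\<kappa> \<theta> = \<kappa> 0" for \<theta> using r_pos by (metis mult_right_cancel less_irrefl)
  have "\<kappa> 0 *\<^sub>R W 0 = \<kappa> 0 *\<^sub>R W pi" using J0 \<kappa> by metis
  moreover have "W 0 \<noteq> W pi"
  proof
    assume "W 0 = W pi"
    then have "e = - e" by (simp add: W_def)
    then have "2 *\<^sub>R e = 0" unfolding scaleR_2 by (metis add.right_inverse)
    then show False using e(4) by simp
  qed
  ultimately have "\<kappa> 0 = 0" by simp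
  then have "\<kappa> \<theta> = 0" for \<theta> using \<kappa> by metis
  then have "W \<theta> \<bullet> y = 0" for \<theta>
    using tangents_D(2)[OF W[of \<theta>]] by (metis \<kappa>_def divide_eq_0_iff less_irrefl mult_eq_0_iff zero_neq_numeral)
  from this[of 0] this[of pi] have "foot a \<bullet> y + e \<bullet> y = 0" "foot a \<bullet> y - e \<bullet> y = 0"
    by (simp_all add: W_def inner_add_left inner_diff_left)
  then have "e \<bullet> y = 0" "foot a \<bullet> y = 0" by linarith+
  moreover from this have "a \<bullet> y = 0" using aa r_pos by (simp add: foot_def)
  ultimately show False using e(3) by blast
qed

text \<open>Every path from a point outside \<open>K\<close> to a point of \<open>M\<close> on the level set of \<open>m\<close> enters \<open>M\<close>
  through one of the finitely many nearest points, but such points can be avoided.\<close>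

lemma level_set_in_K:
  assumes x0: "x0 \<bullet> J x0 = m"
  shows "x0 \<in> K"
proof (rule ccontr)
  assume x0K: "x0 \<notin> K"
  define F where "F = {y. \<exists>x. nearest x y}"
  have finF: "finite F" unfolding F_def by (rule finite_nearest)
  have FM: "F \<subseteq> M" by (auto simp: F_def nearest_def)
  \<comment> \<open>The paths end at \<open>y1\<close>, so it must itself avoid F.\<close>
  obtain y1 where y1: "y1 \<in> M" "y1 \<notin> F" using infinite_M finF by (meson finite_subset subsetI)
  have i2: "indep2 x0 y1" by (rule indep2_M[OF x0 x0K y1(1)])
  obtain d0 where "d0 \<noteq> 0" "d0 \<bullet> x0 = 0" "d0 \<bullet> y1 = 0" using orthogonal_exists2[OF dim3] by blast
  define d where "d = d0"
  have "d \<notin> span {x0, y1}"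
  proof
    assume "d \<in> span {x0, y1}"
    then obtain b c where "d = b *\<^sub>R x0 + c *\<^sub>R y1" by (auto simp: in_span2)
    then have "d0 \<bullet> d = 0" using \<open>d0 \<bullet> x0 = 0\<close> \<open>d0 \<bullet> y1 = 0\<close> by (simp add: inner_add_right)
    then show False using \<open>d0 \<noteq> 0\<close> by (simp add: d_def)
  qed
  then have i3: "indep3 x0 y1 d" using i2 by (simp add: indep3_iff)
  \<comment> \<open>A family of paths with common ends. For 0 < t < 1 the coordinates along
    \<open>x0\<close>, \<open>y1\<close>, d determine t and s even up to a positive factor, so
    different paths stay apart after radial projection.\<close>
  define v where "v s t = (1 - t) *\<^sub>R x0 + t *\<^sub>R y1 + (t * (1 - t) * s) *\<^sub>R d" for s t :: real
  have v0: "v s t \<noteq> 0" for s t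
  proof
    assume "v s t = 0"
    then have "1 - t = 0 \<and> t = 0 \<and> t * (1 - t) * s = 0"
      using i3 unfolding indep3_def v_def by blast
    then show False by linarith
  qed
  define bad where "bad s f t c \<longleftrightarrow> f \<in> F \<and> 0 \<le> t \<and> t \<le> 1 \<and> c > 0 \<and> f = c *\<^sub>R v s t" for s f t c
  have bad_unique: "s = s'" if b: "bad s f t c" "bad s' f t' c'" for s s' f t t' c c'
  proof -
    have f: "f \<in> M" and c: "c > 0" and t: "0 \<le> t" "t \<le> 1" using b FM by (auto simp: bad_def)
    have "c *\<^sub>R v s t = c' *\<^sub>R v s' t'" using b by (simp add: bad_def)
    then have "(c * (1 - t)) *\<^sub>R x0 + (c * t) *\<^sub>R y1 + (c * (t * (1 - t) * s)) *\<^sub>R d =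
        (c' * (1 - t')) *\<^sub>R x0 + (c' * t') *\<^sub>R y1 + (c' * (t' * (1 - t') * s')) *\<^sub>R d"
      by (simp add: v_def scaleR_add_right)
    from indep3_D[OF i3 this]
    have q: "c * (1 - t) = c' * (1 - t')" "c * t = c' * t'" "c * (t * (1 - t) * s) = c' * (t' * (1 - t') * s')"
      by auto
    have "c = c'" using q(1,2) by (simp add: algebra_simps)
    then have "t = t'" using q(2) c by simp
    have "t \<noteq> 0"
    proof
      assume "t = 0"
      then have e: "f = c *\<^sub>R x0" using b(1) by (simp add: bad_def v_def)
      have "c * (c * m) = m" using M_D(2)[OF f] x0 by (simp add: e J_simps)
      then have "c * c = 1" using m_pos by (simp add: mult.assoc[symmetric])
      then have "c = 1" using c by (simp add: square_eq_1_iff)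
      then show False using e M_D(1)[OF f] x0K by simp
    qed
    moreover have "t \<noteq> 1"
    proof
      assume "t = 1"
      then have e: "f = c *\<^sub>R y1" using b(1) by (simp add: bad_def v_def)
      have "c * (c * m) = m" using M_D(2)[OF f] M_D(2)[OF y1(1)] by (simp add: e J_simps)
      then have "c * c = 1" using m_pos by (simp add: mult.assoc[symmetric])
      then have "c = 1" using c by (simp add: square_eq_1_iff)
      then show False using e y1 b(1) by (simp add: bad_def)
    qed
    ultimately have "c * (t * (1 - t)) \<noteq> 0" using c by simp
    then show ?thesis using q(3) \<open>c = c'\<close> \<open>t = t'\<close> by simp
  qed
  \<comment> \<open>The parameters whose projected path meets F. Each point of F lies on at most one
    path, so S is finite.\<close>
  define S where "S = {s. \<exists>f t c. bad s f t c}"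
  have "\<forall>s\<in>S. \<exists>f. \<exists>t c. bad s f t c" by (auto simp: S_def)
  then obtain \<phi> where \<phi>: "\<forall>s\<in>S. \<exists>t c. bad s (\<phi> s) t c" by metis
  have "inj_on \<phi> S" unfolding inj_on_def using \<phi> bad_unique by metis
  moreover have "\<phi> ` S \<subseteq> F" using \<phi> by (auto simp: bad_def)
  ultimately have "finite S" using finF by (meson finite_imageD finite_subset)
  then obtain s where s: "s \<notin> S" using ex_new_if_finite[OF infinite_UNIV_char_0] by blast
  define \<sigma> where "\<sigma> t = sqrt (m / (v s t \<bullet> J (v s t))) *\<^sub>R v s t" for t
  have pos: "m / (v s t \<bullet> J (v s t)) > 0" for t using m_pos posJ[OF v0] by simp
  have \<sigma>m: "\<sigma> t \<bullet> J (\<sigma> t) = m" for t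
  proof -
    define c where "c = sqrt (m / (v s t \<bullet> J (v s t)))"
    have "c\<^sup>2 = m / (v s t \<bullet> J (v s t))" unfolding c_def using pos[of t] by (intro real_sqrt_pow2) simp
    moreover have "\<sigma> t \<bullet> J (\<sigma> t) = c\<^sup>2 * (v s t \<bullet> J (v s t))"
      by (simp add: \<sigma>_def c_def[symmetric] J_simps power2_eq_square)
    ultimately show ?thesis using posJ[OF v0[of s t]] by simp
  qed
  have \<sigma>F: "\<sigma> t \<notin> F" if t: "0 \<le> t" "t \<le> 1" for t
  proof
    assume "\<sigma> t \<in> F"
    then have "bad s (\<sigma> t) t (sqrt (m / (v s t \<bullet> J (v s t))))"
      using t pos[of t] by (simp add: bad_def \<sigma>_def)
    then show False using s by (auto simp: S_def)
  qed
  have cv: "continuous_on UNIV (v s)" unfolding v_def by (intro continuous_intros)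
  have cJv: "continuous_on UNIV (\<lambda>t. J (v s t))"
    by (rule continuous_on_compose2[OF cont_J[of UNIV] cv]) simp
  have "v s t \<bullet> J (v s t) \<noteq> 0" for t using posJ[OF v0[of s t]] by simp
  then have c\<sigma>: "continuous_on UNIV \<sigma>" unfolding \<sigma>_def by (intro continuous_intros cv cJv) auto
  define D where "D = {t. \<sigma> t \<in> M}"
  \<comment> \<open>The times at which some point of F maximises the product over \<open>M\<close>.
    Nothing is asked about K, so that this is a finite union of closed sets.\<close>
  define N where "N = (\<Union>f\<in>F. {t. \<forall>z\<in>M. \<sigma> t \<bullet> J z \<le> \<sigma> t \<bullet> J f})"
  have cl: "closed D"
  proof -
    have "D = \<sigma> -` M" by (auto simp: D_def)
    then show ?thesis
      using continuous_closed_vimage[OF compact_imp_closed[OF compact_M], of \<sigma>] c\<sigma>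
      by (simp add: continuous_on_eq_continuous_at)
  qed
  have cN: "closed N"
    unfolding N_def
  proof (intro closed_UN finF ballI)
    fix f
    have "{t. \<forall>z\<in>M. \<sigma> t \<bullet> J z \<le> \<sigma> t \<bullet> J f} = (\<Inter>z\<in>M. {t. \<sigma> t \<bullet> J z \<le> \<sigma> t \<bullet> J f})" by auto
    moreover have "closed {t. \<sigma> t \<bullet> J z \<le> \<sigma> t \<bullet> J f}" for z
      by (intro closed_Collect_le continuous_intros c\<sigma>)
    ultimately show "closed {t. \<forall>z\<in>M. \<sigma> t \<bullet> J z \<le> \<sigma> t \<bullet> J f}" by (simp add: closed_INT)
  qed
  have cover: "t \<in> D \<union> N" for t
  proof (cases "\<sigma> t \<in> K")
    case True
    then show ?thesis using \<sigma>m by (simp add: D_def M_def)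
  next
    case False
    have "\<exists>y\<in>M. \<forall>z\<in>M. \<sigma> t \<bullet> J z \<le> \<sigma> t \<bullet> J y"
      by (intro continuous_attains_sup compact_M continuous_intros cont_J) (use y1 in auto)
    then obtain y where "y \<in> M" "\<forall>z\<in>M. \<sigma> t \<bullet> J z \<le> \<sigma> t \<bullet> J y" by blast
    then have "nearest (\<sigma> t) y" using \<sigma>m False by (simp add: nearest_def)
    then show ?thesis using \<open>\<forall>z\<in>M. _ z\<close> by (auto simp: N_def F_def)
  qed
  \<comment> \<open>For \<sigma> t in \<open>M\<close> the maximum m is attained only at \<sigma> t
    itself, by strict Cauchy-Schwarz, and the path avoids F.\<close>
  have disj: "D \<inter> N \<inter> {0..1} = {}"
  proof (rule ccontr)
    assume "\<not> ?thesis"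
    then obtain t f where t: "0 \<le> t" "t \<le> 1" "\<sigma> t \<in> M" "f \<in> F" "\<forall>z\<in>M. \<sigma> t \<bullet> J z \<le> \<sigma> t \<bullet> J f"
      by (auto simp: D_def N_def)
    then have "m \<le> \<sigma> t \<bullet> J f" using \<sigma>m by metis
    moreover have "\<sigma> t \<bullet> J f < m"
      using t \<sigma>F[OF t(1,2)] FM M_D(2) \<sigma>m by (intro strict_CS) auto
    ultimately show False by simp
  qed
  have "sqrt (m / (x0 \<bullet> J x0)) = 1" "sqrt (m / (y1 \<bullet> J y1)) = 1"
    using x0 M_D(2)[OF y1(1)] m_pos by simp_all
  then have ends: "\<sigma> 0 = x0" "\<sigma> 1 = y1" by (simp_all add: \<sigma>_def v_def)
  have "D \<inter> {0..1} \<noteq> {}" using ends y1 by (force simp: D_def)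
  moreover have "N \<inter> {0..1} \<noteq> {}"
  proof -
    have "0 \<notin> D" using ends x0K M_D(1) by (auto simp: D_def)
    then have "0 \<in> N" using cover[of 0] by blast
    then show ?thesis by force
  qed
  ultimately show False
    using connected_closedD[OF connected_Icc[of "0::real" 1] disj _ cl cN] cover by blast
qed

theorem K_eq: "K = {x. x \<bullet> J x \<le> m}"
proof
  show "K \<subseteq> {x. x \<bullet> J x \<le> m}" using m_upper by blast
  show "{x. x \<bullet> J x \<le> m} \<subseteq> K"
  proof clarify
    fix x assume x: "x \<bullet> J x \<le> m"
    show "x \<in> K"
    proof (cases "x = 0")
      case False
      define t where "t = sqrt (m / (x \<bullet> J x))"
      have q: "x \<bullet> J x > 0" by (rule posJ[OF False])
      have t2: "t\<^sup>2 = m / (x \<bullet> J x)" using q m_pos by (simp add: t_def)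
      have t: "t \<ge> 1" unfolding t_def using x q by simp
      have "(t *\<^sub>R x) \<bullet> J (t *\<^sub>R x) = t\<^sup>2 * (x \<bullet> J x)" by (simp add: J_simps power2_eq_square)
      then have "(t *\<^sub>R x) \<bullet> J (t *\<^sub>R x) = m" using t2 q by simp
      then have "t *\<^sub>R x \<in> K" by (rule level_set_in_K)
      then have "(1 / t) *\<^sub>R (t *\<^sub>R x) + (1 - 1 / t) *\<^sub>R 0 \<in> K"
        by (intro convexD[OF convex_K _ nonempty(2)]) (use t in auto)
      then show ?thesis using t by simp
    qed (use nonempty in simp)
  qed
qed

end

section \<open>Ellipsoids from quadratic forms\<close>

text \<open>Gram-Schmidt for the form of J. The family is indexed by \<open>Basis\<close> so that it
  extends to a linear map of the space to itself.\<close>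

lemma orthonormal_family:
  fixes J :: "'a::euclidean_space \<Rightarrow> 'a"
  assumes J: "linear J" and sym: "\<And>x y. x \<bullet> J y = J x \<bullet> y" and pos: "\<And>x. x \<noteq> 0 \<Longrightarrow> x \<bullet> J x > 0"
    and S: "S \<subseteq> (Basis :: 'a set)"
  shows "\<exists>v. \<forall>i\<in>S. \<forall>j\<in>S. v i \<bullet> J (v j) = (if i = j then 1 else 0)"
proof -
  have "finite S" using S finite_Basis by (rule finite_subset)
  then show ?thesis using S
  proof (induction S rule: finite_induct)
    case (insert b S)
    have "S \<subseteq> Basis" using insert.prems by simp
    from insert.IH[OF this] obtain v where v: "\<forall>i\<in>S. \<forall>j\<in>S. v i \<bullet> J (v j) = (if i = j then 1 else 0)" ..
    have "card S < card (insert b S)" using insert.hyps by simp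
    also have "\<dots> \<le> DIM('a)" using insert.prems by (rule card_mono[OF finite_Basis])
    finally have "card ((\<lambda>i. J (v i)) ` S) < DIM('a)"
      using card_image_le[OF insert(1), of "\<lambda>i. J (v i)"] by linarith
    from orthogonal_exists[OF finite_imageI[OF insert(1)] this]
    obtain x where x: "x \<noteq> 0" "\<forall>y\<in>(\<lambda>i. J (v i)) ` S. x \<bullet> y = 0" by blast
    define u where "u = (1 / sqrt (x \<bullet> J x)) *\<^sub>R x"
    have q: "x \<bullet> J x > 0" by (rule pos[OF x(1)])
    have "sqrt (x \<bullet> J x) * sqrt (x \<bullet> J x) = x \<bullet> J x" using q by simp
    then have uu: "u \<bullet> J u = 1" using q by (simp add: u_def linear_scale[OF J])
    have ui: "u \<bullet> J (v i) = 0" if "i \<in> S" for i using x(2) that by (simp add: u_def)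
    have iu: "v i \<bullet> J u = 0" if "i \<in> S" for i
      using ui[OF that] sym[of "v i" u] inner_commute[of "J (v i)" u] by simp
    have "\<forall>i\<in>insert b S. \<forall>j\<in>insert b S.
        (v(b := u)) i \<bullet> J ((v(b := u)) j) = (if i = j then 1 else 0)"
    proof (intro ballI)
      fix i j assume ij: "i \<in> insert b S" "j \<in> insert b S"
      show "(v(b := u)) i \<bullet> J ((v(b := u)) j) = (if i = j then 1 else 0)"
      proof (cases "i = b")
        case True
        then show ?thesis using ij(2) uu ui[of j] by (cases "j = b") auto
      next
        case False
        then show ?thesis using ij iu[of i] v by (cases "j = b") auto
      qed
    qed
    then show ?case by (rule exI[of _ "v(b := u)"])
  qed simp
qed

lemma ellipsoid_quadratic_form:
  fixes J :: "'a::euclidean_space \<Rightarrow> 'a"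
  assumes J: "linear J" and sym: "\<And>x y. x \<bullet> J y = J x \<bullet> y" and pos: "\<And>x. x \<noteq> 0 \<Longrightarrow> x \<bullet> J x > 0"
    and m: "m > 0"
  shows "ellipsoid {x. x \<bullet> J x \<le> m}"
proof -
  obtain v :: "'a \<Rightarrow> 'a" where v: "\<And>i j. i \<in> Basis \<Longrightarrow> j \<in> Basis \<Longrightarrow> v i \<bullet> J (v j) = (if i = j then 1 else 0)"
    using orthonormal_family[OF J sym pos subset_refl] by blast
  define f where "f y = sqrt m *\<^sub>R (\<Sum>b\<in>Basis. (y \<bullet> b) *\<^sub>R v b)" for y
  have f: "linear f"
    unfolding f_def
    by (rule linearI) (simp_all add: inner_add_left scaleR_add_left scaleR_add_right sum.distrib
        scaleR_sum_right mult.commute mult.left_commute)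
  have fq: "f y \<bullet> J (f y) = m * (y \<bullet> y)" for y
  proof -
    have "(\<Sum>b\<in>Basis. (y \<bullet> b) *\<^sub>R v b) \<bullet> J (\<Sum>c\<in>Basis. (y \<bullet> c) *\<^sub>R v c) =
        (\<Sum>c\<in>Basis. \<Sum>b\<in>Basis. (y \<bullet> c) * ((y \<bullet> b) * (v b \<bullet> J (v c))))"
      by (simp add: linear_sum[OF J] linear_scale[OF J] inner_sum_left inner_sum_right sum_distrib_left)
    also have "\<dots> = (\<Sum>c\<in>Basis. \<Sum>b\<in>Basis. if b = c then (y \<bullet> c) * (y \<bullet> c) else 0)"
      by (intro sum.cong) (auto simp: v)
    also have "\<dots> = y \<bullet> y" by (simp add: euclidean_inner[of y y])
    finally show ?thesis using m by (simp add: f_def linear_scale[OF J] mult.assoc[symmetric])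
  qed
  have "inj f"
    unfolding linear_injective_0[OF f]
  proof (intro allI impI)
    fix y assume "f y = 0"
    then have "m * (y \<bullet> y) = 0" using fq[of y] by simp
    then show "y = 0" using m by simp
  qed
  then have bij: "bij f" using linear_injective_imp_surjective[OF f] by (simp add: bij_def)
  have "{x. x \<bullet> J x \<le> m} = (\<lambda>y. 0 + f y) ` cball 0 1"
  proof (intro equalityI subsetI)
    fix x assume x: "x \<in> {x. x \<bullet> J x \<le> m}"
    obtain y where y: "x = f y" using bij by (metis bij_pointE)
    have "m * (y \<bullet> y) \<le> m" using x fq[of y] by (simp add: y)
    then have "(norm y)\<^sup>2 \<le> 1" using m by (simp add: dot_square_norm)
    then show "x \<in> (\<lambda>y. 0 + f y) ` cball 0 1" using y by (auto simp: power_le_one_iff abs_square_le_1)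
  next
    fix x assume "x \<in> (\<lambda>y. 0 + f y) ` cball 0 1"
    then obtain y where y: "x = f y" "norm y \<le> 1" by auto
    have "(norm y)\<^sup>2 \<le> 1" using y(2) by (simp add: power_le_one)
    then have "m * (y \<bullet> y) \<le> m * 1" using m by (intro mult_left_mono) (auto simp: dot_square_norm)
    then show "x \<in> {x. x \<bullet> J x \<le> m}" using fq[of y] by (simp add: y)
  qed
  then show ?thesis unfolding ellipsoid_def using f bij by blast
qed

context suitable_ball
begin

theorem ellipsoid_K: "ellipsoid K"
proof -
  from polarity obtain A where pol: "linear A \<and> (\<forall>x y. x \<bullet> A y = A x \<bullet> y) \<and>
    (\<forall>x. x \<noteq> 0 \<longrightarrow> x \<bullet> A x > 0) \<and> (\<forall>w. w \<noteq> 0 \<longrightarrow> cen w = (h w / (w \<bullet> A w)) *\<^sub>R A w)" ..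
  then have A: "linear A" by (rule conjunct1)
  note symA = pol[THEN conjunct2, THEN conjunct1, rule_format]
    and posA = pol[THEN conjunct2, THEN conjunct2, THEN conjunct1, rule_format]
    and cenA = pol[THEN conjunct2, THEN conjunct2, THEN conjunct2, rule_format]
  have "inj A"
    unfolding linear_injective_0[OF A] using posA by (metis inner_zero_right less_irrefl)
  then obtain J where J: "linear J" "J \<circ> A = id"
    using linear_injective_left_inverse[OF A] by blast
  have "A \<circ> J = id" using linear_inverse_left[OF A J(1)] J(2) by blast
  then have AJ: "A (J x) = x" for x by (metis comp_apply id_apply)
  interpret reflection_body K p r A J
  proof (rule reflection_body.intro)
    show "(2 * (w \<bullet> y) / (w \<bullet> A w)) *\<^sub>R A w - y \<in> K"
      if w: "norm w = 1" "y \<in> K" "w \<bullet> (y - p) = r" for w y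
    proof -
      have w0: "w \<noteq> 0" using w(1) by auto
      \<comment> \<open>For y in the tangent hyperplane, \<open>h w\<close> can be written as w
        \<bullet> y, which turns the formula for \<open>cen w\<close> into the one required by the
        locale.\<close>
      have hw: "h w = w \<bullet> y" using w by (simp add: h_def inner_diff_right)
      have "2 *\<^sub>R cen w - y \<in> sec w"
        by (rule reflect_cen[OF w0]) (use w hw in \<open>simp add: sec_def\<close>)
      then show ?thesis by (simp add: sec_def cenA[OF w0] hw)
    qed
    show "J (A x) = x" for x using J(2) by (metis comp_apply id_apply)
    show "3 \<le> DIM('a)" by (rule dim3)
    show "compact K" by (rule compact_K)
    show "convex K" by (rule convex_K)
    show "- x \<in> K" if "x \<in> K" for x using that by (rule uminus_K)
    show "r > 0" by (rule r_pos)
    show "cball p r \<subseteq> interior K" by (rule ball_in)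
    show "p \<noteq> 0" by (rule p_ne_0)
    show "linear A" by (rule A)
    show "linear J" by (rule J(1))
    show "A (J x) = x" for x by (rule AJ)
    show "x \<bullet> A y = A x \<bullet> y" for x y by (rule symA)
    show "x \<bullet> A x > 0" if "x \<noteq> 0" for x using that by (rule posA)
  qed
  show ?thesis
    by (subst K_eq) (rule ellipsoid_quadratic_form[OF J(1) symJ posJ m_pos])
qed

end

theorem theorem1:
  fixes K :: "(real ^ 'n) set" and p :: "real ^ 'n" and r :: real
  assumes "CARD('n) \<ge> 3"
    and "strictly_convex_body K"
    and "symmetric_about_origin K"
    and "r > 0"
    and "cball p r \<subseteq> interior K"
    and "0 \<notin> cball p r"
    and "Barker_Larman K (cball p r)"
    and "suitable K (cball p r)"
  shows "ellipsoid K"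
proof -
  interpret suitable_ball K p r
    by unfold_locales (use assms in auto)
  show ?thesis by (rule ellipsoid_K)
qed

end
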